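(* Let $(p:M\to B,\omega_V)$ be a symplectic fibration with connected fibres, and assume that it admits a symplectic connection with hamiltonian curvature. Then there exist a $2$-form $\omega\in\Omega^2(M)$ extending $\omega_V$ (i.e. $\omega|_{\wedge^2\mathcal V}=\omega_V$) and a closed $3$-form $\phi\in\Omega^3(B)$ such that $d\omega=p^*\phi$. Moreover, if the class $[\phi]\in H^3(B)$ vanishes, then $\omega_V$ admits a closed extension, i.e. there exists a closed $2$-form on $M$ whose restriction to the fibres is $\omega_V$.
   Context: All objects are smooth. A fibration $p:M\to B$ is a surjective submersion admitting a complete Ehresmann connection; $\mathcal V=\ker dp$ is the vertical bundle, $\Omega^q(\mathcal V)=\Gamma(\wedge^q\mathcal V^* )$, and $d_V:\Omega^q(\mathcal V)\to\Omega^{q+1}(\mathcal V)$ is the vertical (fibrewise) de Rham differential. An Ehresmann connection is a splitting $TM=\mathcal V\oplus \mathrm{Hor}$; $h:\mathfrak X(B)\to\Gamma(\mathrm{Hor})$ is the horizontal lift and $C(u,v)=[h(u),h(v)]-h([u,v])\in\Gamma(\mathcal V)$ is the curvature. A connection is complete if horizontal lifts of complete vector fields on $B$ are complete. A symplectic fibration is a pair $(M\to B,\omega_V)$, where $\omega_V\in\Omega^2(\mathcal V)$ is fibrewise non-degenerate with $d_V\omega_V=0$, admitting a (complete) symplectic connection, i.e. a connection such that $\mathcal L_{h(u)}\omega_V=0$ for all $u\in\mathfrak X(B)$. Such a connection has hamiltonian curvature if there exists a $C^\infty(B)$-bilinear alternating $2$-form $\omega_H\in\Omega^2(B,C^\infty(M))$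 on $B$ with values in $C^\infty(M)$ such that $i_{C(u,v)}\omega_V=-d_V(\omega_H(u,v))$ for all $u,v\in\mathfrak X(B)$. *)

theory Defs
  imports "HOL-Analysis.Analysis"
begin

section \<open>Smooth manifolds\<close>

text \<open>
  In finite dimension, continuity of all maps \<open>x \<mapsto> Df(x) v\<close> is the same as continuity
  of the Frechet derivative, so this is the usual notion of a \<open>C\<^sup>k\<close> map on an open set.
\<close>

primrec Ck_on :: "nat \<Rightarrow> 'e::real_normed_vector set \<Rightarrow> ('e \<Rightarrow> 'f::real_normed_vector) \<Rightarrow> bool" where
  "Ck_on 0 S f \<longleftrightarrow> continuous_on S f"
| "Ck_on (Suc k) S f \<longleftrightarrow>
     (\<forall>x\<in>S. f differentiable (at x)) \<and> (\<forall>v. Ck_on k S (\<lambda>x. frechet_derivative f (at x) v))"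

definition smooth_on :: "'e::real_normed_vector set \<Rightarrow> ('e \<Rightarrow> 'f::real_normed_vector) \<Rightarrow> bool" where
  "smooth_on S f \<longleftrightarrow> (\<forall>k. Ck_on k S f)"

type_synonym ('m, 'e) atlas = "('m set \<times> ('m \<Rightarrow> 'e)) set"

text \<open>
  The manifold is the whole type \<open>'m\<close>; Hausdorffness and second countability will come from
  its sort.  The model space is a finite-dimensional inner product space rather than an instance
  of \<^class>\<open>euclidean_space\<close>, because that class excludes dimension 0 (and so, for
  instance, a one-point base).
\<close>

definition smooth_atlas :: "('m::topological_space, 'e::real_inner) atlas \<Rightarrow> bool" where
  "smooth_atlas A \<longleftrightarrow>
     (\<exists>S. finite S \<and> span S = (UNIV :: 'e set)) \<and>
     (\<Union>(U, \<phi>)\<in>A. U) = UNIV \<and>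
     (\<forall>(U, \<phi>)\<in>A. open U \<and> open (\<phi> ` U) \<and> (\<exists>\<phi>'. homeomorphism U (\<phi> ` U) \<phi> \<phi>')) \<and>
     (\<forall>(U, \<phi>)\<in>A. \<forall>(V, \<psi>)\<in>A. smooth_on (\<phi> ` (U \<inter> V)) (\<psi> \<circ> inv_into U \<phi>))"

definition smooth_fun :: "('m::topological_space, 'e::real_inner) atlas \<Rightarrow> ('m \<Rightarrow> real) \<Rightarrow> bool" where
  "smooth_fun A f \<longleftrightarrow> (\<forall>(U, \<phi>)\<in>A. smooth_on (\<phi> ` U) (f \<circ> inv_into U \<phi>))"

definition smooth_map ::
  "('m::topological_space, 'e::real_inner) atlas \<Rightarrow> ('b::topological_space, 'd::real_inner) atlas
     \<Rightarrow> ('m \<Rightarrow> 'b) \<Rightarrow> bool" where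
  "smooth_map A B p \<longleftrightarrow>
     continuous_on UNIV p \<and>
     (\<forall>(U, \<phi>)\<in>A. \<forall>(V, \<psi>)\<in>B. smooth_on (\<phi> ` (U \<inter> p -` V)) (\<psi> \<circ> p \<circ> inv_into U \<phi>))"


section \<open>Tangent vectors, distributions and vector fields\<close>

text \<open>
  A tangent vector at \<open>x\<close> is a derivation at \<open>x\<close> of the algebra of smooth functions.  As a HOL
  function it is defined on all functions; requiring the value 0 on non-smooth ones makes the
  representation unique.
\<close>

type_synonym 'm tvec = "('m \<Rightarrow> real) \<Rightarrow> real"
type_synonym 'm vfield = "'m \<Rightarrow> 'm tvec"
type_synonym 'm distribution = "'m \<Rightarrow> 'm tvec set"

definition tangent :: "('m::topological_space, 'e::real_inner) atlas \<Rightarrow> 'm distribution" where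
  "tangent A x =
     {v. (\<forall>f g a b. smooth_fun A f \<longrightarrow> smooth_fun A g \<longrightarrow>
             v (\<lambda>y. a * f y + b * g y) = a * v f + b * v g) \<and>
         (\<forall>f g. smooth_fun A f \<longrightarrow> smooth_fun A g \<longrightarrow>
             v (\<lambda>y. f y * g y) = v f * g x + f x * v g) \<and>
         (\<forall>f. \<not> smooth_fun A f \<longrightarrow> v f = 0)}"

definition tzero :: "'m tvec" where
  "tzero = (\<lambda>f. 0)"

definition tlin :: "real \<Rightarrow> 'm tvec \<Rightarrow> real \<Rightarrow> 'm tvec \<Rightarrow> 'm tvec" where
  "tlin a v b w = (\<lambda>f. a * v f + b * w f)"

definition sections ::
  "('m::topological_space, 'e::real_inner) atlas \<Rightarrow> 'm distribution \<Rightarrow> 'm vfield set" where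
  "sections A D =
     {X. (\<forall>x. X x \<in> D x) \<and> (\<forall>f. smooth_fun A f \<longrightarrow> smooth_fun A (\<lambda>x. X x f))}"

abbreviation vfields :: "('m::topological_space, 'e::real_inner) atlas \<Rightarrow> 'm vfield set" where
  "vfields A \<equiv> sections A (tangent A)"

definition lie_bracket :: "'m vfield \<Rightarrow> 'm vfield \<Rightarrow> 'm vfield" where
  "lie_bracket X Y = (\<lambda>x f. X x (\<lambda>y. Y y f) - Y x (\<lambda>y. X y f))"

definition complete_vfield ::
  "('m::topological_space, 'e::real_inner) atlas \<Rightarrow> 'm vfield \<Rightarrow> bool" where
  "complete_vfield A X \<longleftrightarrow>
     (\<forall>x. \<exists>\<gamma> :: real \<Rightarrow> 'm. continuous_on UNIV \<gamma> \<and> \<gamma> 0 = x \<and>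
        (\<forall>f t. smooth_fun A f \<longrightarrow> ((f \<circ> \<gamma>) has_real_derivative X (\<gamma> t) f) (at t)))"

definition differential ::
  "('b::topological_space, 'd::real_inner) atlas \<Rightarrow> ('m \<Rightarrow> 'b) \<Rightarrow> 'm tvec \<Rightarrow> 'b tvec" where
  "differential B p v = (\<lambda>f. if smooth_fun B f then v (f \<circ> p) else 0)"


section \<open>Forms along a distribution\<close>

text \<open>
  \<open>form A D q \<omega>\<close> says that \<open>\<omega>\<close> is a smooth section of the \<open>q\<close>-th exterior power of the dual of
  \<open>D\<close>: for \<open>D\<close> the tangent bundle these are the differential forms, for \<open>D\<close> the vertical bundle
  the vertical forms.  Arguments are lists of length \<open>q\<close>; the values of \<open>\<omega> x\<close> on lists of another
  length, or with entries outside \<open>D x\<close>, are irrelevant.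
\<close>

type_synonym 'm form = "'m \<Rightarrow> 'm tvec list \<Rightarrow> real"

definition apply_form :: "'m form \<Rightarrow> 'm vfield list \<Rightarrow> 'm \<Rightarrow> real" where
  "apply_form \<omega> Xs = (\<lambda>x. \<omega> x (map (\<lambda>X. X x) Xs))"

definition alternating_on :: "'m tvec set \<Rightarrow> nat \<Rightarrow> ('m tvec list \<Rightarrow> real) \<Rightarrow> bool" where
  "alternating_on V q \<alpha> \<longleftrightarrow>
     (\<forall>vs i a b v w. length vs = q \<longrightarrow> set vs \<subseteq> V \<longrightarrow> i < q \<longrightarrow> v \<in> V \<longrightarrow> w \<in> V \<longrightarrow>
        \<alpha> (vs[i := tlin a v b w]) = a * \<alpha> (vs[i := v]) + b * \<alpha> (vs[i := w])) \<and>
     (\<forall>vs i j. length vs = q \<longrightarrow> set vs \<subseteq> V \<longrightarrow> i < j \<longrightarrow> j < q \<longrightarrow> vs ! i = vs ! j \<longrightarrow> \<alpha> vs = 0)"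

definition form ::
  "('m::topological_space, 'e::real_inner) atlas \<Rightarrow> 'm distribution \<Rightarrow> nat \<Rightarrow> 'm form \<Rightarrow> bool" where
  "form A D q \<omega> \<longleftrightarrow>
     (\<forall>x. alternating_on (D x) q (\<omega> x)) \<and>
     (\<forall>Xs. length Xs = q \<longrightarrow> set Xs \<subseteq> sections A D \<longrightarrow> smooth_fun A (apply_form \<omega> Xs))"

definition drop_nth :: "nat \<Rightarrow> 'a list \<Rightarrow> 'a list" where
  "drop_nth i xs = take i xs @ drop (Suc i) xs"

text \<open>
  \<open>ext_d \<omega> [X\<^sub>0, \<dots>, X\<^sub>q]\<close> is the function \<open>d\<omega>(X\<^sub>0, \<dots>, X\<^sub>q)\<close>, given by the invariant formula for the
  exterior derivative.  On the sections of an involutive distribution \<open>D\<close> the same formula is the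
  de Rham differential along the leaves; for the vertical bundle this is the fibrewise de Rham
  differential \<open>d\<^sub>V\<close>.
\<close>

definition ext_d :: "'m form \<Rightarrow> 'm vfield list \<Rightarrow> 'm \<Rightarrow> real" where
  "ext_d \<omega> Xs x =
     (\<Sum>i<length Xs. (-1) ^ i * (Xs ! i) x (apply_form \<omega> (drop_nth i Xs))) +
     (\<Sum>j<length Xs. \<Sum>i<j. (-1) ^ (i + j) *
        apply_form \<omega> (lie_bracket (Xs ! i) (Xs ! j) # drop_nth i (drop_nth j Xs)) x)"

definition fun_form :: "('m \<Rightarrow> real) \<Rightarrow> 'm form" where
  "fun_form f = (\<lambda>x vs. f x)"

definition closed_form ::
  "('m::topological_space, 'e::real_inner) atlas \<Rightarrow> 'm distribution \<Rightarrow> nat \<Rightarrow> 'm form \<Rightarrow> bool" where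
  "closed_form A D q \<omega> \<longleftrightarrow>
     form A D q \<omega> \<and>
     (\<forall>Xs x. length Xs = Suc q \<longrightarrow> set Xs \<subseteq> sections A D \<longrightarrow> ext_d \<omega> Xs x = 0)"

definition deRham_class ::
  "('m::topological_space, 'e::real_inner) atlas \<Rightarrow> nat \<Rightarrow> 'm form \<Rightarrow> 'm form set" where
  "deRham_class A q \<omega> =
     {\<psi>. closed_form A (tangent A) q \<psi> \<and>
         (\<exists>\<beta>. form A (tangent A) (q - 1) \<beta> \<and>
           (\<forall>Xs x. length Xs = q \<longrightarrow> set Xs \<subseteq> vfields A \<longrightarrow>
              apply_form \<psi> Xs x - apply_form \<omega> Xs x = ext_d \<beta> Xs x))}"

definition pullback ::
  "('b::topological_space, 'd::real_inner) atlas \<Rightarrow> ('m \<Rightarrow> 'b) \<Rightarrow> 'b form \<Rightarrow> 'm form" where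
  "pullback B p \<phi> = (\<lambda>x vs. \<phi> (p x) (map (differential B p) vs))"

definition lie_deriv :: "'m vfield \<Rightarrow> 'm form \<Rightarrow> 'm vfield list \<Rightarrow> 'm \<Rightarrow> real" where
  "lie_deriv Z \<omega> Xs x =
     Z x (apply_form \<omega> Xs) -
     (\<Sum>i<length Xs. apply_form \<omega> (Xs[i := lie_bracket Z (Xs ! i)]) x)"


section \<open>Fibrations and Ehresmann connections\<close>

definition vertical ::
  "('m::topological_space, 'e::real_inner) atlas \<Rightarrow> ('b::topological_space, 'd::real_inner) atlas
     \<Rightarrow> ('m \<Rightarrow> 'b) \<Rightarrow> 'm distribution" where
  "vertical A B p x = {v \<in> tangent A x. differential B p v = tzero}"

text \<open>
  Smoothness of the subbundle \<open>Hor\<close> (whose rank is constant, being complementary to the vertical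
  bundle of a submersion) is expressed by the existence of smooth sections through each of its
  vectors.
\<close>

definition ehresmann_connection ::
  "('m::topological_space, 'e::real_inner) atlas \<Rightarrow> ('b::topological_space, 'd::real_inner) atlas
     \<Rightarrow> ('m \<Rightarrow> 'b) \<Rightarrow> 'm distribution \<Rightarrow> bool" where
  "ehresmann_connection A B p Hor \<longleftrightarrow>
     (\<forall>x. Hor x \<subseteq> tangent A x \<and> tzero \<in> Hor x \<and>
        (\<forall>v\<in>Hor x. \<forall>w\<in>Hor x. \<forall>a b. tlin a v b w \<in> Hor x)) \<and>
     (\<forall>x. \<forall>v\<in>tangent A x. \<exists>v\<^sub>1\<in>vertical A B p x. \<exists>v\<^sub>2\<in>Hor x. v = tlin 1 v\<^sub>1 1 v\<^sub>2) \<and>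
     (\<forall>x. vertical A B p x \<inter> Hor x = {tzero}) \<and>
     (\<forall>x. \<forall>v\<in>Hor x. \<exists>X\<in>sections A Hor. X x = v)"

definition hlift ::
  "('b::topological_space, 'd::real_inner) atlas \<Rightarrow> ('m \<Rightarrow> 'b) \<Rightarrow> 'm distribution
     \<Rightarrow> 'b vfield \<Rightarrow> 'm vfield" where
  "hlift B p Hor u = (\<lambda>x. THE v. v \<in> Hor x \<and> differential B p v = u (p x))"

definition curvature ::
  "('b::topological_space, 'd::real_inner) atlas \<Rightarrow> ('m \<Rightarrow> 'b) \<Rightarrow> 'm distribution
     \<Rightarrow> 'b vfield \<Rightarrow> 'b vfield \<Rightarrow> 'm vfield" where
  "curvature B p Hor u v =
     (\<lambda>x. tlin 1 (lie_bracket (hlift B p Hor u) (hlift B p Hor v) x)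
               (-1) (hlift B p Hor (lie_bracket u v) x))"

definition complete_connection ::
  "('m::topological_space, 'e::real_inner) atlas \<Rightarrow> ('b::topological_space, 'd::real_inner) atlas
     \<Rightarrow> ('m \<Rightarrow> 'b) \<Rightarrow> 'm distribution \<Rightarrow> bool" where
  "complete_connection A B p Hor \<longleftrightarrow>
     ehresmann_connection A B p Hor \<and>
     (\<forall>u\<in>vfields B. complete_vfield B u \<longrightarrow> complete_vfield A (hlift B p Hor u))"

definition submersion ::
  "('m::topological_space, 'e::real_inner) atlas \<Rightarrow> ('b::topological_space, 'd::real_inner) atlas
     \<Rightarrow> ('m \<Rightarrow> 'b) \<Rightarrow> bool" where
  "submersion A B p \<longleftrightarrow>
     smooth_map A B p \<and> (\<forall>x. differential B p ` tangent A x = tangent B (p x))"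

definition fibration ::
  "('m::{second_countable_topology, t2_space}, 'e::real_inner) atlas
     \<Rightarrow> ('b::{second_countable_topology, t2_space}, 'd::real_inner) atlas \<Rightarrow> ('m \<Rightarrow> 'b) \<Rightarrow> bool" where
  "fibration A B p \<longleftrightarrow>
     smooth_atlas A \<and> smooth_atlas B \<and> submersion A B p \<and> surj p \<and>
     (\<exists>Hor. complete_connection A B p Hor)"


section \<open>Symplectic fibrations\<close>

definition fibrewise_nondegenerate ::
  "('m::topological_space, 'e::real_inner) atlas \<Rightarrow> ('b::topological_space, 'd::real_inner) atlas
     \<Rightarrow> ('m \<Rightarrow> 'b) \<Rightarrow> 'm form \<Rightarrow> bool" where
  "fibrewise_nondegenerate A B p \<omega>\<^sub>V \<longleftrightarrow>
     (\<forall>x. \<forall>v\<in>vertical A B p x. (\<forall>w\<in>vertical A B p x. \<omega>\<^sub>V x [v, w] = 0) \<longrightarrow> v = tzero)"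

definition symplectic_connection ::
  "('m::topological_space, 'e::real_inner) atlas \<Rightarrow> ('b::topological_space, 'd::real_inner) atlas
     \<Rightarrow> ('m \<Rightarrow> 'b) \<Rightarrow> 'm form \<Rightarrow> 'm distribution \<Rightarrow> bool" where
  "symplectic_connection A B p \<omega>\<^sub>V Hor \<longleftrightarrow>
     ehresmann_connection A B p Hor \<and>
     (\<forall>u\<in>vfields B. \<forall>X\<in>sections A (vertical A B p). \<forall>Y\<in>sections A (vertical A B p). \<forall>x.
        lie_deriv (hlift B p Hor u) \<omega>\<^sub>V [X, Y] x = 0)"

definition symplectic_fibration ::
  "('m::{second_countable_topology, t2_space}, 'e::real_inner) atlas
     \<Rightarrow> ('b::{second_countable_topology, t2_space}, 'd::real_inner) atlas
     \<Rightarrow> ('m \<Rightarrow> 'b) \<Rightarrow> 'm form \<Rightarrow> bool" where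
  "symplectic_fibration A B p \<omega>\<^sub>V \<longleftrightarrow>
     fibration A B p \<and>
     closed_form A (vertical A B p) 2 \<omega>\<^sub>V \<and>
     fibrewise_nondegenerate A B p \<omega>\<^sub>V \<and>
     (\<exists>Hor. complete_connection A B p Hor \<and> symplectic_connection A B p \<omega>\<^sub>V Hor)"

text \<open>
  The elements of \<open>\<Omega>\<^sup>2(B, C\<^sup>\<infinity>(M))\<close>, as alternating bilinear maps on vector fields of \<open>B\<close>;
  \<open>C\<^sup>\<infinity>(B)\<close> acts on \<open>C\<^sup>\<infinity>(M)\<close> through \<open>p\<close>.
\<close>

definition function_valued_two_form ::
  "('m::topological_space, 'e::real_inner) atlas \<Rightarrow> ('b::topological_space, 'd::real_inner) atlas
     \<Rightarrow> ('m \<Rightarrow> 'b) \<Rightarrow> ('b vfield \<Rightarrow> 'b vfield \<Rightarrow> 'm \<Rightarrow> real) \<Rightarrow> bool" where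
  "function_valued_two_form A B p \<omega>\<^sub>H \<longleftrightarrow>
     (\<forall>u\<in>vfields B. \<forall>v\<in>vfields B. smooth_fun A (\<omega>\<^sub>H u v)) \<and>
     (\<forall>u\<in>vfields B. \<forall>x. \<omega>\<^sub>H u u x = 0) \<and>
     (\<forall>u\<in>vfields B. \<forall>v\<in>vfields B. \<forall>w\<in>vfields B. \<forall>f g x. smooth_fun B f \<longrightarrow> smooth_fun B g \<longrightarrow>
        \<omega>\<^sub>H (\<lambda>b. tlin (f b) (u b) (g b) (v b)) w x = f (p x) * \<omega>\<^sub>H u w x + g (p x) * \<omega>\<^sub>H v w x \<and>
        \<omega>\<^sub>H w (\<lambda>b. tlin (f b) (u b) (g b) (v b)) x = f (p x) * \<omega>\<^sub>H w u x + g (p x) * \<omega>\<^sub>H w v x)"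

definition hamiltonian_curvature ::
  "('m::topological_space, 'e::real_inner) atlas \<Rightarrow> ('b::topological_space, 'd::real_inner) atlas
     \<Rightarrow> ('m \<Rightarrow> 'b) \<Rightarrow> 'm form \<Rightarrow> 'm distribution \<Rightarrow> bool" where
  "hamiltonian_curvature A B p \<omega>\<^sub>V Hor \<longleftrightarrow>
     (\<exists>\<omega>\<^sub>H. function_valued_two_form A B p \<omega>\<^sub>H \<and>
        (\<forall>u\<in>vfields B. \<forall>v\<in>vfields B. \<forall>Y\<in>sections A (vertical A B p). \<forall>x.
           apply_form \<omega>\<^sub>V [curvature B p Hor u v, Y] x = - ext_d (fun_form (\<omega>\<^sub>H u v)) [Y] x))"

definition extends_vertical ::
  "('m::topological_space, 'e::real_inner) atlas \<Rightarrow> ('b::topological_space, 'd::real_inner) atlas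
     \<Rightarrow> ('m \<Rightarrow> 'b) \<Rightarrow> 'm form \<Rightarrow> 'm form \<Rightarrow> bool" where
  "extends_vertical A B p \<omega> \<omega>\<^sub>V \<longleftrightarrow>
     (\<forall>x. \<forall>v\<in>vertical A B p x. \<forall>w\<in>vertical A B p x. \<omega> x [v, w] = \<omega>\<^sub>V x [v, w])"

definition closed_up_to_base ::
  "('m::topological_space, 'e::real_inner) atlas \<Rightarrow> ('b::topological_space, 'd::real_inner) atlas
     \<Rightarrow> ('m \<Rightarrow> 'b) \<Rightarrow> 'm form \<Rightarrow> 'm form \<Rightarrow> 'b form \<Rightarrow> bool" where
  "closed_up_to_base A B p \<omega>\<^sub>V \<omega> \<phi> \<longleftrightarrow>
     form A (tangent A) 2 \<omega> \<and> extends_vertical A B p \<omega> \<omega>\<^sub>V \<and>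
     closed_form B (tangent B) 3 \<phi> \<and>
     (\<forall>X\<in>vfields A. \<forall>Y\<in>vfields A. \<forall>Z\<in>vfields A. \<forall>x.
        ext_d \<omega> [X, Y, Z] x = apply_form (pullback B p \<phi>) [X, Y, Z] x)"

end

theory Submission
  imports Defs
begin

text \<open>
  A symplectic connection \<open>Hor\<close> extends \<open>\<omega>\<^sub>V\<close> by zero on horizontal vectors; with \<open>\<omega>\<^sub>H\<close> the hamiltonian of the
  curvature, let \<open>\<omega> = \<omega>\<^sub>V - \<omega>\<^sub>H\<close>.  Fibrewise closedness, \<open>L\<^sub>h\<^sub>u \<omega>\<^sub>V = 0\<close> and the hamiltonian condition say
  exactly that \<open>d\<omega>\<close> vanishes as soon as one argument is vertical.  Then \<open>d d\<omega> = 0\<close> shows that the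
  functions \<open>d\<omega>(h u, h v, h w)\<close> are killed by vertical vectors, so on connected fibres they descend to
  the base and define \<open>\<phi>\<close> with \<open>d\<omega> = p\<^sup>* \<phi>\<close>; applying \<open>d d\<omega> = 0\<close> to horizontal lifts gives \<open>d\<phi> = 0\<close>.
  If \<open>\<phi> = d\<beta>\<close>, then \<open>\<omega> - p\<^sup>* \<beta>\<close> is a closed extension.
\<close>


section \<open>Finite-dimensional inner product spaces\<close>

text \<open>Tangent vectors are derivations, and d is given by the invariant formula on global
  vector fields. Pointwise statements therefore need global extensions of local data (cutoffs),
  coordinates for derivations (Hadamard's lemma), and the linearity of d\<omega> over smooth
  functions, which allows an identity at a point to be checked on vertical fields and horizontal
  lifts, whatever fields were given.

  The delicate step is the descent to the base: a function constant on the fibres of p has to be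
  smooth as a function on B. In place of smooth local sections of p, a Lipschitz straightening of p
  in charts gives a differentiable function on the base. Its derivatives pull back to the functions
  h(u) f, and since [X, h(u)] is vertical for vertical X, these are again killed by vertical
  vectors; so the argument repeats at every order.

  The sign of \<omega>_H in \<omega> comes from the convention i_C \<omega>_V = - d_V \<omega>_H: in
  d\<omega>(X, h u, h v) the terms X(\<omega>(h u, h v)) and \<omega>([h u, h v], X) have to
  cancel.\<close>

definition orthonormal_basis :: "'e::real_inner set \<Rightarrow> bool" where
  "orthonormal_basis E \<longleftrightarrow> finite E \<and> (\<forall>u\<in>E. \<forall>v\<in>E. u \<bullet> v = (if u = v then 1 else 0)) \<and>
     (\<forall>x. x = (\<Sum>e\<in>E. (x \<bullet> e) *\<^sub>R e))"

lemma orthonormal_basis_finite: "orthonormal_basis E \<Longrightarrow> finite E"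
  and orthonormal_basis_inner: "orthonormal_basis E \<Longrightarrow> u \<in> E \<Longrightarrow> v \<in> E \<Longrightarrow> u \<bullet> v = (if u = v then 1 else 0)"
  and orthonormal_basis_expand: "orthonormal_basis E \<Longrightarrow> (\<Sum>e\<in>E. (x \<bullet> e) *\<^sub>R e) = x"
  by (auto simp: orthonormal_basis_def)

lemma orthonormal_basis_norm: "orthonormal_basis E \<Longrightarrow> u \<in> E \<Longrightarrow> norm u = 1"
  by (simp add: norm_eq_sqrt_inner orthonormal_basis_inner)

lemma orthonormal_basis_real: "orthonormal_basis {1::real}"
  by (simp add: orthonormal_basis_def)

text \<open>Gram-Schmidt: what remains of \<open>a\<close> after subtracting its projection to the
  span of \<open>E\<close> is normalised and added to \<open>E\<close>; if nothing remains,
  \<open>a\<close> already lies in that span.\<close>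

lemma orthonormal_spanning_set:
  fixes S :: "'e::real_inner set"
  assumes "finite S"
  shows "\<exists>E. finite E \<and> (\<forall>u\<in>E. \<forall>v\<in>E. u \<bullet> v = (if u = v then 1 else 0)) \<and> span S \<subseteq> span E"
  using assms
proof (induction S)
  case empty
  show ?case by (rule exI[of _ "{}"]) auto
next
  case (insert a S)
  then obtain E where E: "finite E" "\<And>u v. u \<in> E \<Longrightarrow> v \<in> E \<Longrightarrow> u \<bullet> v = (if u = v then 1 else 0)"
    "span S \<subseteq> span E" by blast
  define a' where "a' = a - (\<Sum>e\<in>E. (a \<bullet> e) *\<^sub>R e)"
  have proj: "(\<Sum>e\<in>E. (a \<bullet> e) *\<^sub>R e) \<in> span E"
    by (intro span_sum span_scale span_base)
  have orth: "a' \<bullet> f = 0" if "f \<in> E" for f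
  proof -
    have "(\<Sum>e\<in>E. (a \<bullet> e) *\<^sub>R e) \<bullet> f = (\<Sum>e\<in>E. if e = f then a \<bullet> e else 0)"
      unfolding inner_sum_left using E(2) that by (intro sum.cong) auto
    also have "\<dots> = a \<bullet> f" using E(1) that by simp
    finally show ?thesis by (simp add: a'_def inner_diff_left)
  qed
  show ?case
  proof (cases "a' = 0")
    case True
    then have "a \<in> span E" using proj by (simp add: a'_def)
    moreover have "S \<subseteq> span E" using E(3) span_superset by blast
    ultimately have "span (insert a S) \<subseteq> span E" by (intro span_minimal) auto
    then show ?thesis using E by blast
  next
    case False
    define e' where "e' = (1 / norm a') *\<^sub>R a'"
    have e'1: "e' \<bullet> e' = 1" using False by (simp add: e'_def dot_square_norm power2_eq_square)
    have e'2: "e' \<bullet> f = 0" "f \<bullet> e' = 0" if "f \<in> E" for f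
      using orth[OF that] by (simp_all add: e'_def inner_commute)
    have "S \<subseteq> span (insert e' E)"
      using E(3) span_superset span_mono[of E "insert e' E"] by blast
    moreover have "a = norm a' *\<^sub>R e' + (\<Sum>e\<in>E. (a \<bullet> e) *\<^sub>R e)"
      using False by (simp add: e'_def a'_def)
    then have "a \<in> span (insert e' E)"
      using proj span_mono[of E "insert e' E"]
      by (metis insertI1 span_add span_base span_scale subset_insertI subsetD)
    ultimately have "span (insert a S) \<subseteq> span (insert e' E)" by (intro span_minimal) auto
    moreover have "\<forall>u\<in>insert e' E. \<forall>v\<in>insert e' E. u \<bullet> v = (if u = v then 1 else 0)"
    proof (intro ballI)
      fix u v assume "u \<in> insert e' E" "v \<in> insert e' E"
      moreover have "e' \<notin> E" using e'1 e'2 by force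
      ultimately show "u \<bullet> v = (if u = v then 1 else 0)" using E(2) e'1 e'2 by auto
    qed
    moreover have "finite (insert e' E)" using E(1) by simp
    ultimately show ?thesis by (intro exI[of _ "insert e' E"] conjI)
  qed
qed

lemma orthonormal_basis_exists:
  fixes S :: "'e::real_inner set"
  assumes "finite S" "span S = UNIV"
  shows "\<exists>E::'e set. orthonormal_basis E"
proof -
  obtain E where E: "finite E" "\<forall>u\<in>E. \<forall>v\<in>E. u \<bullet> v = (if u = v then 1 else 0)"
    and "span S \<subseteq> span E" using orthonormal_spanning_set[OF assms(1)] by (elim exE conjE)
  then have span: "span E = (UNIV :: 'e set)" using assms(2) by (simp add: top.extremum_unique)
  have "x = (\<Sum>e\<in>E. (x \<bullet> e) *\<^sub>R e)" for x
  proof -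
    have "x \<in> range (\<lambda>u. \<Sum>v\<in>E. u v *\<^sub>R v)" using span span_finite[OF E(1)] by simp
    then obtain u where u: "x = (\<Sum>v\<in>E. u v *\<^sub>R v)" by auto
    have "x \<bullet> f = u f" if "f \<in> E" for f
    proof -
      have "x \<bullet> f = (\<Sum>e\<in>E. if e = f then u e else 0)"
        unfolding u inner_sum_left using E(2) that by (intro sum.cong) auto
      then show ?thesis using E(1) that by simp
    qed
    then show ?thesis using u by simp
  qed
  then have "orthonormal_basis E" using E unfolding orthonormal_basis_def by simp
  then show ?thesis ..
qed

text \<open>In coordinates with respect to \<open>E\<close> the ball is a closed part of a box, and
  the box is compact because it arises by repeatedly taking a product with an interval and a
  continuous image.\<close>

lemma compact_cball_finite_dimensional:
  fixes c :: "'e::real_inner"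
  assumes "orthonormal_basis (E :: 'e set)"
  shows "compact (cball c r)"
proof -
  have box: "compact {x. \<exists>a. (\<forall>e\<in>F. \<bar>a e\<bar> \<le> R) \<and> x = (\<Sum>e\<in>F. a e *\<^sub>R (e::'e))}" if "finite F" for F and R :: real
    using that
  proof (induction F)
    case empty
    show ?case by simp
  next
    case (insert e F)
    let ?K = "\<lambda>F. {x. \<exists>a. (\<forall>e\<in>F. \<bar>a e\<bar> \<le> R) \<and> x = (\<Sum>e\<in>F. a e *\<^sub>R e)}"
    have "?K (insert e F) = (\<lambda>(s, x). s *\<^sub>R e + x) ` ({-R..R} \<times> ?K F)"
    proof (intro set_eqI iffI)
      fix x assume "x \<in> ?K (insert e F)"
      then show "x \<in> (\<lambda>(s, x). s *\<^sub>R e + x) ` ({-R..R} \<times> ?K F)"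
        using insert.hyps by (force simp: abs_le_iff intro!: image_eqI)
    next
      fix x assume "x \<in> (\<lambda>(s, x). s *\<^sub>R e + x) ` ({-R..R} \<times> ?K F)"
      then obtain s a where sa: "s \<in> {-R..R}" "\<forall>e\<in>F. \<bar>a e\<bar> \<le> R" "x = s *\<^sub>R e + (\<Sum>e\<in>F. a e *\<^sub>R e)"
        by auto
      have "(\<Sum>f\<in>F. a f *\<^sub>R f) = (\<Sum>f\<in>F. (a(e := s)) f *\<^sub>R f)"
        using insert.hyps by (intro sum.cong) auto
      then show "x \<in> ?K (insert e F)" using sa insert.hyps
        by (intro CollectI exI[of _ "a(e := s)"]) (auto simp: abs_le_iff)
    qed
    moreover have "compact \<dots>"
      by (intro compact_continuous_image compact_Times insert.IH)
        (auto simp: case_prod_unfold intro!: continuous_intros)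
    ultimately show ?case by simp
  qed
  define R where "R = norm c + \<bar>r\<bar>"
  let ?K = "{x. \<exists>a. (\<forall>e\<in>E. \<bar>a e\<bar> \<le> R) \<and> x = (\<Sum>e\<in>E. a e *\<^sub>R e)}"
  have "cball c r \<subseteq> ?K"
  proof
    fix x assume "x \<in> cball c r"
    then have "norm x \<le> R" unfolding R_def mem_cball dist_norm
      by (smt (verit) norm_minus_commute norm_triangle_sub)
    then have "\<bar>x \<bullet> e\<bar> \<le> R" if "e \<in> E" for e
      using Cauchy_Schwarz_ineq2[of x e] orthonormal_basis_norm[OF assms that] by simp
    then show "x \<in> ?K" using orthonormal_basis_expand[OF assms, of x]
      by (intro CollectI exI[of _ "\<lambda>e. x \<bullet> e"]) auto
  qed
  then have "cball c r = ?K \<inter> cball c r" by (simp add: Int_absorb1)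
  moreover have "compact (?K \<inter> cball c r)"
    by (intro compact_Int_closed closed_cball box orthonormal_basis_finite[OF assms])
  ultimately show ?thesis by simp
qed


section \<open>Smooth functions on open sets\<close>

lemma Ck_on_subset: "Ck_on k S f \<Longrightarrow> T \<subseteq> S \<Longrightarrow> Ck_on k T f"
  by (induction k arbitrary: f) (auto intro: continuous_on_subset)

text \<open>Openness of \<open>S\<close> matters because \<open>Ck_on\<close> uses the full
  derivative \<open>at x\<close> and not the derivative within \<open>S\<close>: functions that
  agree near \<open>x\<close> have the same one.\<close>

lemma Ck_on_cong:
  assumes "open S" "\<And>x. x \<in> S \<Longrightarrow> f x = g x" "Ck_on k S f"
  shows "Ck_on k S g"
  using assms(2,3)
proof (induction k arbitrary: f g)
  case 0
  then show ?case using continuous_on_cong by (metis Ck_on.simps(1))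
next
  case (Suc k)
  have D: "(g has_derivative frechet_derivative f (at x)) (at x)" if "x \<in> S" for x
  proof -
    have "(f has_derivative frechet_derivative f (at x)) (at x)"
      using Suc.prems(2) that by (simp add: frechet_derivative_works)
    then show ?thesis
      by (rule has_derivative_transform_within_open[OF _ assms(1) that]) (use Suc.prems(1) in auto)
  qed
  then have eq: "frechet_derivative g (at x) = frechet_derivative f (at x)" if "x \<in> S" for x
    using frechet_derivative_at that by metis
  have "g differentiable (at x)" if "x \<in> S" for x using D[OF that] differentiableI by blast
  moreover have "Ck_on k S (\<lambda>x. frechet_derivative g (at x) v)" for v
    by (rule Suc.IH[of "\<lambda>x. frechet_derivative f (at x) v"]) (use Suc.prems(2) eq in auto)
  ultimately show ?case by simp
qed

lemma Ck_on_local: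
  assumes "\<And>x. x \<in> S \<Longrightarrow> \<exists>T. open T \<and> x \<in> T \<and> Ck_on k T f"
  shows "Ck_on k S f"
  using assms
proof (induction k arbitrary: f)
  case 0
  have "continuous_on S f"
    unfolding continuous_on_eq_continuous_within
  proof
    fix x assume "x \<in> S"
    then obtain T where "open T" "x \<in> T" "continuous_on T f" using 0 by auto
    then show "continuous (at x within S) f"
      using continuous_at_imp_continuous_at_within continuous_on_eq_continuous_at by blast
  qed
  then show ?case by simp
next
  case (Suc k)
  have "f differentiable (at x)" if "x \<in> S" for x using Suc.prems[OF that] by auto
  moreover have "Ck_on k S (\<lambda>x. frechet_derivative f (at x) v)" for v
    by (rule Suc.IH) (use Suc.prems in fastforce)
  ultimately show ?case by simp
qed

lemma Ck_on_SucD: "Ck_on (Suc k) S f \<Longrightarrow> Ck_on k S f"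
proof (induction k arbitrary: f)
  case 0
  then show ?case
    by (auto intro!: continuous_at_imp_continuous_on differentiable_imp_continuous_within)
next
  case (Suc k)
  have "Ck_on k S (\<lambda>x. frechet_derivative f (at x) v)" for v
    by (rule Suc.IH) (use Suc.prems in auto)
  then show ?case using Suc.prems by simp
qed

text \<open>Trades the chosen \<open>frechet_derivative\<close> for any explicit formula
  \<open>D\<close> of the derivative. The inductions for sums, products, inverses and compositions
  all pass through this rule.\<close>

lemma Ck_on_SucI:
  assumes "open S" "\<And>x. x \<in> S \<Longrightarrow> (f has_derivative D x) (at x)" "\<And>v. Ck_on k S (\<lambda>x. D x v)"
  shows "Ck_on (Suc k) S f"
proof -
  have eq: "D x = frechet_derivative f (at x)" if "x \<in> S" for x
    using frechet_derivative_at assms(2)[OF that] by metis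
  have "Ck_on k S (\<lambda>x. frechet_derivative f (at x) v)" for v
    by (rule Ck_on_cong[OF assms(1) _ assms(3)]) (use eq in auto)
  then show ?thesis using assms(2) differentiableI by fastforce
qed

lemma Ck_on_const: "Ck_on k S (\<lambda>x. c)"
  by (induction k arbitrary: c) auto

lemma Ck_on_bounded_linear:
  assumes "bounded_linear f"
  shows "Ck_on k S f"
proof -
  have "Ck_on (Suc k) UNIV f"
    by (rule Ck_on_SucI[where D = "\<lambda>x. f"])
      (use assms in \<open>auto intro: bounded_linear_imp_has_derivative Ck_on_const\<close>)
  then have "Ck_on k UNIV f" by (rule Ck_on_SucD)
  then show ?thesis by (rule Ck_on_subset) simp
qed

lemma Ck_on_add:
  assumes "open S"
  shows "Ck_on k S f \<Longrightarrow> Ck_on k S g \<Longrightarrow> Ck_on k S (\<lambda>x. f x + g x)"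
proof (induction k arbitrary: f g)
  case 0
  then show ?case by (auto intro: continuous_intros)
next
  case (Suc k)
  show ?case
  proof (rule Ck_on_SucI[OF assms,
      where D = "\<lambda>x v. frechet_derivative f (at x) v + frechet_derivative g (at x) v"])
    fix x assume "x \<in> S"
    then show "((\<lambda>x. f x + g x) has_derivative
       (\<lambda>v. frechet_derivative f (at x) v + frechet_derivative g (at x) v)) (at x)"
      using Suc.prems by (intro has_derivative_add) (auto simp: frechet_derivative_works)
  qed (use Suc in auto)
qed

lemma Ck_on_bounded_linear_compose:
  assumes "open S" "bounded_linear h"
  shows "Ck_on k S f \<Longrightarrow> Ck_on k S (\<lambda>x. h (f x))"
proof (induction k arbitrary: f)
  case 0
  then show ?case using assms(2) bounded_linear.continuous_on by auto
next
  case (Suc k)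
  show ?case
  proof (rule Ck_on_SucI[OF assms(1), where D = "\<lambda>x v. h (frechet_derivative f (at x) v)"])
    fix x assume "x \<in> S"
    then show "((\<lambda>x. h (f x)) has_derivative (\<lambda>v. h (frechet_derivative f (at x) v))) (at x)"
      using Suc.prems
      by (intro bounded_linear.has_derivative[OF assms(2)]) (auto simp: frechet_derivative_works)
  qed (use Suc in auto)
qed

lemma Ck_on_mult:
  fixes f g :: "'e::real_normed_vector \<Rightarrow> real"
  assumes "open S"
  shows "Ck_on k S f \<Longrightarrow> Ck_on k S g \<Longrightarrow> Ck_on k S (\<lambda>x. f x * g x)"
proof (induction k arbitrary: f g)
  case 0
  then show ?case by (auto intro: continuous_intros)
next
  case (Suc k)
  show ?case
  proof (rule Ck_on_SucI[OF assms,
      where D = "\<lambda>x v. f x * frechet_derivative g (at x) v + frechet_derivative f (at x) v * g x"])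
    fix x assume "x \<in> S"
    then show "((\<lambda>x. f x * g x) has_derivative
       (\<lambda>v. f x * frechet_derivative g (at x) v + frechet_derivative f (at x) v * g x)) (at x)"
      using Suc.prems by (intro has_derivative_mult) (auto simp: frechet_derivative_works)
  next
    fix v
    show "Ck_on k S (\<lambda>x. f x * frechet_derivative g (at x) v + frechet_derivative f (at x) v * g x)"
      using Suc.prems Suc.prems[THEN Ck_on_SucD] by (intro Ck_on_add assms Suc.IH) simp_all
  qed
qed

lemma Ck_on_sum:
  assumes "open S" "\<And>i. i \<in> I \<Longrightarrow> Ck_on k S (f i)"
  shows "Ck_on k S (\<lambda>x. \<Sum>i\<in>I. f i x)"
proof (cases "finite I")
  case True
  then show ?thesis using assms(2)
    by (induction I) (auto intro: Ck_on_const Ck_on_add[OF assms(1)])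
qed (simp add: Ck_on_const)

text \<open>The derivative of 1/f contains 1/f again, but only to order \<open>k\<close>, where the
  induction hypothesis applies.\<close>

lemma Ck_on_inverse:
  fixes f :: "'e::real_normed_vector \<Rightarrow> real"
  assumes "open S" "\<And>x. x \<in> S \<Longrightarrow> f x \<noteq> 0"
  shows "Ck_on k S f \<Longrightarrow> Ck_on k S (\<lambda>x. inverse (f x))"
proof (induction k)
  case 0
  then show ?case using assms by (auto intro!: continuous_intros)
next
  case (Suc k)
  show ?case
  proof (rule Ck_on_SucI[OF assms(1),
      where D = "\<lambda>x v. (-1) * (inverse (f x) * frechet_derivative f (at x) v * inverse (f x))"])
    fix x assume "x \<in> S"
    then show "((\<lambda>x. inverse (f x)) has_derivative
       (\<lambda>v. (-1) * (inverse (f x) * frechet_derivative f (at x) v * inverse (f x)))) (at x)"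
      using Suc.prems assms(2)
      by (intro has_derivative_eq_rhs[OF Deriv.has_derivative_inverse]) (auto simp: frechet_derivative_works)
  next
    fix v
    show "Ck_on k S (\<lambda>x. (-1) * (inverse (f x) * frechet_derivative f (at x) v * inverse (f x)))"
      using Suc.prems Suc.IH[OF Suc.prems[THEN Ck_on_SucD]]
      by (intro Ck_on_mult assms(1) Ck_on_const) simp_all
  qed
qed

lemma frechet_derivative_expand:
  assumes "orthonormal_basis (E :: 'e::real_inner set)" "f differentiable (at x)"
  shows "frechet_derivative f (at x) v = (\<Sum>e\<in>E. (v \<bullet> e) *\<^sub>R frechet_derivative f (at x) e)"
proof -
  have l: "linear (frechet_derivative f (at x))" using assms(2) by (rule linear_frechet_derivative)
  show ?thesis
    by (subst orthonormal_basis_expand[OF assms(1), of v, symmetric])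
      (simp add: linear_sum[OF l] linear_cmul[OF l])
qed

text \<open>The chain rule applies Df(g x) to the moving vector Dg(x) v, while \<open>Ck_on\<close>
  speaks of Df applied to fixed vectors only. Expanding the moving vector in the basis
  \<open>E\<close> turns the derivative into a finite sum of products, to which the induction
  hypothesis for the partial derivatives of \<open>f\<close> applies.\<close>

lemma Ck_on_compose:
  fixes f :: "'d::real_inner \<Rightarrow> real" and g :: "'e::real_normed_vector \<Rightarrow> 'd"
  assumes "orthonormal_basis (E :: 'd set)" "open S" "g ` S \<subseteq> T"
  shows "Ck_on k T f \<Longrightarrow> Ck_on k S g \<Longrightarrow> Ck_on k S (\<lambda>x. f (g x))"
proof (induction k arbitrary: f)
  case 0
  then show ?case using assms(3) by (auto intro: continuous_on_compose2)
next
  case (Suc k)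
  let ?D = "\<lambda>x v. \<Sum>e\<in>E. (frechet_derivative g (at x) v \<bullet> e) * frechet_derivative f (at (g x)) e"
  show ?case
  proof (rule Ck_on_SucI[OF assms(2), where D = ?D])
    fix x assume x: "x \<in> S"
    then have g: "g differentiable (at x)" and f: "f differentiable (at (g x))"
      using Suc.prems assms(3) by auto
    have "((\<lambda>x. f (g x)) has_derivative
      (\<lambda>v. frechet_derivative f (at (g x)) (frechet_derivative g (at x) v))) (at x)"
      using f g by (intro has_derivative_compose[of g _ x UNIV f]) (auto simp: frechet_derivative_works)
    then show "((\<lambda>x. f (g x)) has_derivative ?D x) (at x)"
      by (rule has_derivative_eq_rhs) (simp add: fun_eq_iff frechet_derivative_expand[OF assms(1) f, symmetric]
          flip: real_scaleR_def)
  next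
    fix v
    have "Ck_on k S (\<lambda>x. frechet_derivative f (at (g x)) e)" for e
      using Suc.prems(1) Suc.prems(2)[THEN Ck_on_SucD] by (intro Suc.IH) simp_all
    moreover have "Ck_on k S (\<lambda>x. frechet_derivative g (at x) v \<bullet> e)" for e
      using Suc.prems by (intro Ck_on_bounded_linear_compose[OF assms(2) bounded_linear_inner_left]) auto
    ultimately show "Ck_on k S (\<lambda>x. ?D x v)"
      by (intro Ck_on_sum Ck_on_mult assms(2))
  qed
qed

lemma smooth_on_subset: "smooth_on S f \<Longrightarrow> T \<subseteq> S \<Longrightarrow> smooth_on T f"
  unfolding smooth_on_def by (auto intro: Ck_on_subset)

lemma smooth_on_cong: "open S \<Longrightarrow> (\<And>x. x \<in> S \<Longrightarrow> f x = g x) \<Longrightarrow> smooth_on S f \<Longrightarrow> smooth_on S g"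
  unfolding smooth_on_def by (intro allI, rule Ck_on_cong[of S f g]) auto

lemma smooth_on_local:
  "(\<And>x. x \<in> S \<Longrightarrow> \<exists>T. open T \<and> x \<in> T \<and> smooth_on T f) \<Longrightarrow> smooth_on S f"
  unfolding smooth_on_def by (intro allI, rule Ck_on_local) blast

lemma smooth_on_const: "smooth_on S (\<lambda>x. c)"
  by (simp add: smooth_on_def Ck_on_const)

lemma smooth_on_bounded_linear: "bounded_linear f \<Longrightarrow> smooth_on S f"
  by (simp add: smooth_on_def Ck_on_bounded_linear)

lemma smooth_on_add: "open S \<Longrightarrow> smooth_on S f \<Longrightarrow> smooth_on S g \<Longrightarrow> smooth_on S (\<lambda>x. f x + g x)"
  by (simp add: smooth_on_def Ck_on_add)

lemma smooth_on_mult: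
  fixes f g :: "'e::real_normed_vector \<Rightarrow> real"
  shows "open S \<Longrightarrow> smooth_on S f \<Longrightarrow> smooth_on S g \<Longrightarrow> smooth_on S (\<lambda>x. f x * g x)"
  by (simp add: smooth_on_def Ck_on_mult)

lemma smooth_on_sum: "open S \<Longrightarrow> (\<And>i. i \<in> I \<Longrightarrow> smooth_on S (f i)) \<Longrightarrow> smooth_on S (\<lambda>x. \<Sum>i\<in>I. f i x)"
  by (simp add: smooth_on_def Ck_on_sum)

lemma smooth_on_inverse:
  fixes f :: "'e::real_normed_vector \<Rightarrow> real"
  shows "open S \<Longrightarrow> (\<And>x. x \<in> S \<Longrightarrow> f x \<noteq> 0) \<Longrightarrow> smooth_on S f \<Longrightarrow> smooth_on S (\<lambda>x. inverse (f x))"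
  by (simp add: smooth_on_def Ck_on_inverse)

lemma smooth_on_compose:
  fixes f :: "'d::real_inner \<Rightarrow> real" and g :: "'e::real_normed_vector \<Rightarrow> 'd"
  assumes "orthonormal_basis (E :: 'd set)" "open S" "g ` S \<subseteq> T" "smooth_on T f" "smooth_on S g"
  shows "smooth_on S (\<lambda>x. f (g x))"
  using assms(4,5) Ck_on_compose[OF assms(1-3)] unfolding smooth_on_def by simp

lemma smooth_on_differentiable: "smooth_on S f \<Longrightarrow> x \<in> S \<Longrightarrow> f differentiable (at x)"
  unfolding smooth_on_def by (drule spec[of _ "Suc 0"]) simp

lemma smooth_on_has_derivative:
  "smooth_on S f \<Longrightarrow> x \<in> S \<Longrightarrow> (f has_derivative frechet_derivative f (at x)) (at x)"
  by (simp add: smooth_on_differentiable flip: frechet_derivative_works)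

lemma smooth_on_derivative: "smooth_on S f \<Longrightarrow> smooth_on S (\<lambda>x. frechet_derivative f (at x) v)"
  unfolding smooth_on_def by (intro allI, drule_tac x = "Suc k" in spec) simp

lemma smooth_on_continuous: "smooth_on S f \<Longrightarrow> continuous_on S f"
  unfolding smooth_on_def by (drule spec[of _ 0]) simp


subsection \<open>A smooth cutoff\<close>

text \<open>The classical exp(-1/x) together with the negative powers of x that differentiation
  produces. The whole family is closed under differentiation up to linear combinations, so its
  smoothness is a single induction over all \<open>n\<close>.\<close>

definition flat :: "nat \<Rightarrow> real \<Rightarrow> real" where
  "flat n x = (if x > 0 then exp (- inverse x) * inverse x ^ n else 0)"

lemma flat_tendsto_0: "(flat n \<longlongrightarrow> 0) (at 0)"
proof -
  have "((\<lambda>x::real. inverse x ^ n / exp (inverse x)) \<longlongrightarrow> 0) (at_right 0)"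
    by (rule filterlim_compose[OF tendsto_power_div_exp_0 filterlim_inverse_at_top_right])
  moreover have "eventually (\<lambda>x::real. inverse x ^ n / exp (inverse x) = flat n x) (at_right 0)"
    unfolding eventually_at_filter by (rule always_eventually) (simp add: flat_def exp_minus field_simps)
  ultimately have "(flat n \<longlongrightarrow> 0) (at_right 0)" by (rule Lim_transform_eventually)
  moreover have "eventually (\<lambda>x::real. 0 = flat n x) (at_left 0)"
    unfolding eventually_at_filter by (rule always_eventually) (simp add: flat_def)
  then have "(flat n \<longlongrightarrow> 0) (at_left 0)" by (rule Lim_transform_eventually[OF tendsto_const])
  ultimately show ?thesis by (simp add: filterlim_split_at)
qed

lemma flat_has_derivative:
  "(flat n has_real_derivative (flat (n + 2) x - real n * flat (n + 1) x)) (at x)"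
proof -
  consider "x < 0" | "x = 0" | "x > 0" by linarith
  then show ?thesis
  proof cases
    case 1
    have "((\<lambda>_. 0) has_real_derivative (flat (n + 2) x - real n * flat (n + 1) x)) (at x)"
      using 1 by (auto simp: flat_def)
    then show ?thesis
      by (rule has_field_derivative_transform_within_open[where S = "{..<0}"]) (use 1 in \<open>auto simp: flat_def\<close>)
  next
    case 2
    have "eventually (\<lambda>h. flat (n + 1) h = (flat n (0 + h) - flat n 0) / h) (at 0)"
      unfolding eventually_at_filter
      by (rule always_eventually) (auto simp: flat_def field_simps)
    then have "((\<lambda>h. (flat n (0 + h) - flat n 0) / h) \<longlongrightarrow> 0) (at 0)"
      using flat_tendsto_0 by (rule Lim_transform_eventually[rotated])
    then have "(flat n has_real_derivative 0) (at 0)" unfolding DERIV_def .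
    then show ?thesis using 2 by (simp add: flat_def)
  next
    case 3
    have "((\<lambda>x. exp (- inverse x) * inverse x ^ n) has_real_derivative
        (flat (n + 2) x - real n * flat (n + 1) x)) (at x)"
    proof (cases n)
      case 0
      then show ?thesis using 3
        by (auto intro!: derivative_eq_intros simp: flat_def power2_eq_square)
    next
      case (Suc m)
      then show ?thesis using 3
        by (auto intro!: derivative_eq_intros simp: flat_def power2_eq_square field_simps)
          (cases m; simp)
    qed
    then show ?thesis
      by (rule has_field_derivative_transform_within_open[where S = "{0<..}"]) (use 3 in \<open>auto simp: flat_def\<close>)
  qed
qed

lemma smooth_on_flat: "smooth_on UNIV (flat n)"
proof -
  have "Ck_on k UNIV (flat n)" for k
  proof (induction k arbitrary: n)
    case 0
    have "continuous_on UNIV (flat n)"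
      using flat_has_derivative DERIV_isCont by (intro continuous_at_imp_continuous_on) blast
    then show ?case by simp
  next
    case (Suc k)
    show ?case
    proof (rule Ck_on_SucI[where D = "\<lambda>x v. (flat (n + 2) x + (- real n) * flat (n + 1) x) * v"])
      fix x show "(flat n has_derivative (\<lambda>v. (flat (n + 2) x + (- real n) * flat (n + 1) x) * v)) (at x)"
        using flat_has_derivative[of n x] by (simp add: has_field_derivative_def)
    qed (intro Ck_on_mult Ck_on_add Ck_on_const open_UNIV Suc.IH)+
  qed
  then show ?thesis by (simp add: smooth_on_def)
qed

definition smooth_step :: "real \<Rightarrow> real" where
  "smooth_step t = flat 0 t * inverse (flat 0 t + flat 0 (1 + (-1) * t))"

lemma smooth_step_0: "t \<le> 0 \<Longrightarrow> smooth_step t = 0"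
  and smooth_step_1: "t \<ge> 1 \<Longrightarrow> smooth_step t = 1"
  by (auto simp: smooth_step_def flat_def)

lemma smooth_on_smooth_step: "smooth_on UNIV smooth_step"
proof -
  have "smooth_on UNIV (\<lambda>t::real. 1 + (-1) * t)"
    by (intro smooth_on_add smooth_on_mult smooth_on_const open_UNIV smooth_on_bounded_linear[OF bounded_linear_ident])
  then have 1: "smooth_on UNIV (\<lambda>t. flat 0 (1 + (-1) * t))"
    by (rule smooth_on_compose[OF orthonormal_basis_real open_UNIV _ smooth_on_flat, rotated]) simp
  have "flat 0 t + flat 0 (1 + (-1) * t) \<noteq> 0" for t
  proof -
    have "0 < flat 0 t + flat 0 (1 - t)"
      by (cases "t \<le> 0") (auto simp: flat_def intro!: add_pos_nonneg add_nonneg_pos)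
    then show ?thesis by simp
  qed
  then show ?thesis unfolding smooth_step_def[abs_def]
    by (intro smooth_on_mult smooth_on_inverse smooth_on_add 1 smooth_on_flat) auto
qed

text \<open>The argument 2 - |y - c|^2 / r^2 is at least 1 on the ball of radius r and at most 0
  outside the ball of radius 2 r (already from radius sqrt 2 r on). The squared norm is used since,
  unlike the norm, it is smooth at \<open>c\<close>.\<close>

definition cutoff :: "'e::real_inner \<Rightarrow> real \<Rightarrow> 'e \<Rightarrow> real" where
  "cutoff c r y = smooth_step (2 + (- 1 / r\<^sup>2) * ((y - c) \<bullet> (y - c)))"

lemma cutoff_1: "r > 0 \<Longrightarrow> y \<in> cball c r \<Longrightarrow> cutoff c r y = 1"
  unfolding cutoff_def
  by (rule smooth_step_1) (auto simp: dist_norm norm_minus_commute power2_norm_eq_inner[symmetric]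
      field_simps intro!: power_mono)

lemma cutoff_0: "r > 0 \<Longrightarrow> y \<notin> ball c (2 * r) \<Longrightarrow> cutoff c r y = 0"
proof -
  assume r: "r > 0" "y \<notin> ball c (2 * r)"
  then have "(2 * r)\<^sup>2 \<le> (norm (y - c))\<^sup>2"
    by (intro power_mono) (auto simp: dist_norm norm_minus_commute)
  then have "2 * r\<^sup>2 \<le> (y - c) \<bullet> (y - c)" using r
    by (simp add: power2_norm_eq_inner[symmetric] power_mult_distrib) (smt (verit) zero_le_power2)
  then show ?thesis unfolding cutoff_def using r by (intro smooth_step_0) (simp add: field_simps)
qed

lemma smooth_on_cutoff:
  fixes c :: "'e::real_inner"
  assumes E: "orthonormal_basis (E :: 'e set)"
  shows "smooth_on S (cutoff c r)"
proof -
  have q: "(y - c) \<bullet> (y - c) = (\<Sum>e\<in>E. (y \<bullet> e + - (c \<bullet> e)) * (y \<bullet> e + - (c \<bullet> e)))" for y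
  proof -
    have "(y - c) \<bullet> (y - c) = (\<Sum>e\<in>E. ((y - c) \<bullet> e) *\<^sub>R e) \<bullet> (y - c)"
      by (simp only: orthonormal_basis_expand[OF E])
    also have "\<dots> = (\<Sum>e\<in>E. ((y - c) \<bullet> e) * ((y - c) \<bullet> e))"
      unfolding inner_sum_left by (intro sum.cong refl) (simp add: inner_commute)
    finally show ?thesis by (simp add: inner_diff_left)
  qed
  have lin: "smooth_on UNIV (\<lambda>y. y \<bullet> e)" for e :: 'e
    by (rule smooth_on_bounded_linear) (rule bounded_linear_inner_left)
  have "smooth_on UNIV (\<lambda>y. 2 + (- 1 / r\<^sup>2) *
      (\<Sum>e\<in>E. (y \<bullet> e + - (c \<bullet> e)) * (y \<bullet> e + - (c \<bullet> e))))"
    by (intro smooth_on_add smooth_on_mult smooth_on_sum lin open_UNIV smooth_on_const)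
  then have "smooth_on UNIV (\<lambda>y. smooth_step (2 + (- 1 / r\<^sup>2) *
      (\<Sum>e\<in>E. (y \<bullet> e + - (c \<bullet> e)) * (y \<bullet> e + - (c \<bullet> e)))))"
    by (rule smooth_on_compose[OF orthonormal_basis_real open_UNIV _ smooth_on_smooth_step, rotated]) simp
  then have "smooth_on UNIV (cutoff c r)" by (simp only: cutoff_def[abs_def] q)
  then show ?thesis by (rule smooth_on_subset) simp
qed


subsection \<open>Directional derivatives\<close>

lemma linear_norm_le_basis:
  fixes f :: "'e::real_inner \<Rightarrow> 'f::real_normed_vector"
  assumes E: "orthonormal_basis (E :: 'e set)" and f: "linear f"
  shows "norm (f v) \<le> (\<Sum>e\<in>E. norm (f e)) * norm v"
proof -
  have "f v = (\<Sum>e\<in>E. (v \<bullet> e) *\<^sub>R f e)"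
    by (subst orthonormal_basis_expand[OF E, of v, symmetric])
      (simp add: linear_sum[OF f] linear_cmul[OF f])
  then have "norm (f v) \<le> (\<Sum>e\<in>E. norm ((v \<bullet> e) *\<^sub>R f e))" by (simp only: norm_sum)
  also have "\<dots> \<le> (\<Sum>e\<in>E. norm (f e) * norm v)"
  proof (intro sum_mono)
    fix e assume "e \<in> E"
    then have "\<bar>v \<bullet> e\<bar> \<le> norm v"
      using Cauchy_Schwarz_ineq2[of v e] orthonormal_basis_norm[OF E] by simp
    then show "norm ((v \<bullet> e) *\<^sub>R f e) \<le> norm (f e) * norm v"
      using mult_right_mono[of "\<bar>v \<bullet> e\<bar>" "norm v" "norm (f e)"] by (simp add: mult.commute)
  qed
  finally show ?thesis by (simp add: sum_distrib_right)
qed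

lemma linear_imp_bounded_linear_finite_dimensional:
  fixes f :: "'e::real_inner \<Rightarrow> 'f::real_normed_vector"
  assumes E: "orthonormal_basis (E :: 'e set)" and f: "linear f"
  shows "bounded_linear f"
  using f linear_norm_le_basis[OF E f]
  by (intro bounded_linear_intro[where K = "\<Sum>e\<in>E. norm (f e)"])
    (auto simp: linear_add linear_cmul mult.commute)

text \<open>Continuity of \<open>L y v\<close> for each fixed \<open>v\<close> becomes a bound
  uniform in \<open>v\<close>, because a linear map is controlled by its values on the finitely many
  basis vectors.\<close>

lemma linear_family_close:
  fixes L :: "'e::real_inner \<Rightarrow> 'e \<Rightarrow> 'f::real_normed_vector"
  assumes E: "orthonormal_basis (E :: 'e set)" and S: "open S" "x \<in> S" and "\<epsilon> > 0"
    and lin: "\<And>y. y \<in> S \<Longrightarrow> linear (L y)"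
    and cont: "\<And>v. continuous_on S (\<lambda>y. L y v)"
  shows "\<exists>d>0. cball x d \<subseteq> S \<and> (\<forall>y\<in>cball x d. \<forall>v. norm (L y v - L x v) \<le> \<epsilon> * norm v)"
proof -
  let ?h = "\<lambda>y. \<Sum>e\<in>E. norm (L y e - L x e)"
  have "continuous_on S ?h" by (intro continuous_intros cont)
  then have "isCont ?h x" using S continuous_on_eq_continuous_at by blast
  moreover have "?h x = 0" by simp
  ultimately have "(?h \<longlongrightarrow> 0) (at x)" unfolding isCont_def by simp
  then have "eventually (\<lambda>y. ?h y < \<epsilon>) (at x)" using \<open>\<epsilon> > 0\<close> by (rule order_tendstoD)
  then obtain d1 where d1: "d1 > 0" "\<And>y. dist y x < d1 \<Longrightarrow> y \<noteq> x \<Longrightarrow> ?h y < \<epsilon>"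
    unfolding eventually_at by auto
  obtain d2 where d2: "d2 > 0" "cball x d2 \<subseteq> S" using S open_contains_cball by blast
  define d where "d = min (d1 / 2) d2"
  have "norm (L y v - L x v) \<le> \<epsilon> * norm v" if "y \<in> cball x d" for y v
  proof (cases "y = x")
    case True
    then show ?thesis using \<open>\<epsilon> > 0\<close> by simp
  next
    case False
    have "dist y x < d1" "y \<in> S" using that d1(1) d2 by (auto simp: d_def dist_commute)
    then have h: "?h y \<le> \<epsilon>" using d1(2) False by (simp add: less_imp_le)
    have "linear (\<lambda>v. L y v - L x v)"
      using lin[OF \<open>y \<in> S\<close>] lin[OF S(2)] by (rule linear_compose_sub)
    from linear_norm_le_basis[OF E this, of v] h show ?thesis
      by (meson mult_right_mono norm_ge_zero order_trans)
  qed
  moreover have "d > 0" "cball x d \<subseteq> S" using d1(1) d2 by (auto simp: d_def)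
  ultimately show ?thesis by (intro exI[of _ d] conjI) auto
qed

text \<open>The mean value theorem on the segment from \<open>x\<close> to \<open>y\<close> writes
  the increment as \<open>L z (y - x)\<close> with z on the segment, and
  \<open>linear_family_close\<close> compares \<open>L z\<close> with \<open>L x\<close> uniformly
  in the direction. This turns differentiation under the integral sign, done in one real parameter,
  into a Frechet derivative.\<close>

lemma has_derivative_of_directional:
  fixes G :: "'e::real_inner \<Rightarrow> real"
  assumes E: "orthonormal_basis (E :: 'e set)" and S: "open S" "x \<in> S"
    and dir: "\<And>y v. y \<in> S \<Longrightarrow> ((\<lambda>s. G (y + s *\<^sub>R v)) has_real_derivative L y v) (at 0)"
    and lin: "\<And>y. y \<in> S \<Longrightarrow> linear (L y)"
    and cont: "\<And>v. continuous_on S (\<lambda>y. L y v)"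
  shows "(G has_derivative L x) (at x)"
  unfolding has_derivative_at_alt
proof (intro conjI allI impI)
  show "bounded_linear (L x)"
    using linear_imp_bounded_linear_finite_dimensional[OF E lin[OF S(2)]] .
next
  fix \<epsilon> :: real assume "0 < \<epsilon>"
  then obtain d where d: "d > 0" "cball x d \<subseteq> S" "\<And>y v. y \<in> cball x d \<Longrightarrow> norm (L y v - L x v) \<le> \<epsilon> * norm v"
    using linear_family_close[OF E S _ lin cont] by metis
  have "norm (G y - G x - L x (y - x)) \<le> \<epsilon> * norm (y - x)" if y: "norm (y - x) < d" for y
  proof -
    let ?v = "y - x"
    have seg: "x + s *\<^sub>R ?v \<in> cball x d" if "0 \<le> s" "s \<le> 1" for s
    proof -
      have "s * norm ?v \<le> 1 * norm ?v" using that by (intro mult_right_mono) auto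
      then show ?thesis using y that by (simp add: dist_norm)
    qed
    have "((\<lambda>s. G (x + s *\<^sub>R ?v)) has_real_derivative L (x + s *\<^sub>R ?v) ?v) (at s)"
      if "0 \<le> s" "s \<le> 1" for s
    proof -
      have "((\<lambda>t. G (x + s *\<^sub>R ?v + t *\<^sub>R ?v)) has_real_derivative L (x + s *\<^sub>R ?v) ?v) (at 0)"
        using seg[OF that] d(2) by (intro dir) auto
      then have "((\<lambda>t. G (x + (t + s) *\<^sub>R ?v)) has_real_derivative L (x + s *\<^sub>R ?v) ?v) (at 0)"
        by (simp add: scaleR_add_left add_ac)
      then show ?thesis using DERIV_shift[of "\<lambda>s. G (x + s *\<^sub>R ?v)" _ 0 s] by simp
    qed
    then obtain z where z: "0 < z" "z < 1"
      "G (x + 1 *\<^sub>R ?v) - G (x + 0 *\<^sub>R ?v) = (1 - 0) * L (x + z *\<^sub>R ?v) ?v"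
      using MVT2[of 0 1 "\<lambda>s. G (x + s *\<^sub>R ?v)" "\<lambda>s. L (x + s *\<^sub>R ?v) ?v"] by auto
    then have "G y - G x = L (x + z *\<^sub>R ?v) ?v" by simp
    then show ?thesis using d(3)[OF seg[of z], of ?v] z by simp
  qed
  then show "\<exists>d>0. \<forall>y. norm (y - x) < d \<longrightarrow> norm (G y - G x - L x (y - x)) \<le> \<epsilon> * norm (y - x)"
    using d(1) by blast
qed


subsection \<open>Hadamard's lemma\<close>

lemma ball_radial_segment:
  fixes c :: "'e::real_normed_vector"
  assumes "y \<in> ball c r" "0 \<le> t" "t \<le> 1"
  shows "c + t *\<^sub>R (y - c) \<in> ball c r"
proof -
  have "t * norm (y - c) \<le> 1 * norm (y - c)" using assms by (intro mult_right_mono) auto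
  then show ?thesis using assms by (simp add: dist_norm norm_minus_commute)
qed

lemma continuous_on_radial:
  fixes c :: "'e::real_normed_vector"
  assumes "continuous_on (ball c r) F"
  shows "continuous_on (ball c r \<times> cbox 0 1) (\<lambda>(y, t). t ^ m * F (c + t *\<^sub>R (y - c)) :: real)"
  unfolding case_prod_unfold
  by (intro continuous_intros continuous_on_compose2[OF assms]) (use ball_radial_segment in auto)

lemma integrable_radial:
  fixes c :: "'e::real_normed_vector"
  assumes "continuous_on (ball c r) F" "y \<in> ball c r"
  shows "(\<lambda>t. t ^ m * F (c + t *\<^sub>R (y - c)) :: real) integrable_on {0..1}"
  by (intro integrable_continuous_interval continuous_intros continuous_on_compose2[OF assms(1)])
    (use ball_radial_segment[OF assms(2)] in auto)

lemma Ck_on_0D: "Ck_on k S f \<Longrightarrow> Ck_on 0 S f"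
  by (induction k) (blast dest: Ck_on_SucD)+

text \<open>Each differentiation in \<open>y\<close> under the integral brings out one factor t by
  the chain rule. The weight t^m is there so that the induction on \<open>k\<close> closes, with
  \<open>m\<close> raised by one in each step.\<close>

lemma Ck_on_radial_integral:
  fixes F :: "'e::real_inner \<Rightarrow> real"
  assumes E: "orthonormal_basis (E :: 'e set)"
  shows "Ck_on k (ball c r) F \<Longrightarrow>
    Ck_on k (ball c r) (\<lambda>y. integral {0..1} (\<lambda>t. t ^ m * F (c + t *\<^sub>R (y - c))))"
proof (induction k arbitrary: F m)
  case 0
  then have "continuous_on (ball c r \<times> cbox 0 1) (\<lambda>(y, t). t ^ m * F (c + t *\<^sub>R (y - c)))"
    by (intro continuous_on_radial) simp
  from integral_continuous_on_param[OF this] show ?case by simp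
next
  case (Suc k)
  let ?B = "ball c r"
  let ?D = "\<lambda>z. frechet_derivative F (at z)"
  let ?L = "\<lambda>y v. integral {0..1} (\<lambda>t. t ^ Suc m * ?D (c + t *\<^sub>R (y - c)) v)"
  have F: "(F has_derivative ?D z) (at z)" if "z \<in> ?B" for z
    using Suc.prems that by (simp add: frechet_derivative_works)
  have CkD: "Ck_on k ?B (\<lambda>z. ?D z v)" for v using Suc.prems by simp
  have cF: "continuous_on ?B F"
    by (intro continuous_at_imp_continuous_on ballI has_derivative_continuous[OF F])
  have cD: "continuous_on ?B (\<lambda>z. ?D z v)" for v
  proof -
    have "Ck_on 0 ?B (\<lambda>z. ?D z v)" using CkD[of v] by (rule Ck_on_0D)
    then show ?thesis by simp
  qed
  have linD: "linear (?D z)" if "z \<in> ?B" for z using F[OF that] by (rule has_derivative_linear)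
  have seg: "c + t *\<^sub>R (y - c) \<in> ?B" if "y \<in> ?B" "t \<in> {0..1}" for y t
    using ball_radial_segment that by auto
  show ?case
  proof (rule Ck_on_SucI[where D = ?L])
    show "Ck_on k ?B (\<lambda>y. ?L y v)" for v by (rule Suc.IH[OF CkD])
  next
    fix y assume y: "y \<in> ?B"
    show "((\<lambda>y. integral {0..1} (\<lambda>t. t ^ m * F (c + t *\<^sub>R (y - c)))) has_derivative ?L y) (at y)"
    proof (rule has_derivative_of_directional[OF E open_ball y])
      fix y v assume y: "y \<in> ?B"
      \<comment> \<open>The Leibniz rule differentiates in a parameter ranging over a convex set;
        \<open>U\<close> consists of the parameters for which the line through \<open>y\<close> in
        direction \<open>v\<close> stays in the ball.\<close>
      define U where "U = {s. y + s *\<^sub>R v \<in> ?B}"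
      have Uv: "U = (\<lambda>s. y + s *\<^sub>R v) -` ?B" by (auto simp: U_def)
      have U: "open U" unfolding Uv by (intro open_vimage continuous_intros open_ball)
      have "convex U" unfolding convex_def
      proof (intro ballI allI impI)
        fix s s' u u' :: real assume *: "s \<in> U" "s' \<in> U" "0 \<le> u" "0 \<le> u'" "u + u' = 1"
        have "u *\<^sub>R (y + s *\<^sub>R v) + u' *\<^sub>R (y + s' *\<^sub>R v) \<in> ?B"
          using * convex_ball[of c r] unfolding U_def by (intro convexD) auto
        moreover have "u *\<^sub>R (y + s *\<^sub>R v) + u' *\<^sub>R (y + s' *\<^sub>R v) = (u + u') *\<^sub>R y + (u * s + u' * s') *\<^sub>R v"
          by (simp add: algebra_simps)
        ultimately show "u *\<^sub>R s + u' *\<^sub>R s' \<in> U" using * by (simp add: U_def)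
      qed
      have "0 \<in> U" using y by (simp add: U_def)
      have "((\<lambda>s. integral (cbox 0 1) (\<lambda>t. t ^ m * F (c + t *\<^sub>R (y + s *\<^sub>R v - c)))) has_vector_derivative
          integral (cbox 0 1) (\<lambda>t. t ^ Suc m * ?D (c + t *\<^sub>R (y + 0 *\<^sub>R v - c)) v)) (at 0 within U)"
      proof (rule leibniz_rule_vector_derivative[where fx = "\<lambda>s t. t ^ Suc m * ?D (c + t *\<^sub>R (y + s *\<^sub>R v - c)) v"])
        fix s t :: real assume st: "s \<in> U" "t \<in> cbox 0 1"
        then have z: "c + t *\<^sub>R (y + s *\<^sub>R v - c) \<in> ?B" using seg[of "y + s *\<^sub>R v" t] by (simp add: U_def)
        have "((\<lambda>s. F (c + t *\<^sub>R (y + s *\<^sub>R v - c))) has_derivative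
           (\<lambda>h. ?D (c + t *\<^sub>R (y + s *\<^sub>R v - c)) (t *\<^sub>R (h *\<^sub>R v)))) (at s within U)"
          by (rule has_derivative_compose[where f = "\<lambda>s. c + t *\<^sub>R (y + s *\<^sub>R v - c)", OF _ F[OF z]])
            (auto intro!: derivative_eq_intros)
        moreover have "?D (c + t *\<^sub>R (y + s *\<^sub>R v - c)) (t *\<^sub>R (h *\<^sub>R v)) = h * (t * ?D (c + t *\<^sub>R (y + s *\<^sub>R v - c)) v)" for h
          using linear_cmul[OF linD[OF z]] by simp
        ultimately have "((\<lambda>s. F (c + t *\<^sub>R (y + s *\<^sub>R v - c))) has_vector_derivative
           t * ?D (c + t *\<^sub>R (y + s *\<^sub>R v - c)) v) (at s within U)"
          by (simp add: has_vector_derivative_def)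
        then have "((\<lambda>s. t ^ m * F (c + t *\<^sub>R (y + s *\<^sub>R v - c))) has_vector_derivative
           t ^ m * (t * ?D (c + t *\<^sub>R (y + s *\<^sub>R v - c)) v)) (at s within U)"
          by (rule has_vector_derivative_mult_right)
        then show "((\<lambda>s. t ^ m * F (c + t *\<^sub>R (y + s *\<^sub>R v - c))) has_vector_derivative
           t ^ Suc m * ?D (c + t *\<^sub>R (y + s *\<^sub>R v - c)) v) (at s within U)"
          by (simp add: mult_ac)
      next
        fix s assume "s \<in> U"
        then show "(\<lambda>t. t ^ m * F (c + t *\<^sub>R (y + s *\<^sub>R v - c))) integrable_on cbox 0 1"
          using integrable_radial[OF cF, of "y + s *\<^sub>R v"] by (simp add: U_def)
      next
        have "continuous_on (U \<times> cbox 0 1) ((\<lambda>(y, t). t ^ Suc m * ?D (c + t *\<^sub>R (y - c)) v) \<circ> (\<lambda>(s, t). (y + s *\<^sub>R v, t)))"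
          unfolding case_prod_unfold
          by (intro continuous_on_compose continuous_intros continuous_on_compose2[OF cD])
            (use seg in \<open>auto simp: U_def\<close>)
        then show "continuous_on (U \<times> cbox 0 1) (\<lambda>(s, t). t ^ Suc m * ?D (c + t *\<^sub>R (y + s *\<^sub>R v - c)) v)"
          by (simp add: case_prod_unfold o_def)
      qed fact+
      then show "((\<lambda>s. integral {0..1} (\<lambda>t. t ^ m * F (c + t *\<^sub>R (y + s *\<^sub>R v - c)))) has_real_derivative
          ?L y v) (at 0)"
        using at_within_open[OF \<open>0 \<in> U\<close> U] by (simp add: has_real_derivative_iff_has_vector_derivative)
    next
      fix y assume y: "y \<in> ?B"
      have int: "(\<lambda>t. t ^ Suc m * ?D (c + t *\<^sub>R (y - c)) v) integrable_on {0..1}" for v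
        by (rule integrable_radial[OF cD y])
      show "linear (?L y)"
      proof (rule linearI)
        fix v w
        have "?L y (v + w) = integral {0..1} (\<lambda>t. t ^ Suc m * ?D (c + t *\<^sub>R (y - c)) v + t ^ Suc m * ?D (c + t *\<^sub>R (y - c)) w)"
          by (intro integral_cong) (simp add: linear_add[OF linD[OF seg[OF y]]] distrib_left)
        then show "?L y (v + w) = ?L y v + ?L y w" by (simp only: integral_add[OF int int])
      next
        fix a v
        have "?L y (a *\<^sub>R v) = integral {0..1} (\<lambda>t. a *\<^sub>R (t ^ Suc m * ?D (c + t *\<^sub>R (y - c)) v))"
          by (intro integral_cong) (simp add: linear_cmul[OF linD[OF seg[OF y]]])
        then show "?L y (a *\<^sub>R v) = a *\<^sub>R ?L y v" by (simp only: integral_cmul)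
      qed
    next
      fix v
      show "continuous_on ?B (\<lambda>y. ?L y v)"
        using integral_continuous_on_param[OF continuous_on_radial[where m = "Suc m" and F = "\<lambda>z. ?D z v", OF cD]] by simp
    qed
  qed simp
qed

text \<open>F(y) - F(c) is the integral over t of DF(c + t(y - c))(y - c); expanding y - c in the
  basis leaves the averaged partial derivatives as coefficients. This expansion is what makes every
  derivation a coordinate vector.\<close>

lemma Hadamard:
  fixes F :: "'e::real_inner \<Rightarrow> real"
  assumes E: "orthonormal_basis (E :: 'e set)" and F: "smooth_on (ball c r) F"
  shows "\<exists>g. (\<forall>e\<in>E. smooth_on (ball c r) (g e)) \<and>
    (\<forall>y\<in>ball c r. F y = F c + (\<Sum>e\<in>E. ((y - c) \<bullet> e) * g e y))"
proof (intro exI conjI ballI)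
  let ?D = "\<lambda>z. frechet_derivative F (at z)"
  \<comment> \<open>The factor t^0 gives \<open>g\<close> the shape of the case m = 0 of
    \<open>Ck_on_radial_integral\<close>.\<close>
  define g where "g e y = integral {0..1} (\<lambda>t. t ^ 0 * ?D (c + t *\<^sub>R (y - c)) e)" for e y
  show "smooth_on (ball c r) (g e)" for e
    using smooth_on_derivative[OF F] unfolding smooth_on_def g_def by (intro allI Ck_on_radial_integral[OF E]) blast
  fix y assume y: "y \<in> ball c r"
  have cD: "continuous_on (ball c r) (\<lambda>z. ?D z v)" for v
    by (intro smooth_on_continuous smooth_on_derivative F)
  have int: "(\<lambda>t. t ^ 0 * ?D (c + t *\<^sub>R (y - c)) v) integrable_on {0..1}" for v
    by (rule integrable_radial[OF cD y])
  have der: "((\<lambda>t. F (c + t *\<^sub>R (y - c))) has_vector_derivative ?D (c + t *\<^sub>R (y - c)) (y - c)) (at t within {0..1})"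
    if t: "t \<in> {0..1}" for t
  proof -
    have z: "c + t *\<^sub>R (y - c) \<in> ball c r" using ball_radial_segment[OF y] t by auto
    have "((\<lambda>t. F (c + t *\<^sub>R (y - c))) has_derivative (\<lambda>h. ?D (c + t *\<^sub>R (y - c)) (h *\<^sub>R (y - c)))) (at t within {0..1})"
      by (rule has_derivative_compose[where f = "\<lambda>t. c + t *\<^sub>R (y - c)", OF _ smooth_on_has_derivative[OF F z]])
        (auto intro!: derivative_eq_intros)
    then show ?thesis unfolding has_vector_derivative_def
      by (simp only: linear_cmul[OF has_derivative_linear[OF smooth_on_has_derivative[OF F z]]])
  qed
  have "F y - F c = integral {0..1} (\<lambda>t. ?D (c + t *\<^sub>R (y - c)) (y - c))"
    using fundamental_theorem_of_calculus[OF _ der] by (simp add: integral_unique)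
  also have "\<dots> = integral {0..1} (\<lambda>t. \<Sum>e\<in>E. ((y - c) \<bullet> e) * (t ^ 0 * ?D (c + t *\<^sub>R (y - c)) e))"
  proof (intro integral_cong)
    fix t :: real assume t: "t \<in> {0..1}"
    then have "F differentiable (at (c + t *\<^sub>R (y - c)))"
      using ball_radial_segment[OF y] F by (intro smooth_on_differentiable[OF F]) auto
    from frechet_derivative_expand[OF E this, of "y - c"]
    show "?D (c + t *\<^sub>R (y - c)) (y - c) = (\<Sum>e\<in>E. ((y - c) \<bullet> e) * (t ^ 0 * ?D (c + t *\<^sub>R (y - c)) e))"
      by simp
  qed
  also have "\<dots> = (\<Sum>e\<in>E. ((y - c) \<bullet> e) * g e y)"
    unfolding g_def
    by (subst integral_sum[OF orthonormal_basis_finite[OF E]])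
      (auto simp del: power_0 intro!: integrable_on_mult_right int)
  finally show "F y = F c + (\<Sum>e\<in>E. ((y - c) \<bullet> e) * g e y)" by simp
qed


subsection \<open>Functions that factor through a submersion\<close>

text \<open>
  With \<open>R\<close> a right inverse of \<open>P = DY(w\<^sub>0)\<close>, the map \<open>\<Phi> w = w - R P w + R Y w\<close> is a Lipschitz
  perturbation of the identity with \<open>P \<circ> \<Phi> = Y\<close>, so its (merely Lipschitz) inverse \<open>G\<close> straightens
  \<open>Y\<close>.  As \<open>f - a(w) \<circ> Y\<close> has derivative 0 at \<open>w\<close>, the composition \<open>f \<circ> G\<close> is still
  differentiable.
\<close>

lemma submersion_factor:
  fixes Y :: "'e::real_inner \<Rightarrow> 'd::real_inner" and f :: "'e \<Rightarrow> real"
  assumes E: "orthonormal_basis (E :: 'e set)" and D: "orthonormal_basis (D :: 'd set)"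
    and S: "open S" "w0 \<in> S" and Y: "smooth_on S Y"
    and f: "\<And>w. w \<in> S \<Longrightarrow> (f has_derivative (\<lambda>v. a w (frechet_derivative Y (at w) v))) (at w)"
    and a: "\<And>w. w \<in> S \<Longrightarrow> linear (a w)"
    and surj: "\<And>d. \<exists>e. frechet_derivative Y (at w0) e = d"
  shows "\<exists>N Q F. open N \<and> w0 \<in> N \<and> N \<subseteq> S \<and> open Q \<and> Y w0 \<in> Q \<and> (\<forall>w\<in>N. f w = F (Y w)) \<and>
    (\<forall>\<eta>\<in>Q. \<exists>w\<in>S. Y w = \<eta> \<and> f w = F \<eta> \<and> (F has_derivative a w) (at \<eta>))"
proof -
  define P where "P = frechet_derivative Y (at w0)"
  have linP: "linear P" unfolding P_def
    using smooth_on_has_derivative[OF Y S(2)] by (rule has_derivative_linear)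
  obtain \<rho>' where \<rho>': "\<And>d. P (\<rho>' d) = d" using surj unfolding P_def by metis
  define R where "R d = (\<Sum>b\<in>D. (d \<bullet> b) *\<^sub>R \<rho>' b)" for d
  have linR: "linear R" unfolding R_def
    by (intro linearI) (simp_all add: inner_add_left scaleR_add_left sum.distrib scaleR_sum_right)
  have PR: "P (R d) = d" for d
  proof -
    have "P (R d) = (\<Sum>b\<in>D. (d \<bullet> b) *\<^sub>R b)"
      unfolding R_def by (simp add: linear_sum[OF linP] linear_cmul[OF linP] \<rho>')
    then show ?thesis by (simp add: orthonormal_basis_expand[OF D])
  qed
  have blP: "bounded_linear P" and blR: "bounded_linear R"
    using linear_imp_bounded_linear_finite_dimensional E D linP linR by blast+
  obtain K where K: "K > 0" "\<And>d. norm (R d) \<le> norm d * K"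
    using bounded_linear.pos_bounded[OF blR] by auto
  define \<Psi> where "\<Psi> w = R (Y w - P w)" for w
  have linD: "linear (frechet_derivative Y (at w))" if "w \<in> S" for w
    using smooth_on_has_derivative[OF Y that] by (rule has_derivative_linear)
  \<comment> \<open>The bound 1/(2K) on DY - P compensates the norm bound \<open>K\<close> of
    \<open>R\<close>, so that \<Psi> = R (Y - P) becomes a contraction with constant 1/2.\<close>
  have "1 / (2 * K) > 0" using K by simp
  then obtain \<rho> where \<rho>: "\<rho> > 0" "cball w0 \<rho> \<subseteq> S"
    "\<And>w v. w \<in> cball w0 \<rho> \<Longrightarrow> norm (frechet_derivative Y (at w) v - P v) \<le> 1 / (2 * K) * norm v"
    using linear_family_close[OF E S _ linD smooth_on_continuous[OF smooth_on_derivative[OF Y]], of "1 / (2 * K)"]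
    unfolding P_def by metis
  have lip: "norm (\<Psi> w - \<Psi> w') \<le> 1 / 2 * norm (w - w')" if "w \<in> cball w0 \<rho>" "w' \<in> cball w0 \<rho>" for w w'
  proof (rule differentiable_bound[OF convex_cball _ _ that])
    fix w assume w: "w \<in> cball w0 \<rho>"
    then have "(Y has_derivative frechet_derivative Y (at w)) (at w within cball w0 \<rho>)"
      using smooth_on_has_derivative[OF Y] \<rho>(2) has_derivative_at_withinI by blast
    then show "(\<Psi> has_derivative (\<lambda>v. R (frechet_derivative Y (at w) v - P v))) (at w within cball w0 \<rho>)"
      unfolding \<Psi>_def
      by (intro bounded_linear.has_derivative[OF blR] has_derivative_diff bounded_linear_imp_has_derivative[OF blP])
    show "onorm (\<lambda>v. R (frechet_derivative Y (at w) v - P v)) \<le> 1 / 2"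
    proof (rule onorm_bound)
      show "0 \<le> (1 / 2 :: real)" by simp
    next
      fix v
      have "norm (R (frechet_derivative Y (at w) v - P v)) \<le> norm (frechet_derivative Y (at w) v - P v) * K"
        by (rule K)
      also have "\<dots> \<le> (1 / (2 * K) * norm v) * K" using \<rho>(3)[OF w] K(1) by (intro mult_right_mono) auto
      finally show "norm (R (frechet_derivative Y (at w) v - P v)) \<le> 1 / 2 * norm v" using K(1) by simp
    qed
  qed
  define z0 where "z0 = w0 + \<Psi> w0"
  have w0: "w0 \<in> cball w0 \<rho>" using \<rho>(1) by simp
  \<comment> \<open>Solving w + \<Psi> w = z is a fixed point problem for w \<mapsto> z - \<Psi> w.
    With z within \<rho>/2 of \<open>z0\<close>, the contraction constant 1/2 leaves exactly enough
    room for this map to preserve the closed ball of radius \<rho>.\<close>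
  have "\<exists>w. w \<in> cball w0 \<rho> \<and> w + \<Psi> w = z" if z: "z \<in> ball z0 (\<rho> / 2)" for z
  proof -
    have "\<exists>!w. w \<in> cball w0 \<rho> \<and> z - \<Psi> w = w"
    proof (rule Banach_fix)
      show "complete (cball w0 \<rho>)"
        by (intro compact_imp_complete compact_cball_finite_dimensional[OF E])
      show "cball w0 \<rho> \<noteq> {}" using w0 by blast
      show "(\<lambda>w. z - \<Psi> w) ` cball w0 \<rho> \<subseteq> cball w0 \<rho>"
      proof
        fix u assume "u \<in> (\<lambda>w. z - \<Psi> w) ` cball w0 \<rho>"
        then obtain w where w: "w \<in> cball w0 \<rho>" "u = z - \<Psi> w" by blast
        have "u - w0 = (z - z0) - (\<Psi> w - \<Psi> w0)" by (simp add: w z0_def)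
        then have "norm (u - w0) \<le> norm (z - z0) + norm (\<Psi> w - \<Psi> w0)" by (simp only: norm_triangle_ineq4)
        also have "\<dots> \<le> \<rho> / 2 + 1 / 2 * \<rho>"
          using z lip[OF w(1) w0] w(1) by (intro add_mono) (auto simp: dist_norm norm_minus_commute)
        finally show "u \<in> cball w0 \<rho>" by (simp add: dist_norm norm_minus_commute)
      qed
      show "dist (z - \<Psi> x) (z - \<Psi> y) \<le> 1 / 2 * dist x y"
        if "x \<in> cball w0 \<rho>" "y \<in> cball w0 \<rho>" for x y
        using lip[OF that] by (simp add: dist_norm norm_minus_commute)
    qed auto
    then show ?thesis by (metis diff_add_cancel)
  qed
  then obtain G where G: "\<And>z. z \<in> ball z0 (\<rho> / 2) \<Longrightarrow> G z \<in> cball w0 \<rho>"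
    "\<And>z. z \<in> ball z0 (\<rho> / 2) \<Longrightarrow> G z + \<Psi> (G z) = z" by metis
  \<comment> \<open>Serves twice: as the Lipschitz bound for the inverse \<open>G\<close>, and as
    injectivity of w \<mapsto> w + \<Psi> w, by which \<open>G\<close> returns the original point at
    the end.\<close>
  have expand: "norm (w - w') \<le> 2 * norm ((w + \<Psi> w) - (w' + \<Psi> w'))"
    if "w \<in> cball w0 \<rho>" "w' \<in> cball w0 \<rho>" for w w'
  proof -
    have "w - w' = ((w + \<Psi> w) - (w' + \<Psi> w')) - (\<Psi> w - \<Psi> w')" by simp
    then have "norm (w - w') \<le> norm ((w + \<Psi> w) - (w' + \<Psi> w')) + norm (\<Psi> w - \<Psi> w')"
      by (metis norm_triangle_ineq4)
    then show ?thesis using lip[OF that] by linarith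
  qed
  let ?Z = "ball z0 (\<rho> / 2)"
  have Glip: "norm (G z - G z') \<le> 2 * norm (z - z')" if "z \<in> ?Z" "z' \<in> ?Z" for z z'
    using expand[OF G(1)[OF that(1)] G(1)[OF that(2)]] G(2) that by simp
  have P\<Psi>: "P (w + \<Psi> w) = Y w" for w
    by (simp add: \<Psi>_def linear_add[OF linP] PR)
  have YG: "Y (G z) = P z" if "z \<in> ?Z" for z using P\<Psi>[of "G z"] G(2)[OF that] by simp
  have GS: "G z \<in> S" if "z \<in> ?Z" for z using G(1)[OF that] \<rho>(2) by blast
  have bla: "bounded_linear (a w)" if "w \<in> S" for w
    using linear_imp_bounded_linear_finite_dimensional[OF D a[OF that]] .
  have der: "((\<lambda>z. f (G z)) has_derivative (\<lambda>v. a (G z) (P v))) (at z)" if z: "z \<in> ?Z" for z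
  proof -
    let ?a = "a (G z)"
    define q where "q w = f w - ?a (Y w)" for w
    have "(q has_derivative (\<lambda>v. ?a (frechet_derivative Y (at (G z)) v) - ?a (frechet_derivative Y (at (G z)) v))) (at (G z))"
      unfolding q_def
      by (intro has_derivative_diff f GS[OF z] bounded_linear.has_derivative[OF bla[OF GS[OF z]]]
          smooth_on_has_derivative[OF Y])
    then have q: "(q has_derivative (\<lambda>v. 0)) (at (G z))" by simp
    \<comment> \<open>An error that is small compared with the displacement of \<open>G\<close> is
      small compared with the displacement of its argument, since \<open>G\<close> has Lipschitz
      constant 2; this constant explains \<epsilon>/2 and d/2.\<close>
    have "((\<lambda>z. q (G z)) has_derivative (\<lambda>v. 0)) (at z)"
      unfolding has_derivative_at_alt
    proof (intro conjI allI impI)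
      fix \<epsilon> :: real assume "\<epsilon> > 0"
      then obtain d where d: "d > 0" "\<And>y. norm (y - G z) < d \<Longrightarrow> norm (q y - q (G z) - 0) \<le> \<epsilon> / 2 * norm (y - G z)"
        using q unfolding has_derivative_at_alt by (meson half_gt_zero)
      obtain r where r: "r > 0" "ball z r \<subseteq> ?Z" using z open_ball open_contains_ball by meson
      have "norm (q (G y) - q (G z) - 0) \<le> \<epsilon> * norm (y - z)" if y: "norm (y - z) < min r (d / 2)" for y
      proof -
        have "y \<in> ball z r" using y by (simp add: dist_norm norm_minus_commute)
        then have "y \<in> ?Z" using r(2) by blast
        note l = Glip[OF this z]
        then have "norm (G y - G z) < d" using y by linarith
        from d(2)[OF this] have "norm (q (G y) - q (G z) - 0) \<le> \<epsilon> / 2 * norm (G y - G z)" .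
        also have "\<dots> \<le> \<epsilon> / 2 * (2 * norm (y - z))" using l \<open>\<epsilon> > 0\<close> by (intro mult_left_mono) auto
        finally show ?thesis by simp
      qed
      then show "\<exists>d>0. \<forall>y. norm (y - z) < d \<longrightarrow> norm (q (G y) - q (G z) - 0) \<le> \<epsilon> * norm (y - z)"
        using r(1) d(1) by (intro exI[of _ "min r (d / 2)"]) simp
    qed simp
    then have "((\<lambda>z. q (G z) + ?a (P z)) has_derivative (\<lambda>v. 0 + ?a (P v))) (at z)"
      by (intro has_derivative_add bounded_linear_imp_has_derivative
          bounded_linear_compose[OF bla[OF GS[OF z]] blP])
    then have "((\<lambda>z. q (G z) + ?a (P z)) has_derivative (\<lambda>v. ?a (P v))) (at z)" by simp
    then show ?thesis
      by (rule has_derivative_transform_within_open[OF _ open_ball z]) (simp add: q_def YG)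
  qed
  \<comment> \<open>The derivative of f o G factors through \<open>P\<close>, so it vanishes in
    directions of the kernel of \<open>P\<close>; the segment between two points of the ball with
    equal image under \<open>P\<close> runs in such a direction.\<close>
  have const: "f (G z) = f (G z')" if z: "z \<in> ?Z" "z' \<in> ?Z" and P: "P z = P z'" for z z'
  proof -
    define v where "v = z' - z"
    have Pv: "P v = 0" using P by (simp add: v_def linear_diff[OF linP])
    have "((\<lambda>s. f (G (z + s *\<^sub>R v))) has_real_derivative 0) (at s)" if "0 \<le> s" "s \<le> 1" for s
    proof -
      have "(1 - s) *\<^sub>R z + s *\<^sub>R z' \<in> ?Z" using z that by (intro convexD[OF convex_ball]) auto
      then have "z + s *\<^sub>R v \<in> ?Z" by (simp add: v_def algebra_simps)
      from der[OF this]
      have "((\<lambda>s. f (G (z + s *\<^sub>R v))) has_derivative (\<lambda>h. a (G (z + s *\<^sub>R v)) (P (h *\<^sub>R v)))) (at s)"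
        by (rule has_derivative_compose[where f = "\<lambda>s. z + s *\<^sub>R v", rotated])
          (auto intro!: derivative_eq_intros)
      then show ?thesis
        using linear_0[OF a[OF GS[OF \<open>z + s *\<^sub>R v \<in> ?Z\<close>]]]
        by (simp add: has_field_derivative_def linear_cmul[OF linP] Pv lambda_zero)
    qed
    then obtain \<xi> :: real where "f (G (z + 1 *\<^sub>R v)) - f (G (z + 0 *\<^sub>R v)) = (1 - 0) * 0"
      using MVT2[of 0 1 "\<lambda>s. f (G (z + s *\<^sub>R v))" "\<lambda>_. 0"] by auto
    then show ?thesis by (simp add: v_def)
  qed
  \<comment> \<open>An affine section of \<open>P\<close> passing through \<open>z0\<close> over the
    point Y w0; then f o G o s is the function on the base.\<close>
  define s where "s \<eta> = z0 + R (\<eta> - Y w0)" for \<eta>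
  have Ps: "P (s \<eta>) = \<eta>" for \<eta>
    using P\<Psi>[of w0] by (simp add: s_def z0_def linear_add[OF linP] PR)
  have conts: "continuous_on UNIV s" unfolding s_def
    by (intro continuous_intros bounded_linear.continuous_on[OF blR])
  define F where "F \<eta> = f (G (s \<eta>))" for \<eta>
  define Q where "Q = s -` ?Z"
  have "open Q" unfolding Q_def using conts by (intro open_vimage) auto
  have "z0 \<in> ?Z" using \<rho>(1) by simp
  then have "Y w0 \<in> Q" by (simp add: Q_def s_def linear_0[OF linR])
  define N where "N = (ball w0 \<rho> \<inter> (\<lambda>w. w + \<Psi> w) -` ?Z) \<inter> (ball w0 \<rho> \<inter> Y -` Q)"
  have cY: "continuous_on (ball w0 \<rho>) Y"
    using smooth_on_continuous[OF Y] \<rho>(2) ball_subset_cball continuous_on_subset by blast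
  have "continuous_on (ball w0 \<rho>) (\<lambda>w. w + \<Psi> w)"
    unfolding \<Psi>_def
    by (intro continuous_intros bounded_linear.continuous_on[OF blR] cY bounded_linear.continuous_on[OF blP])
  then have "open N" unfolding N_def
    by (intro open_Int continuous_open_preimage cY open_ball \<open>open Q\<close>)
  moreover have "w0 \<in> N" using \<open>Y w0 \<in> Q\<close> \<open>z0 \<in> ?Z\<close> \<rho>(1) by (simp add: N_def z0_def)
  moreover have "N \<subseteq> S" using \<rho>(2) by (auto simp: N_def)
  moreover have "f w = F (Y w)" if w: "w \<in> N" for w
  proof -
    have wz: "w + \<Psi> w \<in> ?Z" "s (Y w) \<in> ?Z" "w \<in> cball w0 \<rho>" using w by (auto simp: N_def Q_def)
    have "norm (G (w + \<Psi> w) - w) \<le> 2 * norm (G (w + \<Psi> w) + \<Psi> (G (w + \<Psi> w)) - (w + \<Psi> w))"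
      using expand[OF G(1)[OF wz(1)] wz(3)] .
    then have "G (w + \<Psi> w) = w" by (simp add: G(2)[OF wz(1)])
    moreover have "f (G (w + \<Psi> w)) = f (G (s (Y w)))"
      by (rule const[OF wz(1,2)]) (simp add: P\<Psi> Ps)
    ultimately show ?thesis by (simp add: F_def)
  qed
  moreover have "\<exists>w\<in>S. Y w = \<eta> \<and> f w = F \<eta> \<and> (F has_derivative a w) (at \<eta>)" if "\<eta> \<in> Q" for \<eta>
  proof (intro bexI conjI)
    have s: "s \<eta> \<in> ?Z" using that by (simp add: Q_def)
    show "G (s \<eta>) \<in> S" by (rule GS[OF s])
    show "Y (G (s \<eta>)) = \<eta>" by (simp add: YG[OF s] Ps)
    show "f (G (s \<eta>)) = F \<eta>" by (simp add: F_def)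
    have "(s has_derivative (\<lambda>v. 0 + R (v - 0))) (at \<eta>)"
      unfolding s_def
      by (intro has_derivative_add has_derivative_const bounded_linear.has_derivative[OF blR]
          has_derivative_diff has_derivative_ident)
    from has_derivative_compose[OF this der[OF s]]
    show "(F has_derivative a (G (s \<eta>))) (at \<eta>)" by (simp add: F_def[abs_def] PR)
  qed
  ultimately show ?thesis using \<open>open Q\<close> \<open>Y w0 \<in> Q\<close> by (intro exI[of _ N] exI[of _ Q] exI[of _ F]) auto
qed


section \<open>Calculus on manifolds\<close>

locale smooth_manifold =
  fixes A :: "('m::t2_space, 'e::real_inner) atlas"
  assumes atlas: "smooth_atlas A"
begin

lemma orthonormal_basis_model: "\<exists>E::'e set. orthonormal_basis E"
proof -
  have "\<exists>S. finite S \<and> span S = (UNIV :: 'e set)"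
    using atlas unfolding smooth_atlas_def by (rule conjunct1)
  then show ?thesis using orthonormal_basis_exists by (elim exE conjE)
qed

lemma chart_exists: "\<exists>U \<phi>. (U, \<phi>) \<in> A \<and> x \<in> U"
proof -
  have "(\<Union>(U, \<phi>)\<in>A. U) = UNIV" using atlas unfolding smooth_atlas_def by (elim conjE)
  then have "x \<in> (\<Union>(U, \<phi>)\<in>A. U)" by simp
  then show ?thesis by auto
qed

lemma
  assumes "(U, \<phi>) \<in> A"
  shows chart_open: "open U"
    and chart_inj: "inj_on \<phi> U"
    and chart_continuous: "continuous_on U \<phi>"
    and chart_inv_continuous: "continuous_on (\<phi> ` U) (inv_into U \<phi>)"
    and chart_image_open: "\<And>W. open W \<Longrightarrow> W \<subseteq> U \<Longrightarrow> open (\<phi> ` W)"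
proof -
  have "case (U, \<phi>) of (U, \<phi>) \<Rightarrow> open U \<and> open (\<phi> ` U) \<and> (\<exists>\<phi>'. homeomorphism U (\<phi> ` U) \<phi> \<phi>')"
    using atlas assms unfolding smooth_atlas_def by (elim conjE) (rule bspec)
  then obtain \<phi>' where *: "open U" "open (\<phi> ` U)" "homeomorphism U (\<phi> ` U) \<phi> \<phi>'" by auto
  show "open U" by fact
  show inj: "inj_on \<phi> U" using *(3) by (metis homeomorphism_apply1 inj_onI)
  show "continuous_on U \<phi>" using *(3) homeomorphism_cont1 by blast
  have "\<phi>' y = inv_into U \<phi> y" if "y \<in> \<phi> ` U" for y
    using that *(3) inj by (auto simp: homeomorphism_apply1)
  then show cinv: "continuous_on (\<phi> ` U) (inv_into U \<phi>)"
    using homeomorphism_cont2[OF *(3)] continuous_on_cong by (metis (no_types, lifting))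
  fix W assume W: "open W" "W \<subseteq> U"
  have "\<phi> ` W = \<phi> ` U \<inter> inv_into U \<phi> -` W" using W(2) inj by (auto simp: subset_iff image_iff)
  then show "open (\<phi> ` W)" using continuous_open_preimage[OF cinv *(2) W(1)] by simp
qed

lemma transition_smooth:
  assumes "(U, \<phi>) \<in> A" "(V, \<psi>) \<in> A"
  shows "smooth_on (\<phi> ` (U \<inter> V)) (\<lambda>y. \<psi> (inv_into U \<phi> y))"
proof -
  have "\<forall>(U, \<phi>)\<in>A. \<forall>(V, \<psi>)\<in>A. smooth_on (\<phi> ` (U \<inter> V)) (\<psi> \<circ> inv_into U \<phi>)"
    using atlas unfolding smooth_atlas_def by (elim conjE)
  from bspec[OF this assms(1)] show ?thesis using assms(2) by (auto simp: o_def)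
qed

lemma chart_inv: "(U, \<phi>) \<in> A \<Longrightarrow> x \<in> U \<Longrightarrow> inv_into U \<phi> (\<phi> x) = x"
  using chart_inj by simp

lemma smooth_fun_chart: "smooth_fun A f \<Longrightarrow> (U, \<phi>) \<in> A \<Longrightarrow> smooth_on (\<phi> ` U) (\<lambda>y. f (inv_into U \<phi> y))"
  unfolding smooth_fun_def by (auto simp: o_def)

text \<open>One chart around each point suffices, because any other chart differs from it by a
  smooth transition map.\<close>

lemma smooth_funI:
  assumes "\<And>x. \<exists>U \<phi> W. (U, \<phi>) \<in> A \<and> open W \<and> x \<in> W \<and> W \<subseteq> U \<and> smooth_on (\<phi> ` W) (\<lambda>y. f (inv_into U \<phi> y))"
  shows "smooth_fun A f"
proof -
  obtain E where E: "orthonormal_basis (E :: 'e set)" using orthonormal_basis_model ..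
  have "smooth_on (\<psi> ` V) (f \<circ> inv_into V \<psi>)" if V: "(V, \<psi>) \<in> A" for V \<psi>
  proof (rule smooth_on_local)
    fix \<eta> assume "\<eta> \<in> \<psi> ` V"
    then obtain x where x: "x \<in> V" "\<eta> = \<psi> x" by blast
    obtain U \<phi> W where W: "(U, \<phi>) \<in> A" "open W" "x \<in> W" "W \<subseteq> U" "smooth_on (\<phi> ` W) (\<lambda>y. f (inv_into U \<phi> y))"
      using assms[of x] by blast
    define T where "T = \<psi> ` (W \<inter> V)"
    have T: "open T" unfolding T_def using chart_image_open[OF V] chart_open[OF V] W(2) by auto
    have "smooth_on T (\<lambda>y. \<phi> (inv_into V \<psi> y))"
      unfolding T_def using transition_smooth[OF V W(1)] by (rule smooth_on_subset) (use W(4) in auto)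
    moreover have "(\<lambda>y. \<phi> (inv_into V \<psi> y)) ` T \<subseteq> \<phi> ` W"
      unfolding T_def using chart_inv[OF V] by auto
    ultimately have "smooth_on T (\<lambda>y. f (inv_into U \<phi> (\<phi> (inv_into V \<psi> y))))"
      by (intro smooth_on_compose[OF E T _ W(5)])
    then have "smooth_on T (f \<circ> inv_into V \<psi>)"
      by (rule smooth_on_cong[OF T, rotated])
        (use W(4) chart_inv[OF V] chart_inv[OF W(1)] in \<open>auto simp: T_def\<close>)
    then show "\<exists>T. open T \<and> \<eta> \<in> T \<and> smooth_on T (f \<circ> inv_into V \<psi>)"
      using T x W(3) by (intro exI[of _ T]) (auto simp: T_def)
  qed
  then show ?thesis unfolding smooth_fun_def by auto
qed

lemma smooth_fun_local:
  assumes "\<And>x. \<exists>W g. open W \<and> x \<in> W \<and> smooth_fun A g \<and> (\<forall>y\<in>W. f y = g y)"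
  shows "smooth_fun A f"
proof (rule smooth_funI)
  fix x
  obtain W g where W: "open W" "x \<in> W" "smooth_fun A g" "\<forall>y\<in>W. f y = g y" using assms[of x] by blast
  obtain U \<phi> where U: "(U, \<phi>) \<in> A" "x \<in> U" using chart_exists by blast
  have op: "open (\<phi> ` (U \<inter> W))" using chart_image_open[OF U(1)] chart_open[OF U(1)] W(1) by auto
  have "smooth_on (\<phi> ` (U \<inter> W)) (\<lambda>y. g (inv_into U \<phi> y))"
    using smooth_fun_chart[OF W(3) U(1)] by (rule smooth_on_subset) auto
  then have "smooth_on (\<phi> ` (U \<inter> W)) (\<lambda>y. f (inv_into U \<phi> y))"
    by (rule smooth_on_cong[OF op, rotated]) (use W(4) chart_inv[OF U(1)] in auto)
  then show "\<exists>U \<phi> W. (U, \<phi>) \<in> A \<and> open W \<and> x \<in> W \<and> W \<subseteq> U \<and> smooth_on (\<phi> ` W) (\<lambda>y. f (inv_into U \<phi> y))"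
    using U W(1,2) chart_open[OF U(1)] by (intro exI[of _ U] exI[of _ \<phi>] exI[of _ "U \<inter> W"]) auto
qed

section \<open>The algebra of smooth functions\<close>

lemma smooth_fun_const: "smooth_fun A (\<lambda>x. c)"
  unfolding smooth_fun_def by (auto simp: o_def smooth_on_const)

lemma smooth_fun_add: "smooth_fun A f \<Longrightarrow> smooth_fun A g \<Longrightarrow> smooth_fun A (\<lambda>x. f x + g x)"
  and smooth_fun_mult: "smooth_fun A f \<Longrightarrow> smooth_fun A g \<Longrightarrow> smooth_fun A (\<lambda>x. f x * g x)"
  unfolding smooth_fun_def
  using chart_image_open chart_open by (auto simp: o_def case_prod_unfold intro!: smooth_on_add smooth_on_mult)

lemma smooth_fun_lin: "smooth_fun A f \<Longrightarrow> smooth_fun A g \<Longrightarrow> smooth_fun A (\<lambda>x. a * f x + b * g x)"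
  by (intro smooth_fun_add smooth_fun_mult smooth_fun_const)

lemma smooth_fun_cmult: "smooth_fun A f \<Longrightarrow> smooth_fun A (\<lambda>x. c * f x)"
  by (intro smooth_fun_mult smooth_fun_const)

lemma smooth_fun_minus: "smooth_fun A f \<Longrightarrow> smooth_fun A (\<lambda>x. - f x)"
  using smooth_fun_cmult[of f "-1"] by simp

lemma smooth_fun_diff: "smooth_fun A f \<Longrightarrow> smooth_fun A g \<Longrightarrow> smooth_fun A (\<lambda>x. f x - g x)"
  using smooth_fun_lin[of f g 1 "-1"] by simp

lemma smooth_fun_sum: "(\<And>i. i \<in> I \<Longrightarrow> smooth_fun A (f i)) \<Longrightarrow> smooth_fun A (\<lambda>x. \<Sum>i\<in>I. f i x)"
  by (induction I rule: infinite_finite_induct) (auto intro: smooth_fun_const smooth_fun_add)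

lemma smooth_fun_continuous:
  assumes "smooth_fun A f"
  shows "continuous_on UNIV f"
proof (intro continuous_at_imp_continuous_on ballI)
  fix x
  obtain U \<phi> where U: "(U, \<phi>) \<in> A" "x \<in> U" using chart_exists by blast
  have "continuous_on U (\<lambda>x. f (inv_into U \<phi> (\<phi> x)))"
    by (rule continuous_on_compose2[OF smooth_on_continuous[OF smooth_fun_chart[OF assms U(1)]]
          chart_continuous[OF U(1)]]) auto
  then have "continuous_on U f" using chart_inv[OF U(1)] by simp
  then show "isCont f x" using U chart_open continuous_on_eq_continuous_at by blast
qed

text \<open>A cutoff in the chart, continued by zero. The continuation is smooth because
  \<open>K\<close> is closed in the whole manifold: it is the image of a closed ball, hence compact,
  and the manifold is Hausdorff. \<open>K\<close> is returned as well, for later continuations by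
  zero.\<close>

lemma bump:
  assumes "(U, \<phi>) \<in> A" "open W" "x \<in> W" "W \<subseteq> U"
  shows "\<exists>\<kappa> N K. smooth_fun A \<kappa> \<and> open N \<and> x \<in> N \<and> N \<subseteq> K \<and> closed K \<and> K \<subseteq> W \<and>
    (\<forall>y\<in>N. \<kappa> y = 1) \<and> (\<forall>y. y \<notin> K \<longrightarrow> \<kappa> y = 0)"
proof -
  obtain E where E: "orthonormal_basis (E :: 'e set)" using orthonormal_basis_model ..
  have "open (\<phi> ` W)" using chart_image_open assms by blast
  then obtain R where R: "R > 0" "cball (\<phi> x) R \<subseteq> \<phi> ` W"
    using assms(3) open_contains_cball by (metis imageI)
  \<comment> \<open>Halved because \<open>cutoff\<close> with radius \<open>r\<close> is only known
    to vanish outside the ball of radius 2 r.\<close>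
  define r where "r = R / 2"
  have r: "r > 0" "cball (\<phi> x) (2 * r) \<subseteq> \<phi> ` W" using R by (auto simp: r_def)
  define K where "K = inv_into U \<phi> ` cball (\<phi> x) (2 * r)"
  define N where "N = U \<inter> \<phi> -` ball (\<phi> x) r"
  define \<kappa> where "\<kappa> y = (if y \<in> U then cutoff (\<phi> x) r (\<phi> y) else 0)" for y
  have KW: "K \<subseteq> W"
  proof
    fix y assume "y \<in> K"
    then obtain \<eta> where \<eta>: "\<eta> \<in> cball (\<phi> x) (2 * r)" "y = inv_into U \<phi> \<eta>" unfolding K_def by blast
    then obtain w where "w \<in> W" "\<eta> = \<phi> w" using r(2) by blast
    then show "y \<in> W" using \<eta> chart_inv[OF assms(1)] assms(4) by auto
  qed
  have "compact K" unfolding K_def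
  proof (rule compact_continuous_image)
    show "continuous_on (cball (\<phi> x) (2 * r)) (inv_into U \<phi>)"
      using chart_inv_continuous[OF assms(1)] r(2) assms(4) continuous_on_subset
      by (metis image_mono order_trans)
  qed (rule compact_cball_finite_dimensional[OF E])
  then have "closed K" by (rule compact_imp_closed)
  have K: "y \<in> K" if "y \<in> U" "\<phi> y \<in> cball (\<phi> x) (2 * r)" for y
    unfolding K_def using that chart_inv[OF assms(1)] by (metis image_eqI)
  have 0: "\<kappa> y = 0" if "y \<notin> K" for y
  proof (cases "y \<in> U")
    case True
    then have "\<phi> y \<notin> ball (\<phi> x) (2 * r)" using K that ball_subset_cball by blast
    then show ?thesis using True cutoff_0[OF r(1)] by (simp add: \<kappa>_def)
  qed (simp add: \<kappa>_def)
  have "smooth_fun A \<kappa>"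
  proof (rule smooth_funI)
    fix y
    show "\<exists>U \<phi> W. (U, \<phi>) \<in> A \<and> open W \<and> y \<in> W \<and> W \<subseteq> U \<and> smooth_on (\<phi> ` W) (\<lambda>y. \<kappa> (inv_into U \<phi> y))"
    proof (cases "y \<in> U")
      case True
      have "smooth_on (\<phi> ` U) (\<lambda>y. \<kappa> (inv_into U \<phi> y))"
        by (rule smooth_on_cong[OF _ _ smooth_on_cutoff[OF E, of _ "\<phi> x" r]])
          (use chart_image_open[OF assms(1)] chart_open[OF assms(1)] chart_inv[OF assms(1)] in \<open>auto simp: \<kappa>_def\<close>)
      then show ?thesis using True assms(1) chart_open by blast
    next
      case False
      obtain V \<psi> where V: "(V, \<psi>) \<in> A" "y \<in> V" using chart_exists by blast
      have op: "open (V \<inter> - K)" using chart_open[OF V(1)] \<open>closed K\<close> by auto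
      have "smooth_on (\<psi> ` (V \<inter> - K)) (\<lambda>y. \<kappa> (inv_into V \<psi> y))"
        by (rule smooth_on_cong[OF chart_image_open[OF V(1) op] _ smooth_on_const[of _ 0]])
          (use chart_inv[OF V(1)] 0 in auto)
      moreover have "y \<notin> K" using False KW assms(4) by blast
      ultimately show ?thesis using V op by (intro exI[of _ V] exI[of _ \<psi>] exI[of _ "V \<inter> - K"]) auto
    qed
  qed
  moreover have "open N" unfolding N_def
    by (rule continuous_open_preimage[OF chart_continuous[OF assms(1)] chart_open[OF assms(1)] open_ball])
  moreover have "x \<in> N" using assms r(1) by (auto simp: N_def)
  moreover have "N \<subseteq> K" using K r(1) by (auto simp: N_def)
  moreover have "\<forall>y\<in>N. \<kappa> y = 1" using cutoff_1[OF r(1), of _ "\<phi> x"] by (auto simp: N_def \<kappa>_def less_imp_le)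
  ultimately show ?thesis using 0 KW \<open>closed K\<close> by blast
qed

lemma bump_exists:
  assumes "open W" "x \<in> W"
  shows "\<exists>\<kappa> N K. smooth_fun A \<kappa> \<and> open N \<and> x \<in> N \<and> N \<subseteq> K \<and> closed K \<and> K \<subseteq> W \<and>
    (\<forall>y\<in>N. \<kappa> y = 1) \<and> (\<forall>y. y \<notin> K \<longrightarrow> \<kappa> y = 0)"
proof -
  obtain U \<phi> where U: "(U, \<phi>) \<in> A" "x \<in> U" using chart_exists by blast
  have "open (W \<inter> U)" "x \<in> W \<inter> U" "W \<inter> U \<subseteq> U" using chart_open[OF U(1)] assms U by auto
  from bump[OF U(1) this] obtain \<kappa> N K where "smooth_fun A \<kappa>" "open N" "x \<in> N" "N \<subseteq> K" "closed K"
    "K \<subseteq> W \<inter> U" "\<forall>y\<in>N. \<kappa> y = 1" "\<forall>y. y \<notin> K \<longrightarrow> \<kappa> y = 0" by (elim exE conjE)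
  then show ?thesis by (intro exI[of _ \<kappa>] exI[of _ N] exI[of _ K]) simp
qed

text \<open>\<open>W\<close> and the complement of the closed set \<open>K\<close> form an open
  cover: on the first the function is a product of smooth functions, on the second it is 0.\<close>

lemma extend_by_zero:
  assumes "(U, \<phi>) \<in> A" "open W" "W \<subseteq> U" "smooth_on (\<phi> ` W) g"
    and "closed K" "K \<subseteq> W" "smooth_fun A \<kappa>" "\<And>y. y \<notin> K \<Longrightarrow> \<kappa> y = 0"
  shows "smooth_fun A (\<lambda>y. if y \<in> W then \<kappa> y * g (\<phi> y) else 0)" (is "smooth_fun A ?f")
proof (rule smooth_funI)
  fix x
  show "\<exists>U \<phi> W. (U, \<phi>) \<in> A \<and> open W \<and> x \<in> W \<and> W \<subseteq> U \<and> smooth_on (\<phi> ` W) (\<lambda>y. ?f (inv_into U \<phi> y))"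
  proof (cases "x \<in> W")
    case True
    have op: "open (\<phi> ` W)" by (rule chart_image_open[OF assms(1-3)])
    have "smooth_on (\<phi> ` W) (\<lambda>y. \<kappa> (inv_into U \<phi> y) * g y)"
      using smooth_on_subset[OF smooth_fun_chart[OF assms(7,1)], of "\<phi> ` W"] assms(3)
      by (intro smooth_on_mult op assms(4)) auto
    then have "smooth_on (\<phi> ` W) (\<lambda>y. ?f (inv_into U \<phi> y))"
      by (rule smooth_on_cong[OF op, rotated]) (use chart_inv[OF assms(1)] assms(3) in auto)
    then show ?thesis using True assms(1-3) by blast
  next
    case False
    obtain V \<psi> where V: "(V, \<psi>) \<in> A" "x \<in> V" using chart_exists by blast
    have op: "open (V \<inter> - K)" using chart_open[OF V(1)] assms(5) by auto
    have "smooth_on (\<psi> ` (V \<inter> - K)) (\<lambda>y. ?f (inv_into V \<psi> y))"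
      by (rule smooth_on_cong[OF chart_image_open[OF V(1) op] _ smooth_on_const[of _ 0]])
        (use chart_inv[OF V(1)] assms(8) in auto)
    moreover have "x \<notin> K" using False assms(6) by blast
    ultimately show ?thesis using V op by (intro exI[of _ V] exI[of _ \<psi>] exI[of _ "V \<inter> - K"]) auto
  qed
qed

text \<open>Multiplication by a bump function changes \<open>g\<close> away from \<open>x\<close>,
  hence the smaller neighbourhood \<open>N\<close> on which the bump is 1.\<close>

lemma extension:
  assumes "(U, \<phi>) \<in> A" "open W" "x \<in> W" "W \<subseteq> U" "smooth_on (\<phi> ` W) g"
  shows "\<exists>f N. smooth_fun A f \<and> open N \<and> x \<in> N \<and> N \<subseteq> W \<and> (\<forall>y\<in>N. f y = g (\<phi> y))"
proof -
  obtain \<kappa> N K where *: "smooth_fun A \<kappa>" "open N" "x \<in> N" "N \<subseteq> K" "closed K" "K \<subseteq> W"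
    "\<forall>y\<in>N. \<kappa> y = 1" "\<And>y. y \<notin> K \<Longrightarrow> \<kappa> y = 0" using bump[OF assms(1-4)] by metis
  have "smooth_fun A (\<lambda>y. if y \<in> W then \<kappa> y * g (\<phi> y) else 0)"
    by (rule extend_by_zero[OF assms(1,2,4,5) *(5,6,1,8)])
  then show ?thesis using * by (intro exI[of _ "\<lambda>y. if y \<in> W then \<kappa> y * g (\<phi> y) else 0"] exI[of _ N]) auto
qed

text \<open>Provides the inverse of the pivot in \<open>dual_horizontal_frame\<close>, as a global
  smooth function.\<close>

lemma local_reciprocal:
  assumes "smooth_fun A f" "f x \<noteq> 0"
  shows "\<exists>g N. smooth_fun A g \<and> open N \<and> x \<in> N \<and> (\<forall>y\<in>N. g y * f y = 1)"
proof -
  obtain U \<phi> where U: "(U, \<phi>) \<in> A" "x \<in> U" using chart_exists by blast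
  define W where "W = U \<inter> f -` (- {0})"
  have "open (f -` (- {0}))"
    using smooth_fun_continuous[OF assms(1)] by (intro open_vimage) auto
  then have W: "open W" "x \<in> W" "W \<subseteq> U" using U chart_open assms(2) by (auto simp: W_def)
  have "smooth_on (\<phi> ` W) (\<lambda>y. inverse (f (inv_into U \<phi> y)))"
  proof (rule smooth_on_inverse)
    show "open (\<phi> ` W)" using chart_image_open[OF U(1) W(1,3)] .
    show "smooth_on (\<phi> ` W) (\<lambda>y. f (inv_into U \<phi> y))"
      using smooth_fun_chart[OF assms(1) U(1)] by (rule smooth_on_subset) (use W(3) in auto)
  qed (use chart_inv[OF U(1)] W_def in auto)
  from extension[OF U(1) W this] obtain g N where
    g: "smooth_fun A g" "open N" "x \<in> N" "N \<subseteq> W" "\<forall>y\<in>N. g y = inverse (f (inv_into U \<phi> (\<phi> y)))" by blast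
  have "g y * f y = 1" if "y \<in> N" for y
  proof -
    have "y \<in> U" "f y \<noteq> 0" using g(4) that by (auto simp: W_def)
    then show ?thesis using g(5) that by (simp add: chart_inv[OF U(1)])
  qed
  then show ?thesis using g by blast
qed


subsection \<open>Tangent vectors\<close>

lemma tangent_lin:
  "v \<in> tangent A x \<Longrightarrow> smooth_fun A f \<Longrightarrow> smooth_fun A g \<Longrightarrow> v (\<lambda>y. a * f y + b * g y) = a * v f + b * v g"
  and tangent_mult:
  "v \<in> tangent A x \<Longrightarrow> smooth_fun A f \<Longrightarrow> smooth_fun A g \<Longrightarrow> v (\<lambda>y. f y * g y) = v f * g x + f x * v g"
  and tangent_not_smooth: "v \<in> tangent A x \<Longrightarrow> \<not> smooth_fun A f \<Longrightarrow> v f = 0"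
  unfolding tangent_def by blast+

lemma tangent_add: "v \<in> tangent A x \<Longrightarrow> smooth_fun A f \<Longrightarrow> smooth_fun A g \<Longrightarrow> v (\<lambda>y. f y + g y) = v f + v g"
  using tangent_lin[of v x f g 1 1] by simp

lemma tangent_diff: "v \<in> tangent A x \<Longrightarrow> smooth_fun A f \<Longrightarrow> smooth_fun A g \<Longrightarrow> v (\<lambda>y. f y - g y) = v f - v g"
  using tangent_lin[of v x f g 1 "-1"] by simp

lemma tangent_minus: "v \<in> tangent A x \<Longrightarrow> smooth_fun A f \<Longrightarrow> v (\<lambda>y. - f y) = - v f"
  using tangent_lin[of v x f f "-1" 0] by simp

lemma tangent_const:
  assumes "v \<in> tangent A x"
  shows "v (\<lambda>y. c) = 0"
proof -
  have "v (\<lambda>y. 1) = 0" using tangent_mult[OF assms smooth_fun_const smooth_fun_const, of 1 1] by simp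
  then show ?thesis using tangent_lin[OF assms smooth_fun_const smooth_fun_const, of c 1 0 1] by simp
qed

lemma tangent_sum:
  "v \<in> tangent A x \<Longrightarrow> (\<And>i. i \<in> I \<Longrightarrow> smooth_fun A (f i)) \<Longrightarrow> v (\<lambda>y. \<Sum>i\<in>I. f i y) = (\<Sum>i\<in>I. v (f i))"
proof (induction I rule: infinite_finite_induct)
  case (insert i I)
  then have "v (\<lambda>y. f i y + (\<Sum>i\<in>I. f i y)) = v (f i) + v (\<lambda>y. \<Sum>i\<in>I. f i y)"
    by (intro tangent_add smooth_fun_sum) auto
  then show ?case using insert by simp
qed (simp_all add: tangent_const)

text \<open>With a bump \<kappa> supported in \<open>W\<close>, the product (f - g) \<kappa> is
  identically 0; the product rule at \<open>x\<close>, where \<kappa> = 1 and f = g, leaves only v f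
  - v g.\<close>

lemma tangent_local:
  assumes v: "v \<in> tangent A x" and f: "smooth_fun A f" "smooth_fun A g"
    and W: "open W" "x \<in> W" "\<And>y. y \<in> W \<Longrightarrow> f y = g y"
  shows "v f = v g"
proof -
  obtain \<kappa> N K where \<kappa>: "smooth_fun A \<kappa>" "x \<in> N" "K \<subseteq> W" "\<forall>y\<in>N. \<kappa> y = 1" "\<forall>y. y \<notin> K \<longrightarrow> \<kappa> y = 0"
    using bump_exists[OF W(1,2)] by blast
  have "(\<lambda>y. (f y - g y) * \<kappa> y) = (\<lambda>y. 0)" using \<kappa>(3,5) W(3) by (metis eq_iff_diff_eq_0 mult_eq_0_iff subsetD)
  then have "v (\<lambda>y. (f y - g y) * \<kappa> y) = 0" using tangent_const[OF v] by simp
  then have "(v f - v g) * \<kappa> x + (f x - g x) * v \<kappa> = 0"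
    using tangent_mult[OF v smooth_fun_diff[OF f] \<kappa>(1)] tangent_diff[OF v f] by simp
  then show ?thesis using \<kappa>(2,4) W(2,3) by simp
qed

section \<open>The linear structure and coordinate vectors\<close>

lemma tangent_tzero: "tzero \<in> tangent A x"
  by (simp add: tangent_def tzero_def)

lemma tangent_tlin: "v \<in> tangent A x \<Longrightarrow> w \<in> tangent A x \<Longrightarrow> tlin a v b w \<in> tangent A x"
  by (simp add: tangent_def tlin_def algebra_simps)

text \<open>The directional derivative in the chart, as a derivation; the value 0 on non-smooth
  functions is the normalisation required by \<open>tangent\<close>.\<close>

definition coord_vec :: "'m set \<Rightarrow> ('m \<Rightarrow> 'e) \<Rightarrow> 'm \<Rightarrow> 'e \<Rightarrow> 'm tvec" where
  "coord_vec U \<phi> x e =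
     (\<lambda>f. if smooth_fun A f then frechet_derivative (\<lambda>y. f (inv_into U \<phi> y)) (at (\<phi> x)) e else 0)"

lemma coord_has_derivative:
  assumes "(U, \<phi>) \<in> A" "x \<in> U" "smooth_fun A f"
  shows "((\<lambda>y. f (inv_into U \<phi> y)) has_derivative (\<lambda>e. coord_vec U \<phi> x e f)) (at (\<phi> x))"
  using smooth_on_has_derivative[OF smooth_fun_chart[OF assms(3,1)]] assms
  by (simp add: coord_vec_def)

lemma coord_vec_eq:
  assumes "(U, \<phi>) \<in> A" "x \<in> U" "smooth_fun A f"
    and "((\<lambda>y. f (inv_into U \<phi> y)) has_derivative F) (at (\<phi> x))"
  shows "coord_vec U \<phi> x e f = F e"
  using has_derivative_unique[OF coord_has_derivative[OF assms(1-3)] assms(4)] by metis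

lemma coord_vec_tangent:
  assumes U: "(U, \<phi>) \<in> A" "x \<in> U"
  shows "coord_vec U \<phi> x e \<in> tangent A x"
  unfolding tangent_def
proof (intro CollectI conjI allI impI)
  fix f g a b assume f: "smooth_fun A f" and g: "smooth_fun A g"
  note D = coord_has_derivative[OF U f] coord_has_derivative[OF U g]
  show "coord_vec U \<phi> x e (\<lambda>y. a * f y + b * g y) = a * coord_vec U \<phi> x e f + b * coord_vec U \<phi> x e g"
    by (rule coord_vec_eq[OF U smooth_fun_lin[OF f g]]) (intro has_derivative_add has_derivative_mult_right D)
next
  fix f g assume f: "smooth_fun A f" and g: "smooth_fun A g"
  note D = coord_has_derivative[OF U f] coord_has_derivative[OF U g]
  have "coord_vec U \<phi> x e (\<lambda>y. f y * g y) =
    f (inv_into U \<phi> (\<phi> x)) * coord_vec U \<phi> x e g + coord_vec U \<phi> x e f * g (inv_into U \<phi> (\<phi> x))"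
    by (rule coord_vec_eq[OF U smooth_fun_mult[OF f g]]) (intro has_derivative_mult D)
  then show "coord_vec U \<phi> x e (\<lambda>y. f y * g y) = coord_vec U \<phi> x e f * g x + f x * coord_vec U \<phi> x e g"
    by (simp add: chart_inv[OF U])
qed (simp add: coord_vec_def)

lemma coord_vec_sum:
  assumes U: "(U, \<phi>) \<in> A" "x \<in> U"
  shows "coord_vec U \<phi> x (\<Sum>i\<in>I. c i *\<^sub>R e i) f = (\<Sum>i\<in>I. c i * coord_vec U \<phi> x (e i) f)"
proof (cases "smooth_fun A f")
  case True
  have "linear (\<lambda>e. coord_vec U \<phi> x e f)" using coord_has_derivative[OF U True] by (rule has_derivative_linear)
  then show ?thesis by (simp add: linear_sum[where f = "\<lambda>e. coord_vec U \<phi> x e f"]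
        linear_cmul[where f = "\<lambda>e. coord_vec U \<phi> x e f"])
qed (simp add: coord_vec_def)

lemma coord_vec_coordinate:
  assumes U: "(U, \<phi>) \<in> A" "x \<in> U" and y: "smooth_fun A y"
    and N: "open N" "x \<in> N" "\<And>x. x \<in> N \<Longrightarrow> y x = \<phi> x \<bullet> e"
  shows "coord_vec U \<phi> x w y = w \<bullet> e"
proof (rule coord_vec_eq[OF U y])
  have op: "open (\<phi> ` (U \<inter> N))" using chart_image_open[OF U(1)] chart_open[OF U(1)] N(1) by auto
  show "((\<lambda>\<eta>. y (inv_into U \<phi> \<eta>)) has_derivative (\<lambda>w. w \<bullet> e)) (at (\<phi> x))"
    by (rule has_derivative_transform_within_open[OF
          bounded_linear_imp_has_derivative[OF bounded_linear_inner_left] op])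
      (use U(2) N chart_inv[OF U(1)] in auto)
qed

text \<open>Near \<open>x\<close>, Hadamard's lemma gives f = f(x) + sum of (y_e - c_e) h_e, and the
  product rule at \<open>x\<close> sends this to the sum of v(y_e) h_e(x). So a derivation is
  determined by its values on the coordinate functions, and the coordinate vector with these
  components has the same values.\<close>

lemma tangent_coordinates:
  assumes U: "(U, \<phi>) \<in> A" "x \<in> U" and E: "orthonormal_basis (E :: 'e set)"
    and y: "\<And>e. e \<in> E \<Longrightarrow> smooth_fun A (y e)"
    and N: "open N" "x \<in> N" "\<And>e x. e \<in> E \<Longrightarrow> x \<in> N \<Longrightarrow> y e x = \<phi> x \<bullet> e"
    and v: "v \<in> tangent A x"
  shows "v = coord_vec U \<phi> x (\<Sum>e\<in>E. v (y e) *\<^sub>R e)"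
proof
  fix f
  show "v f = coord_vec U \<phi> x (\<Sum>e\<in>E. v (y e) *\<^sub>R e) f"
  proof (cases "smooth_fun A f")
    case False
    then show ?thesis using tangent_not_smooth[OF v] by (simp add: coord_vec_def)
  next
    case f: True
    define c where "c = \<phi> x"
    have "open (\<phi> ` (U \<inter> N))" using chart_image_open[OF U(1)] chart_open[OF U(1)] N(1) by auto
    then obtain r where r: "r > 0" "ball c r \<subseteq> \<phi> ` (U \<inter> N)"
      using U(2) N(2) open_contains_ball unfolding c_def by (metis IntI imageI)
    have "smooth_on (ball c r) (\<lambda>y. f (inv_into U \<phi> y))"
      using smooth_fun_chart[OF f U(1)] by (rule smooth_on_subset) (use r in auto)
    from Hadamard[OF E this] obtain g where g: "\<forall>e\<in>E. smooth_on (ball c r) (g e)"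
      "\<forall>y\<in>ball c r. f (inv_into U \<phi> y) = f (inv_into U \<phi> c) + (\<Sum>e\<in>E. ((y - c) \<bullet> e) * g e y)" by blast
    define W where "W = U \<inter> \<phi> -` ball c r"
    have oW: "open W" unfolding W_def
      by (rule continuous_open_preimage[OF chart_continuous[OF U(1)] chart_open[OF U(1)] open_ball])
    have W: "x \<in> W" "W \<subseteq> U" "\<phi> ` W \<subseteq> ball c r" using U r(1) by (auto simp: W_def c_def)
    have WN: "W \<subseteq> N"
    proof
      fix z assume z: "z \<in> W"
      then obtain z' where "z' \<in> U \<inter> N" "\<phi> z = \<phi> z'" using r(2) unfolding W_def by blast
      then have "z = z'" using chart_inj[OF U(1)] z W(2) by (auto dest: inj_onD)
      then show "z \<in> N" using \<open>z' \<in> U \<inter> N\<close> by simp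
    qed
    \<comment> \<open>Tangent vectors act on global functions only, so the coefficients from
      Hadamard's lemma are replaced by global functions that agree with them near
      \<open>x\<close>.\<close>
    have "\<forall>e\<in>E. \<exists>h M. smooth_fun A h \<and> open M \<and> x \<in> M \<and> M \<subseteq> W \<and> (\<forall>y\<in>M. h y = g e (\<phi> y))"
      using extension[OF U(1) oW W(1,2)] smooth_on_subset[OF _ W(3)] g(1) by blast
    then obtain h M where h: "\<And>e. e \<in> E \<Longrightarrow> smooth_fun A (h e)" "\<And>e. e \<in> E \<Longrightarrow> open (M e)"
      "\<And>e. e \<in> E \<Longrightarrow> x \<in> M e" "\<And>e. e \<in> E \<Longrightarrow> M e \<subseteq> W" "\<And>e y. e \<in> E \<Longrightarrow> y \<in> M e \<Longrightarrow> h e y = g e (\<phi> y)"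
      by metis
    define L where "L = W \<inter> (\<Inter>e\<in>E. M e)"
    have L: "open L" "x \<in> L"
      using oW W(1) h(2,3) orthonormal_basis_finite[OF E] by (auto simp: L_def intro: open_INT)
    define F where "F z = 1 * f x + 1 * (\<Sum>e\<in>E. (1 * y e z + (- (c \<bullet> e)) * 1) * h e z)" for z
    have yy: "smooth_fun A (\<lambda>z. 1 * y e z + (- (c \<bullet> e)) * 1)" if "e \<in> E" for e
      by (intro smooth_fun_lin y that smooth_fun_const)
    have F: "smooth_fun A F" unfolding F_def
      by (intro smooth_fun_lin smooth_fun_const smooth_fun_sum smooth_fun_mult yy h(1))
    have eq: "f z = F z" if "z \<in> L" for z
    proof -
      have z: "z \<in> U" "\<phi> z \<in> ball c r" "z \<in> N" using that W WN by (auto simp: L_def)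
      have "f z = f (inv_into U \<phi> (\<phi> z))" using chart_inv[OF U(1) z(1)] by simp
      also have "\<dots> = f (inv_into U \<phi> c) + (\<Sum>e\<in>E. ((\<phi> z - c) \<bullet> e) * g e (\<phi> z))" using g(2) z(2) by blast
      also have "f (inv_into U \<phi> c) = f x" unfolding c_def using chart_inv[OF U] by simp
      also have "(\<Sum>e\<in>E. ((\<phi> z - c) \<bullet> e) * g e (\<phi> z)) = (\<Sum>e\<in>E. (y e z - c \<bullet> e) * h e z)"
      proof (intro sum.cong refl)
        fix e assume e: "e \<in> E"
        then have "h e z = g e (\<phi> z)" using that h(5) by (auto simp: L_def)
        then show "((\<phi> z - c) \<bullet> e) * g e (\<phi> z) = (y e z - c \<bullet> e) * h e z"
          using N(3)[OF e z(3)] by (simp add: inner_diff_left)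
      qed
      finally show ?thesis by (simp add: F_def)
    qed
    \<comment> \<open>Proved for every tangent vector at \<open>x\<close>, since it is applied both
      to \<open>v\<close> and to the coordinate vectors.\<close>
    have val: "u f = (\<Sum>e\<in>E. u (y e) * h e x)" if u: "u \<in> tangent A x" for u
    proof -
      have "u f = u F" by (rule tangent_local[OF u f F L eq])
      also have "\<dots> = (\<Sum>e\<in>E. u (\<lambda>z. (1 * y e z + (- (c \<bullet> e)) * 1) * h e z))"
      proof -
        have *: "smooth_fun A (\<lambda>z. (1 * y e z + (- (c \<bullet> e)) * 1) * h e z)" if "e \<in> E" for e
          by (intro smooth_fun_mult yy h(1) that)
        have "u F = 1 * u (\<lambda>z. f x) + 1 * u (\<lambda>z. \<Sum>e\<in>E. (1 * y e z + (- (c \<bullet> e)) * 1) * h e z)"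
          unfolding F_def by (intro tangent_lin[OF u] smooth_fun_const smooth_fun_sum *)
        then show ?thesis using tangent_const[OF u] tangent_sum[OF u *] by simp
      qed
      also have "\<dots> = (\<Sum>e\<in>E. u (y e) * h e x)"
      proof (intro sum.cong refl)
        fix e assume e: "e \<in> E"
        show "u (\<lambda>z. (1 * y e z + (- (c \<bullet> e)) * 1) * h e z) = u (y e) * h e x"
          unfolding tangent_mult[OF u yy[OF e] h(1)[OF e]] tangent_lin[OF u y[OF e] smooth_fun_const]
          using N(3)[OF e N(2)] by (simp add: c_def tangent_const[OF u])
      qed
      finally show ?thesis .
    qed
    have "coord_vec U \<phi> x w f = (\<Sum>e\<in>E. (w \<bullet> e) * h e x)" for w
      unfolding val[OF coord_vec_tangent[OF U]]
      by (intro sum.cong refl) (simp add: coord_vec_coordinate[OF U y N(1,2) N(3)])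
    moreover have "(\<Sum>e\<in>E. v (y e) *\<^sub>R e) \<bullet> e' = v (y e')" if "e' \<in> E" for e'
    proof -
      have "(\<Sum>e\<in>E. v (y e) *\<^sub>R e) \<bullet> e' = (\<Sum>e\<in>E. if e = e' then v (y e) else 0)"
        unfolding inner_sum_left using orthonormal_basis_inner[OF E _ that] by (intro sum.cong) auto
      then show ?thesis using orthonormal_basis_finite[OF E] that by simp
    qed
    ultimately show ?thesis using val[OF v] by simp
  qed
qed

text \<open>Coordinate functions and coordinate fields have to be global objects here, so they are
  cut off; they keep their meaning on the smaller neighbourhood \<open>W\<close> only.\<close>

lemma coordinate_frame:
  assumes E: "orthonormal_basis (E :: 'e set)" and U: "(U, \<phi>) \<in> A" "x0 \<in> U"
  shows "\<exists>y D W. open W \<and> x0 \<in> W \<and> W \<subseteq> U \<and> (\<forall>e\<in>E. smooth_fun A (y e)) \<and>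
    (\<forall>e\<in>E. \<forall>x\<in>W. y e x = \<phi> x \<bullet> e) \<and> (\<forall>w. D w \<in> vfields A) \<and> (\<forall>w. \<forall>x\<in>W. D w x = coord_vec U \<phi> x w)"
proof -
  have "\<forall>e. \<exists>f N. smooth_fun A f \<and> open N \<and> x0 \<in> N \<and> N \<subseteq> U \<and> (\<forall>y\<in>N. f y = \<phi> y \<bullet> e)"
    by (intro allI extension[OF U(1) chart_open[OF U(1)] U(2)] smooth_on_bounded_linear bounded_linear_inner_left) simp
  then obtain y N where y: "\<And>e. smooth_fun A (y e)" "\<And>e. open (N e)" "\<And>e. x0 \<in> N e"
    "\<And>e x. x \<in> N e \<Longrightarrow> y e x = \<phi> x \<bullet> e" by metis
  obtain \<kappa> M K where \<kappa>: "smooth_fun A \<kappa>" "open M" "x0 \<in> M" "M \<subseteq> K" "closed K" "K \<subseteq> U"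
    "\<forall>y\<in>M. \<kappa> y = 1" "\<And>y. y \<notin> K \<Longrightarrow> \<kappa> y = 0"
    using bump[OF U(1) chart_open[OF U(1)] U(2) order_refl] by metis
  define D where "D w x = (if x \<in> U then tlin (\<kappa> x) (coord_vec U \<phi> x w) 0 tzero else tzero)" for w x
  define W where "W = M \<inter> (\<Inter>e\<in>E. N e)"
  have "open W" "x0 \<in> W" "W \<subseteq> U"
    using y(2,3) \<kappa>(2,3,4,6) orthonormal_basis_finite[OF E] by (auto simp: W_def)
  moreover have "D w \<in> vfields A" for w
    unfolding sections_def
  proof (intro CollectI conjI allI impI)
    fix x show "D w x \<in> tangent A x"
      by (simp add: D_def tangent_tlin tangent_tzero coord_vec_tangent[OF U(1)])
  next
    fix f assume f: "smooth_fun A f"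
    have "smooth_fun A (\<lambda>x. if x \<in> U then \<kappa> x * frechet_derivative (\<lambda>y. f (inv_into U \<phi> y)) (at (\<phi> x)) w else 0)"
      using extend_by_zero[OF U(1) chart_open[OF U(1)] order_refl
          smooth_on_derivative[OF smooth_fun_chart[OF f U(1)]] \<kappa>(5,6,1,8)] .
    then show "smooth_fun A (\<lambda>x. D w x f)"
      by (rule back_subst[of "smooth_fun A"]) (auto simp: D_def tlin_def tzero_def coord_vec_def f)
  qed
  moreover have "D w x = coord_vec U \<phi> x w" if "x \<in> W" for w x
    using that \<kappa>(4,6,7) by (auto simp: D_def W_def tlin_def)
  ultimately show ?thesis using y(1,4) by (intro exI[of _ y] exI[of _ D] exI[of _ W]) (auto simp: W_def)
qed

lemma coord_vec_linear:
  assumes U: "(U, \<phi>) \<in> A" "x \<in> U"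
  shows "linear (\<lambda>e. coord_vec U \<phi> x e f)"
proof (cases "smooth_fun A f")
  case True
  then show ?thesis using coord_has_derivative[OF U] has_derivative_linear by blast
next
  case False
  then show ?thesis by (auto simp: coord_vec_def intro: linearI)
qed

lemma tangent_coord_vec:
  assumes U: "(U, \<phi>) \<in> A" "x \<in> U" and v: "v \<in> tangent A x"
  shows "\<exists>e. v = coord_vec U \<phi> x e"
proof -
  obtain E where E: "orthonormal_basis (E :: 'e set)" using orthonormal_basis_model ..
  obtain y D W where *: "open W" "x \<in> W" "\<forall>e\<in>E. smooth_fun A (y e)" "\<forall>e\<in>E. \<forall>x\<in>W. y e x = \<phi> x \<bullet> e"
    using coordinate_frame[OF E U] by (elim exE conjE)
  have "v = coord_vec U \<phi> x (\<Sum>e\<in>E. v (y e) *\<^sub>R e)"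
    by (rule tangent_coordinates[OF U E _ *(1,2) _ v]) (use * in auto)
  then show ?thesis ..
qed

lemma coord_vec_inject:
  assumes U: "(U, \<phi>) \<in> A" "x \<in> U" and eq: "coord_vec U \<phi> x e = coord_vec U \<phi> x e'"
  shows "e = e'"
proof -
  obtain E where E: "orthonormal_basis (E :: 'e set)" using orthonormal_basis_model ..
  obtain y D W where *: "open W" "x \<in> W" "\<forall>e\<in>E. smooth_fun A (y e)" "\<forall>e\<in>E. \<forall>x\<in>W. y e x = \<phi> x \<bullet> e"
    using coordinate_frame[OF E U] by (elim exE conjE)
  have c: "coord_vec U \<phi> x w (y i) = w \<bullet> i" if "i \<in> E" for w i
    by (rule coord_vec_coordinate[OF U _ *(1,2)]) (use * that in auto)
  have "e \<bullet> i = e' \<bullet> i" if "i \<in> E" for i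
    using c[OF that, of e] c[OF that, of e'] by (simp add: eq)
  then have "(\<Sum>i\<in>E. (e \<bullet> i) *\<^sub>R i) = (\<Sum>i\<in>E. (e' \<bullet> i) *\<^sub>R i)" by simp
  then show ?thesis by (simp add: orthonormal_basis_expand[OF E])
qed

text \<open>The chart-free summary for arguments on vector fields and forms: over \<open>W\<close>
  the global fields \<open>D i\<close> are a frame dual to the differentials of the global functions
  \<open>y i\<close>. The index set is the orthonormal basis of the model space itself.\<close>

lemma local_frame:
  "\<exists>(I :: 'e set) y D W. finite I \<and> open W \<and> b \<in> W \<and> (\<forall>i\<in>I. smooth_fun A (y i)) \<and> (\<forall>i\<in>I. D i \<in> vfields A) \<and>
    (\<forall>c\<in>W. \<forall>v\<in>tangent A c. \<forall>f. v f = (\<Sum>i\<in>I. v (y i) * D i c f)) \<and>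
    (\<forall>c\<in>W. \<forall>i\<in>I. \<forall>j\<in>I. D i c (y j) = (if i = j then 1 else 0))"
proof -
  obtain E where E: "orthonormal_basis (E :: 'e set)" using orthonormal_basis_model ..
  obtain U \<phi> where U: "(U, \<phi>) \<in> A" "b \<in> U" using chart_exists by blast
  obtain y D W where *: "open W" "b \<in> W" "W \<subseteq> U" "\<forall>e\<in>E. smooth_fun A (y e)"
    "\<forall>e\<in>E. \<forall>x\<in>W. y e x = \<phi> x \<bullet> e" "\<forall>w. D w \<in> vfields A" "\<forall>w. \<forall>x\<in>W. D w x = coord_vec U \<phi> x w"
    using coordinate_frame[OF E U] by blast
  have "v f = (\<Sum>i\<in>E. v (y i) * D i c f)" if c: "c \<in> W" and v: "v \<in> tangent A c" for c v f
  proof -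
    have "v = coord_vec U \<phi> c (\<Sum>e\<in>E. v (y e) *\<^sub>R e)"
      by (rule tangent_coordinates[OF U(1) _ E _ *(1) c _ v]) (use c * in auto)
    then have "v f = coord_vec U \<phi> c (\<Sum>e\<in>E. v (y e) *\<^sub>R e) f" by (rule fun_cong)
    also have "\<dots> = (\<Sum>i\<in>E. v (y i) * coord_vec U \<phi> c i f)"
      using *(3) c by (intro coord_vec_sum[OF U(1)]) auto
    finally show ?thesis using *(7) c by simp
  qed
  moreover have "D i c (y j) = (if i = j then 1 else 0)" if c: "c \<in> W" and ij: "i \<in> E" "j \<in> E" for c i j
  proof -
    have "D i c (y j) = coord_vec U \<phi> c i (y j)" using *(7) c by simp
    also have "\<dots> = i \<bullet> j" by (rule coord_vec_coordinate[OF U(1) _ _ *(1) c]) (use * c ij in auto)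
    finally show ?thesis using orthonormal_basis_inner[OF E ij] by simp
  qed
  ultimately show ?thesis using * orthonormal_basis_finite[OF E]
    by (intro exI[of _ E] exI[of _ y] exI[of _ D] exI[of _ W]) simp
qed

end


subsection \<open>Vector fields\<close>

abbreviation vlin :: "('m \<Rightarrow> real) \<Rightarrow> 'm vfield \<Rightarrow> ('m \<Rightarrow> real) \<Rightarrow> 'm vfield \<Rightarrow> 'm vfield" where
  "vlin f X g Y \<equiv> (\<lambda>x. tlin (f x) (X x) (g x) (Y x))"

abbreviation vsum :: "'i set \<Rightarrow> ('i \<Rightarrow> 'm \<Rightarrow> real) \<Rightarrow> ('i \<Rightarrow> 'm vfield) \<Rightarrow> 'm vfield" where
  "vsum I c X \<equiv> (\<lambda>x f. \<Sum>i\<in>I. c i x * X i x f)"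

context smooth_manifold
begin

definition linear_distribution :: "'m distribution \<Rightarrow> bool" where
  "linear_distribution D \<longleftrightarrow> (\<forall>x. D x \<subseteq> tangent A x \<and> tzero \<in> D x \<and>
     (\<forall>v\<in>D x. \<forall>w\<in>D x. \<forall>a b. tlin a v b w \<in> D x))"

lemma linear_distribution_tangent: "linear_distribution (tangent A)"
  by (simp add: linear_distribution_def tangent_tzero tangent_tlin)

lemma sections_mem: "X \<in> sections A D \<Longrightarrow> X x \<in> D x"
  and sections_smooth: "X \<in> sections A D \<Longrightarrow> smooth_fun A f \<Longrightarrow> smooth_fun A (\<lambda>x. X x f)"
  by (auto simp: sections_def)

lemma vfields_tangent: "X \<in> vfields A \<Longrightarrow> X x \<in> tangent A x"
  by (rule sections_mem)

lemma sections_subset_vfields: "linear_distribution D \<Longrightarrow> X \<in> sections A D \<Longrightarrow> X \<in> vfields A"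
  unfolding sections_def linear_distribution_def by blast

lemma sections_vlin:
  assumes "linear_distribution D" "X \<in> sections A D" "Y \<in> sections A D" "smooth_fun A f" "smooth_fun A g"
  shows "vlin f X g Y \<in> sections A D"
proof -
  have "smooth_fun A (\<lambda>x. vlin f X g Y x h)" if "smooth_fun A h" for h
    unfolding tlin_def
    by (intro smooth_fun_add smooth_fun_mult assms(4,5) sections_smooth[OF assms(2)] sections_smooth[OF assms(3)] that)
  then show ?thesis using assms(1-3) unfolding sections_def linear_distribution_def by auto
qed

lemma vsum_insert:
  assumes "finite I" "i \<notin> I"
  shows "vsum (insert i I) c X = vlin (c i) (X i) (\<lambda>x. 1) (vsum I c X)"
  using assms by (simp add: fun_eq_iff tlin_def)

lemma sections_zero: "linear_distribution D \<Longrightarrow> (\<lambda>x f. 0) \<in> sections A D"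
  unfolding linear_distribution_def sections_def tzero_def by (auto intro: smooth_fun_const)

lemma sections_vsum:
  assumes "finite I" "linear_distribution D" "\<And>i. i \<in> I \<Longrightarrow> X i \<in> sections A D" "\<And>i. i \<in> I \<Longrightarrow> smooth_fun A (c i)"
  shows "vsum I c X \<in> sections A D"
  using assms(1,3,4)
proof (induction I)
  case empty
  then show ?case using sections_zero[OF assms(2)] by simp
next
  case (insert i I)
  show ?case unfolding vsum_insert[OF insert.hyps]
    using insert by (intro sections_vlin assms(2) smooth_fun_const) auto
qed

text \<open>The components of \<open>v\<close> in a local frame are kept constant; the frame fields
  are already global.\<close>

lemma tangent_extension:
  assumes "v \<in> tangent A x"
  shows "\<exists>X\<in>vfields A. X x = v"
proof -
  obtain I :: "'e set" and y D W where *: "finite I" "x \<in> W" "\<forall>i\<in>I. D i \<in> vfields A"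
    "\<forall>c\<in>W. \<forall>v\<in>tangent A c. \<forall>f. v f = (\<Sum>i\<in>I. v (y i) * D i c f)"
    using local_frame[of x] by (elim exE conjE)
  show ?thesis
  proof
    show "vsum I (\<lambda>i x. v (y i)) D \<in> vfields A"
      using * by (intro sections_vsum linear_distribution_tangent smooth_fun_const) auto
    show "vsum I (\<lambda>i x. v (y i)) D x = v" using *(2,4) assms by (simp add: fun_eq_iff)
  qed
qed

lemma tensorial_vsum:
  assumes "finite I"
    and L: "\<And>X Y f g. X \<in> vfields A \<Longrightarrow> Y \<in> vfields A \<Longrightarrow> smooth_fun A f \<Longrightarrow> smooth_fun A g \<Longrightarrow>
        L (vlin f X g Y) = f x * L X + g x * L Y"
    and "\<And>i. i \<in> I \<Longrightarrow> X i \<in> vfields A" "\<And>i. i \<in> I \<Longrightarrow> smooth_fun A (c i)"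
  shows "L (vsum I c X) = (\<Sum>i\<in>I. c i x * (L (X i) :: real))"
  using assms(1,3,4)
proof (induction I)
  case empty
  let ?Z = "\<lambda>x f. 0 :: real"
  have "?Z \<in> vfields A" by (rule sections_zero[OF linear_distribution_tangent])
  from L[OF this this smooth_fun_const smooth_fun_const, of 0 0] show ?case
    by (simp add: tlin_def)
next
  case (insert i I)
  have "vsum I c X \<in> vfields A" using insert by (intro sections_vsum linear_distribution_tangent) auto
  then have "L (vlin (c i) (X i) (\<lambda>x. 1) (vsum I c X)) = c i x * L (X i) + 1 * L (vsum I c X)"
    using insert.prems by (intro L smooth_fun_const) auto
  then show ?case unfolding vsum_insert[OF insert.hyps] using insert by simp
qed

text \<open>For Z = X - Y, the field \<kappa> Z is globally the combination of the frame fields with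
  coefficients \<kappa> Z(y_i). These vanish at \<open>x\<close>, so L(\<kappa> Z) = 0, while
  \<kappa>(x) = 1 gives L(\<kappa> Z) = L X - L Y.\<close>

lemma tensorial_pointwise:
  assumes L: "\<And>X Y f g. X \<in> vfields A \<Longrightarrow> Y \<in> vfields A \<Longrightarrow> smooth_fun A f \<Longrightarrow> smooth_fun A g \<Longrightarrow>
        L (vlin f X g Y) = f x * L X + g x * (L Y :: real)"
    and X: "X \<in> vfields A" "Y \<in> vfields A" "X x = Y x"
  shows "L X = L Y"
proof -
  obtain I :: "'e set" and y D W where *: "finite I" "open W" "x \<in> W" "\<forall>i\<in>I. smooth_fun A (y i)" "\<forall>i\<in>I. D i \<in> vfields A"
    "\<forall>c\<in>W. \<forall>v\<in>tangent A c. \<forall>f. v f = (\<Sum>i\<in>I. v (y i) * D i c f)"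
    using local_frame[of x] by (elim exE conjE)
  obtain \<kappa> N K where \<kappa>: "smooth_fun A \<kappa>" "x \<in> N" "K \<subseteq> W" "\<forall>y\<in>N. \<kappa> y = 1" "\<forall>y. y \<notin> K \<longrightarrow> \<kappa> y = 0"
    using bump_exists[OF *(2,3)] by (elim exE conjE)
  define Z where "Z = vlin (\<lambda>_. 1) X (\<lambda>_. - 1) Y"
  have Z: "Z \<in> vfields A" unfolding Z_def
    by (intro sections_vlin linear_distribution_tangent X smooth_fun_const)
  have Zx: "Z x f = 0" for f using X(3) by (simp add: Z_def tlin_def)
  \<comment> \<open>The second summand with coefficient 0 is a dummy: linearity of \<open>L\<close>
    is available for combinations \<open>vlin\<close> only. Outside \<open>W\<close> both sides are
    0 because \<kappa> is.\<close>
  have "vlin \<kappa> Z (\<lambda>_. 0) Z = vsum I (\<lambda>i x. \<kappa> x * Z x (y i)) D"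
  proof (intro ext)
    fix c f
    show "vlin \<kappa> Z (\<lambda>_. 0) Z c f = vsum I (\<lambda>i x. \<kappa> x * Z x (y i)) D c f"
    proof (cases "c \<in> W")
      case True
      then have "Z c f = (\<Sum>i\<in>I. Z c (y i) * D i c f)" using *(6) vfields_tangent[OF Z] by blast
      then show ?thesis by (simp add: tlin_def sum_distrib_left mult.assoc)
    next
      case False
      then have "\<kappa> c = 0" using \<kappa>(3,5) by blast
      then show ?thesis by (simp add: tlin_def)
    qed
  qed
  moreover have "L (vsum I (\<lambda>i x. \<kappa> x * Z x (y i)) D) = (\<Sum>i\<in>I. (\<kappa> x * Z x (y i)) * L (D i))"
    using * \<kappa>(1) Z by (intro tensorial_vsum L smooth_fun_mult sections_smooth[OF Z]) auto
  moreover have "L (vlin \<kappa> Z (\<lambda>_. 0) Z) = \<kappa> x * L Z + 0 * L Z"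
    by (intro L Z \<kappa>(1) smooth_fun_const)
  moreover have "L Z = 1 * L X + (- 1) * L Y" unfolding Z_def by (intro L X smooth_fun_const)
  ultimately show ?thesis using \<kappa>(2,4) by (simp add: Zx)
qed

lemma lie_bracket_vfields:
  assumes X: "X \<in> vfields A" and Y: "Y \<in> vfields A"
  shows "lie_bracket X Y \<in> vfields A"
proof -
  note XT = vfields_tangent[OF X] and YT = vfields_tangent[OF Y]
  note Xs = sections_smooth[OF X] and Ys = sections_smooth[OF Y]
  have "lie_bracket X Y x \<in> tangent A x" for x
    unfolding tangent_def
  proof (intro CollectI conjI allI impI)
    fix f g a b assume f: "smooth_fun A f" "smooth_fun A g"
    then show "lie_bracket X Y x (\<lambda>y. a * f y + b * g y) = a * lie_bracket X Y x f + b * lie_bracket X Y x g"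
      by (simp add: lie_bracket_def tangent_lin[OF XT] tangent_lin[OF YT] Xs Ys algebra_simps)
  next
    fix f g assume f: "smooth_fun A f" "smooth_fun A g"
    then show "lie_bracket X Y x (\<lambda>y. f y * g y) = lie_bracket X Y x f * g x + f x * lie_bracket X Y x g"
      by (simp add: lie_bracket_def tangent_mult[OF XT] tangent_mult[OF YT] Xs Ys
          tangent_add[OF XT] tangent_add[OF YT] smooth_fun_mult algebra_simps)
  next
    \<comment> \<open>On a non-smooth function both fields return the zero function by convention,
      and tangent vectors kill constants.\<close>
    fix f assume "\<not> smooth_fun A f"
    then show "lie_bracket X Y x f = 0"
      by (simp add: lie_bracket_def tangent_not_smooth[OF XT] tangent_not_smooth[OF YT]
          tangent_const[OF XT] tangent_const[OF YT])
  qed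
  moreover have "smooth_fun A (\<lambda>x. lie_bracket X Y x f)" if "smooth_fun A f" for f
    unfolding lie_bracket_def using that by (intro smooth_fun_diff Xs Ys)
  ultimately show ?thesis by (auto simp: sections_def)
qed

lemma lie_bracket_antisym: "lie_bracket Y X x = tlin (- 1) (lie_bracket X Y x) 0 (lie_bracket X Y x)"
  by (simp add: lie_bracket_def tlin_def)

lemma lie_bracket_vlin:
  assumes X: "X \<in> vfields A" and X': "X' \<in> vfields A" and Y: "Y \<in> vfields A"
    and f: "smooth_fun A f" and g: "smooth_fun A g"
  shows "lie_bracket (vlin f X g X') Y x =
    tlin 1 (tlin (f x) (lie_bracket X Y x) (g x) (lie_bracket X' Y x)) 1
      (tlin (- Y x f) (X x) (- Y x g) (X' x))"
proof
  fix h
  note T = vfields_tangent[OF X] vfields_tangent[OF X'] vfields_tangent[OF Y]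
  note S = sections_smooth[OF X] sections_smooth[OF X'] sections_smooth[OF Y]
  show "lie_bracket (vlin f X g X') Y x h =
    tlin 1 (tlin (f x) (lie_bracket X Y x) (g x) (lie_bracket X' Y x)) 1
      (tlin (- Y x f) (X x) (- Y x g) (X' x)) h"
  proof (cases "smooth_fun A h")
    case True
    then show ?thesis
      by (simp add: lie_bracket_def tlin_def tangent_add[OF T(3)] tangent_mult[OF T(3)] S smooth_fun_mult f g algebra_simps)
  next
    case False
    then show ?thesis
      by (simp add: lie_bracket_def tlin_def T[THEN tangent_not_smooth] T[THEN tangent_const])
  qed
qed

text \<open>Arranged with all double brackets nested to the left, as they appear in d d\<omega>,
  where the formula for d puts each bracket into the first slot.\<close>

lemma lie_bracket_Jacobi:
  assumes X: "X \<in> vfields A" and Y: "Y \<in> vfields A" and Z: "Z \<in> vfields A"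
  shows "lie_bracket (lie_bracket X Y) Z x =
    tlin 1 (lie_bracket (lie_bracket X Z) Y x) (- 1) (lie_bracket (lie_bracket Y Z) X x)"
proof
  fix h
  note T = vfields_tangent[OF X] vfields_tangent[OF Y] vfields_tangent[OF Z]
  note S = sections_smooth[OF X] sections_smooth[OF Y] sections_smooth[OF Z]
  show "lie_bracket (lie_bracket X Y) Z x h =
    tlin 1 (lie_bracket (lie_bracket X Z) Y x) (- 1) (lie_bracket (lie_bracket Y Z) X x) h"
  proof (cases "smooth_fun A h")
    case True
    then show ?thesis
      by (simp add: lie_bracket_def tlin_def T[THEN tangent_diff] S)
  next
    case False
    then show ?thesis
      by (simp add: lie_bracket_def tlin_def T[THEN tangent_not_smooth] T[THEN tangent_const])
  qed
qed


subsection \<open>Forms of degree two and three\<close>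

text \<open>Alternation and antisymmetry are equivalent here: one way by polarisation with u + v,
  the other because a real number equal to its negative is 0. Antisymmetry carries linearity from
  the first slot to the second.\<close>

lemma form2_iff:
  assumes "linear_distribution D"
  shows "form A D 2 \<omega> \<longleftrightarrow>
    (\<forall>x. \<forall>u\<in>D x. \<forall>v\<in>D x. \<forall>w\<in>D x. \<forall>a b. \<omega> x [tlin a u b v, w] = a * \<omega> x [u, w] + b * \<omega> x [v, w]) \<and>
    (\<forall>x. \<forall>u\<in>D x. \<forall>v\<in>D x. \<omega> x [u, v] = - \<omega> x [v, u]) \<and>
    (\<forall>X\<in>sections A D. \<forall>Y\<in>sections A D. smooth_fun A (\<lambda>x. \<omega> x [X x, Y x]))"
    (is "_ \<longleftrightarrow> ?lin \<and> ?anti \<and> ?smooth")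
proof -
  have alt: "alternating_on (D x) 2 (\<omega> x) \<longleftrightarrow>
      (\<forall>u\<in>D x. \<forall>v\<in>D x. \<forall>w\<in>D x. \<forall>a b. \<omega> x [tlin a u b v, w] = a * \<omega> x [u, w] + b * \<omega> x [v, w]) \<and>
      (\<forall>u\<in>D x. \<forall>v\<in>D x. \<omega> x [u, v] = - \<omega> x [v, u])" (is "?L \<longleftrightarrow> ?R1 \<and> ?R2") for x
  proof
    assume ?L
    then have lin: "\<And>vs i a b v w. length vs = 2 \<Longrightarrow> set vs \<subseteq> D x \<Longrightarrow> i < 2 \<Longrightarrow> v \<in> D x \<Longrightarrow> w \<in> D x \<Longrightarrow>
        \<omega> x (vs[i := tlin a v b w]) = a * \<omega> x (vs[i := v]) + b * \<omega> x (vs[i := w])"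
      and alt: "\<And>vs i j. length vs = 2 \<Longrightarrow> set vs \<subseteq> D x \<Longrightarrow> i < j \<Longrightarrow> j < 2 \<Longrightarrow> vs ! i = vs ! j \<Longrightarrow> \<omega> x vs = 0"
      unfolding alternating_on_def by blast+
    have l1: "\<omega> x [tlin a u b v, w] = a * \<omega> x [u, w] + b * \<omega> x [v, w]"
      and l2: "\<omega> x [w, tlin a u b v] = a * \<omega> x [w, u] + b * \<omega> x [w, v]"
      if "u \<in> D x" "v \<in> D x" "w \<in> D x" for u v w a b
      using lin[of "[u, w]" 0 u v a b] lin[of "[w, u]" 1 u v a b] that by simp_all
    have z: "\<omega> x [u, u] = 0" if "u \<in> D x" for u using alt[of "[u, u]" 0 1] that by simp
    have "\<omega> x [u, v] = - \<omega> x [v, u]" if uv: "u \<in> D x" "v \<in> D x" for u v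
    proof -
      have uv': "tlin 1 u 1 v \<in> D x" using uv assms unfolding linear_distribution_def by blast
      show ?thesis using z[OF uv'] uv by (simp add: l1[OF uv uv'] l2[OF uv] z)
    qed
    then show "?R1 \<and> ?R2" using l1 by blast
  next
    assume R: "?R1 \<and> ?R2"
    have l2: "\<omega> x [w, tlin a u b v] = a * \<omega> x [w, u] + b * \<omega> x [w, v]"
      if uv: "u \<in> D x" "v \<in> D x" "w \<in> D x" for u v w a b
    proof -
      have uv': "tlin a u b v \<in> D x" using uv assms unfolding linear_distribution_def by blast
      have "\<omega> x [w, tlin a u b v] = - \<omega> x [tlin a u b v, w]" "\<omega> x [w, u] = - \<omega> x [u, w]"
        "\<omega> x [w, v] = - \<omega> x [v, w]" using R uv uv' by blast+
      moreover have "\<omega> x [tlin a u b v, w] = a * \<omega> x [u, w] + b * \<omega> x [v, w]" using R uv by blast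
      ultimately show ?thesis by simp
    qed
    have z: "\<omega> x [u, u] = 0" if "u \<in> D x" for u
    proof -
      have "\<omega> x [u, u] = - \<omega> x [u, u]" using R that by blast
      then show ?thesis by simp
    qed
    have l1: "\<omega> x [tlin a u b v, w] = a * \<omega> x [u, w] + b * \<omega> x [v, w]"
      if "u \<in> D x" "v \<in> D x" "w \<in> D x" for u v w a b
      using R that by blast
    show ?L unfolding alternating_on_def
    proof (intro conjI allI impI)
      fix vs and i :: nat and a b v w
      assume *: "length (vs :: 'm tvec list) = 2" "set vs \<subseteq> D x" "i < 2" "v \<in> D x" "w \<in> D x"
      obtain s t where st: "vs = [s, t]" using *(1) by (auto simp: length_Suc_conv numeral_2_eq_2)
      have "i = 0 \<or> i = 1" using *(3) by linarith
      then show "\<omega> x (vs[i := tlin a v b w]) = a * \<omega> x (vs[i := v]) + b * \<omega> x (vs[i := w])"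
      proof
        assume "i = 0"
        moreover have "\<omega> x [tlin a v b w, t] = a * \<omega> x [v, t] + b * \<omega> x [w, t]"
          using *(2,4,5) st by (intro l1) auto
        ultimately show ?thesis by (simp add: st)
      next
        assume "i = 1"
        moreover have "\<omega> x [s, tlin a v b w] = a * \<omega> x [s, v] + b * \<omega> x [s, w]"
          using *(2,4,5) st by (intro l2) auto
        ultimately show ?thesis by (simp add: st)
      qed
    next
      fix vs and i j :: nat
      assume *: "length (vs :: 'm tvec list) = 2" "set vs \<subseteq> D x" "i < j" "j < 2" "vs ! i = vs ! j"
      obtain s t where st: "vs = [s, t]" using *(1) by (auto simp: length_Suc_conv numeral_2_eq_2)
      have "i = 0" "j = 1" using *(3,4) by linarith+
      then have "s = t" using *(5) by (simp add: st)
      then have "vs = [s, s]" "s \<in> D x" using *(2) st by auto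
      then show "\<omega> x vs = 0" using z by simp
    qed
  qed
  have sm: "(\<forall>Xs. length Xs = 2 \<longrightarrow> set Xs \<subseteq> sections A D \<longrightarrow> smooth_fun A (apply_form \<omega> Xs)) \<longleftrightarrow> ?smooth"
  proof (intro iffI ballI allI impI)
    fix X Y assume "\<forall>Xs. length Xs = 2 \<longrightarrow> set Xs \<subseteq> sections A D \<longrightarrow> smooth_fun A (apply_form \<omega> Xs)"
      "X \<in> sections A D" "Y \<in> sections A D"
    then have "smooth_fun A (apply_form \<omega> [X, Y])" by simp
    then show "smooth_fun A (\<lambda>x. \<omega> x [X x, Y x])" by (simp add: apply_form_def)
  next
    fix Xs :: "'m vfield list" assume *: ?smooth "length Xs = 2" "set Xs \<subseteq> sections A D"
    obtain X Y where "Xs = [X, Y]" using *(2) by (auto simp: length_Suc_conv numeral_2_eq_2)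
    then show "smooth_fun A (apply_form \<omega> Xs)" using * by (simp add: apply_form_def)
  qed
  show ?thesis unfolding form_def alt sm by blast
qed

text \<open>Two adjacent transpositions generate all permutations of three slots, so linearity in
  the first slot carries over to the others.\<close>

lemma form3I:
  assumes D: "linear_distribution D"
    and lin: "\<And>x u v w t a b. u \<in> D x \<Longrightarrow> v \<in> D x \<Longrightarrow> w \<in> D x \<Longrightarrow> t \<in> D x \<Longrightarrow>
      \<omega> x [tlin a u b v, w, t] = a * \<omega> x [u, w, t] + b * \<omega> x [v, w, t]"
    and anti1: "\<And>x u v w. u \<in> D x \<Longrightarrow> v \<in> D x \<Longrightarrow> w \<in> D x \<Longrightarrow> \<omega> x [u, v, w] = - \<omega> x [v, u, w]"
    and anti2: "\<And>x u v w. u \<in> D x \<Longrightarrow> v \<in> D x \<Longrightarrow> w \<in> D x \<Longrightarrow> \<omega> x [u, v, w] = - \<omega> x [u, w, v]"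
    and smooth: "\<And>X Y Z. X \<in> sections A D \<Longrightarrow> Y \<in> sections A D \<Longrightarrow> Z \<in> sections A D \<Longrightarrow>
      smooth_fun A (\<lambda>x. \<omega> x [X x, Y x, Z x])"
  shows "form A D 3 \<omega>"
  unfolding form_def
proof (intro conjI allI impI)
  fix x
  have tl: "tlin a u b v \<in> D x" if "u \<in> D x" "v \<in> D x" for a u b v
    using that D unfolding linear_distribution_def by blast
  have l2: "\<omega> x [s, tlin a u b v, t] = a * \<omega> x [s, u, t] + b * \<omega> x [s, v, t]"
    if "u \<in> D x" "v \<in> D x" "s \<in> D x" "t \<in> D x" for u v s t a b
    using that by (simp add: anti1[of s x] lin tl)
  have l3: "\<omega> x [s, t, tlin a u b v] = a * \<omega> x [s, t, u] + b * \<omega> x [s, t, v]"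
    if "u \<in> D x" "v \<in> D x" "s \<in> D x" "t \<in> D x" for u v s t a b
    using that by (simp add: anti2[of s x t] l2 tl)
  have z12: "\<omega> x [u, u, v] = 0" and z23: "\<omega> x [v, u, u] = 0" if "u \<in> D x" "v \<in> D x" for u v
    using anti1[of u x u v] anti2[of v x u u] that by simp_all
  have z13: "\<omega> x [u, v, u] = 0" if "u \<in> D x" "v \<in> D x" for u v
    using anti1[of u x v u] z23[OF that] that by simp
  show "alternating_on (D x) 3 (\<omega> x)"
    unfolding alternating_on_def
  proof (intro conjI allI impI)
    fix vs and i :: nat and a b v w
    assume *: "length (vs :: 'm tvec list) = 3" "set vs \<subseteq> D x" "i < 3" "v \<in> D x" "w \<in> D x"
    obtain r s t where rst: "vs = [r, s, t]" using *(1) by (auto simp: length_Suc_conv numeral_3_eq_3)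
    consider "i = 0" | "i = 1" | "i = 2" using *(3) by linarith
    then show "\<omega> x (vs[i := tlin a v b w]) = a * \<omega> x (vs[i := v]) + b * \<omega> x (vs[i := w])"
      by cases (use * rst in \<open>simp_all add: lin l2 l3 numeral_2_eq_2\<close>)
  next
    fix vs and i j :: nat
    assume *: "length (vs :: 'm tvec list) = 3" "set vs \<subseteq> D x" "i < j" "j < 3" "vs ! i = vs ! j"
    obtain r s t where rst: "vs = [r, s, t]" using *(1) by (auto simp: length_Suc_conv numeral_3_eq_3)
    consider "i = 0" "j = 1" | "i = 0" "j = 2" | "i = 1" "j = 2" using *(3,4) by linarith
    then show "\<omega> x vs = 0"
      by cases (use * rst in \<open>simp_all add: z12 z13 z23 numeral_2_eq_2\<close>)
  qed
next
  fix Xs :: "'m vfield list" assume *: "length Xs = 3" "set Xs \<subseteq> sections A D"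
  obtain X Y Z where "Xs = [X, Y, Z]" using *(1) by (auto simp: length_Suc_conv numeral_3_eq_3)
  then show "smooth_fun A (apply_form \<omega> Xs)" using * smooth by (simp add: apply_form_def)
qed

end

section \<open>The formula for d in low degrees, and d d = 0 for two-forms\<close>

lemma ext_d_1: "ext_d \<omega> [X] x = X x (\<lambda>y. \<omega> y [])"
  by (simp add: ext_d_def apply_form_def drop_nth_def)

lemma ext_d_3:
  "ext_d \<omega> [X, Y, Z] x =
    X x (\<lambda>y. \<omega> y [Y y, Z y]) - Y x (\<lambda>y. \<omega> y [X y, Z y]) + Z x (\<lambda>y. \<omega> y [X y, Y y]) -
    \<omega> x [lie_bracket X Y x, Z x] + \<omega> x [lie_bracket X Z x, Y x] - \<omega> x [lie_bracket Y Z x, X x]"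
  by (simp add: ext_d_def apply_form_def drop_nth_def lessThan_Suc numeral_eq_Suc)

lemma ext_d_4:
  "ext_d \<omega> [X, Y, Z, W] x =
    X x (\<lambda>y. \<omega> y [Y y, Z y, W y]) - Y x (\<lambda>y. \<omega> y [X y, Z y, W y]) +
    Z x (\<lambda>y. \<omega> y [X y, Y y, W y]) - W x (\<lambda>y. \<omega> y [X y, Y y, Z y]) -
    \<omega> x [lie_bracket X Y x, Z x, W x] + \<omega> x [lie_bracket X Z x, Y x, W x] -
    \<omega> x [lie_bracket X W x, Y x, Z x] - \<omega> x [lie_bracket Y Z x, X x, W x] +
    \<omega> x [lie_bracket Y W x, X x, Z x] - \<omega> x [lie_bracket Z W x, X x, Y x]"
  by (simp add: ext_d_def apply_form_def drop_nth_def lessThan_Suc numeral_eq_Suc)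

locale two_form = smooth_manifold A for A :: "('m::t2_space, 'e::real_inner) atlas" +
  fixes \<omega> :: "'m form"
  assumes form: "form A (tangent A) 2 \<omega>"
begin

lemma lin1: "u \<in> tangent A x \<Longrightarrow> v \<in> tangent A x \<Longrightarrow> w \<in> tangent A x \<Longrightarrow>
    \<omega> x [tlin a u b v, w] = a * \<omega> x [u, w] + b * \<omega> x [v, w]"
  and anti: "u \<in> tangent A x \<Longrightarrow> v \<in> tangent A x \<Longrightarrow> \<omega> x [u, v] = - \<omega> x [v, u]"
  and smooth: "X \<in> vfields A \<Longrightarrow> Y \<in> vfields A \<Longrightarrow> smooth_fun A (\<lambda>x. \<omega> x [X x, Y x])"
  using form unfolding form2_iff[OF linear_distribution_tangent] by blast+

lemma lin2: "u \<in> tangent A x \<Longrightarrow> v \<in> tangent A x \<Longrightarrow> w \<in> tangent A x \<Longrightarrow>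
    \<omega> x [w, tlin a u b v] = a * \<omega> x [w, u] + b * \<omega> x [w, v]"
  using anti[of w x] lin1 tangent_tlin by simp

lemma ext_d_anti1:
  assumes X: "X \<in> vfields A" and Y: "Y \<in> vfields A" and Z: "Z \<in> vfields A"
  shows "ext_d \<omega> [Y, X, Z] x = - ext_d \<omega> [X, Y, Z] x"
proof -
  note T = X[THEN vfields_tangent] Y[THEN vfields_tangent] Z[THEN vfields_tangent]
  have "\<omega> x [lie_bracket Y X x, Z x] = - \<omega> x [lie_bracket X Y x, Z x]"
    by (subst lie_bracket_antisym) (simp add: lin1 lie_bracket_vfields[OF X Y] vfields_tangent T)
  moreover have "Z x (\<lambda>y. \<omega> y [Y y, X y]) = - Z x (\<lambda>y. \<omega> y [X y, Y y])"
    using tangent_minus[OF T(3) smooth[OF X Y]] anti[OF T(2,1)] by simp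
  ultimately show ?thesis unfolding ext_d_3 by simp
qed

lemma ext_d_anti2:
  assumes X: "X \<in> vfields A" and Y: "Y \<in> vfields A" and Z: "Z \<in> vfields A"
  shows "ext_d \<omega> [X, Z, Y] x = - ext_d \<omega> [X, Y, Z] x"
proof -
  note T = X[THEN vfields_tangent] Y[THEN vfields_tangent] Z[THEN vfields_tangent]
  have "\<omega> x [lie_bracket Z Y x, X x] = - \<omega> x [lie_bracket Y Z x, X x]"
    by (subst lie_bracket_antisym) (simp add: lin1 lie_bracket_vfields[OF Y Z] vfields_tangent T)
  moreover have "X x (\<lambda>y. \<omega> y [Z y, Y y]) = - X x (\<lambda>y. \<omega> y [Y y, Z y])"
    using tangent_minus[OF T(1) smooth[OF Y Z]] anti[OF T(3,2)] by simp
  ultimately show ?thesis unfolding ext_d_3 by simp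
qed

lemma ext_d_smooth:
  assumes X: "X \<in> vfields A" and Y: "Y \<in> vfields A" and Z: "Z \<in> vfields A"
  shows "smooth_fun A (ext_d \<omega> [X, Y, Z])"
proof -
  have "smooth_fun A (\<lambda>x. ext_d \<omega> [X, Y, Z] x)"
    unfolding ext_d_3
    by (intro smooth_fun_add smooth_fun_diff sections_smooth[OF X] sections_smooth[OF Y] sections_smooth[OF Z]
        smooth lie_bracket_vfields X Y Z)
  then show ?thesis by simp
qed

text \<open>The derivatives of the coefficients that come from the product rule cancel those that
  come from [f X, Y] = f [X, Y] - (Y f) X.\<close>

lemma ext_d_vlin:
  assumes X: "X \<in> vfields A" and X': "X' \<in> vfields A" and Y: "Y \<in> vfields A" and Z: "Z \<in> vfields A"
    and f: "smooth_fun A f" and g: "smooth_fun A g"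
  shows "ext_d \<omega> [vlin f X g X', Y, Z] x = f x * ext_d \<omega> [X, Y, Z] x + g x * ext_d \<omega> [X', Y, Z] x"
proof -
  note T = X[THEN vfields_tangent] X'[THEN vfields_tangent] Y[THEN vfields_tangent] Z[THEN vfields_tangent]
  note LT = lie_bracket_vfields[THEN vfields_tangent]
  have b: "\<omega> x [lie_bracket (vlin f X g X') Y x, Z x] =
      f x * \<omega> x [lie_bracket X Y x, Z x] + g x * \<omega> x [lie_bracket X' Y x, Z x] -
      Y x f * \<omega> x [X x, Z x] - Y x g * \<omega> x [X' x, Z x]"
    if Y: "Y \<in> vfields A" and Z: "Z \<in> vfields A" for Y Z
    unfolding lie_bracket_vlin[OF X X' Y f g]
    by (simp add: lin1 tangent_tlin T Y Z X X' LT vfields_tangent)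
  have a: "Y x (\<lambda>y. \<omega> y [vlin f X g X' y, Z y]) =
      Y x f * \<omega> x [X x, Z x] + f x * Y x (\<lambda>y. \<omega> y [X y, Z y]) +
      Y x g * \<omega> x [X' x, Z x] + g x * Y x (\<lambda>y. \<omega> y [X' y, Z y])"
    if Y: "Y \<in> vfields A" and Z: "Z \<in> vfields A" for Y Z
  proof -
    have "(\<lambda>y. \<omega> y [vlin f X g X' y, Z y]) = (\<lambda>y. f y * \<omega> y [X y, Z y] + g y * \<omega> y [X' y, Z y])"
      by (simp add: lin1 T Z vfields_tangent)
    then show ?thesis
      using tangent_mult[OF vfields_tangent[OF Y]] tangent_add[OF vfields_tangent[OF Y]] smooth[OF X Z] smooth[OF X' Z] f g
      by (simp add: smooth_fun_mult)
  qed
  have c: "\<omega> x [U x, vlin f X g X' x] = f x * \<omega> x [U x, X x] + g x * \<omega> x [U x, X' x]" if "U \<in> vfields A" for U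
    by (simp add: lin2 T vfields_tangent that)
  have d: "vlin f X g X' x h = f x * X x h + g x * X' x h" for h by (simp add: tlin_def)
  show ?thesis
    unfolding ext_d_3 a[OF Y Z] a[OF Z Y] b[OF Y Z] b[OF Z Y] c[OF lie_bracket_vfields[OF Y Z]] d
    by (simp add: algebra_simps)
qed

text \<open>The left side is the formula \<open>ext_d_4\<close> for d\<omega> in place of a
  three-form. It is written out because \<open>ext_d \<omega>\<close> takes vector fields rather
  than tangent vectors and so is not itself an object of type \<open>form\<close>.\<close>

lemma ext_d_ext_d:
  assumes X: "X \<in> vfields A" and Y: "Y \<in> vfields A" and Z: "Z \<in> vfields A" and W: "W \<in> vfields A"
  shows "X x (ext_d \<omega> [Y, Z, W]) - Y x (ext_d \<omega> [X, Z, W]) + Z x (ext_d \<omega> [X, Y, W]) - W x (ext_d \<omega> [X, Y, Z]) -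
    ext_d \<omega> [lie_bracket X Y, Z, W] x + ext_d \<omega> [lie_bracket X Z, Y, W] x -
    ext_d \<omega> [lie_bracket X W, Y, Z] x - ext_d \<omega> [lie_bracket Y Z, X, W] x +
    ext_d \<omega> [lie_bracket Y W, X, Z] x - ext_d \<omega> [lie_bracket Z W, X, Y] x = 0"
proof -
  note LT = lie_bracket_vfields[THEN vfields_tangent]
  have d: "U x (ext_d \<omega> [X, Y, Z]) =
    U x (\<lambda>x. X x (\<lambda>y. \<omega> y [Y y, Z y])) - U x (\<lambda>x. Y x (\<lambda>y. \<omega> y [X y, Z y])) +
    U x (\<lambda>x. Z x (\<lambda>y. \<omega> y [X y, Y y])) - U x (\<lambda>x. \<omega> x [lie_bracket X Y x, Z x]) +
    U x (\<lambda>x. \<omega> x [lie_bracket X Z x, Y x]) - U x (\<lambda>x. \<omega> x [lie_bracket Y Z x, X x])"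
    if U: "U \<in> vfields A" and X: "X \<in> vfields A" and Y: "Y \<in> vfields A" and Z: "Z \<in> vfields A" for U X Y Z
  proof -
    note UT = vfields_tangent[OF U]
    have s: "smooth_fun A (\<lambda>x. X x (\<lambda>y. \<omega> y [Y y, Z y]))" if "X \<in> vfields A" "Y \<in> vfields A" "Z \<in> vfields A" for X Y Z
      by (rule sections_smooth[OF that(1) smooth[OF that(2,3)]])
    have "ext_d \<omega> [X, Y, Z] = (\<lambda>x. X x (\<lambda>y. \<omega> y [Y y, Z y]) - Y x (\<lambda>y. \<omega> y [X y, Z y]) + Z x (\<lambda>y. \<omega> y [X y, Y y]) -
      \<omega> x [lie_bracket X Y x, Z x] + \<omega> x [lie_bracket X Z x, Y x] - \<omega> x [lie_bracket Y Z x, X x])"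
      by (rule ext) (rule ext_d_3)
    then show ?thesis
      by (simp add: tangent_diff[OF UT] tangent_add[OF UT] s smooth lie_bracket_vfields smooth_fun_diff smooth_fun_add X Y Z)
  qed
  have br: "lie_bracket X Y x f = X x (\<lambda>y. Y y f) - Y x (\<lambda>y. X y f)" for X Y f by (simp add: lie_bracket_def)
  have J: "\<omega> x [lie_bracket (lie_bracket X Y) Z x, W x] =
      \<omega> x [lie_bracket (lie_bracket X Z) Y x, W x] - \<omega> x [lie_bracket (lie_bracket Y Z) X x, W x]"
    if "X \<in> vfields A" "Y \<in> vfields A" "Z \<in> vfields A" "W \<in> vfields A" for X Y Z W
    unfolding lie_bracket_Jacobi[OF that(1-3)]
    by (simp add: lin1 LT lie_bracket_vfields that vfields_tangent)
  have an: "\<omega> x [lie_bracket X Y x, lie_bracket Z W x] = - \<omega> x [lie_bracket Z W x, lie_bracket X Y x]"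
    if "X \<in> vfields A" "Y \<in> vfields A" "Z \<in> vfields A" "W \<in> vfields A" for X Y Z W
    using that by (intro anti LT)
  \<comment> \<open>Second derivatives combine to derivatives along brackets. The double brackets
    cancel by one Jacobi identity for each field left outside, and the terms with two brackets
    cancel by antisymmetry, once for each splitting of the four fields into pairs.\<close>
  show ?thesis
    unfolding d[OF X Y Z W] d[OF Y X Z W] d[OF Z X Y W] d[OF W X Y Z] ext_d_3
      br[of X Y "\<lambda>y. \<omega> y [Z y, W y]"] br[of X Z "\<lambda>y. \<omega> y [Y y, W y]"] br[of X W "\<lambda>y. \<omega> y [Y y, Z y]"]
      br[of Y Z "\<lambda>y. \<omega> y [X y, W y]"] br[of Y W "\<lambda>y. \<omega> y [X y, Z y]"] br[of Z W "\<lambda>y. \<omega> y [X y, Y y]"]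
    using J[OF X Y Z W] J[OF X Y W Z] J[OF X Z W Y] J[OF Y Z W X]
      an[OF X Y Z W] an[OF X Z Y W] an[OF X W Y Z]
    by linarith
qed

end


section \<open>Ehresmann connections\<close>

locale fibred_connection = M: smooth_manifold A + B: smooth_manifold B
  for A :: "('m::t2_space, 'e::real_inner) atlas" and B :: "('b::t2_space, 'd::real_inner) atlas" +
  fixes p :: "'m \<Rightarrow> 'b" and Hor :: "'m distribution"
  assumes submersion: "submersion A B p"
    and surj: "surj p"
    and connection: "ehresmann_connection A B p Hor"
begin

abbreviation dp :: "'m tvec \<Rightarrow> 'b tvec" where "dp \<equiv> differential B p"
abbreviation Vert :: "'m distribution" where "Vert \<equiv> vertical A B p"

lemma p_continuous: "continuous_on UNIV p"
  using submersion by (simp add: submersion_def smooth_map_def)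

lemma p_smooth_chart:
  assumes "(U, \<phi>) \<in> A" "(W, \<psi>) \<in> B"
  shows "smooth_on (\<phi> ` (U \<inter> p -` W)) (\<lambda>y. \<psi> (p (inv_into U \<phi> y)))"
proof -
  have "\<forall>(U, \<phi>)\<in>A. \<forall>(W, \<psi>)\<in>B. smooth_on (\<phi> ` (U \<inter> p -` W)) (\<psi> \<circ> p \<circ> inv_into U \<phi>)"
    using submersion by (simp add: submersion_def smooth_map_def)
  from bspec[OF this assms(1)] show ?thesis using assms(2) by (auto simp: o_def)
qed

lemma p_chart_domain_open:
  assumes "(U, \<phi>) \<in> A" "(W, \<psi>) \<in> B"
  shows "open (U \<inter> p -` W)" "open (\<phi> ` (U \<inter> p -` W))"
proof -
  show "open (U \<inter> p -` W)"
    using M.chart_open[OF assms(1)] B.chart_open[OF assms(2)] p_continuous by (intro open_Int open_vimage) auto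
  then show "open (\<phi> ` (U \<inter> p -` W))" using M.chart_image_open[OF assms(1)] by simp
qed

lemma smooth_fun_pullback:
  assumes g: "smooth_fun B g"
  shows "smooth_fun A (\<lambda>x. g (p x))"
proof (rule M.smooth_funI)
  fix x
  obtain E where E: "orthonormal_basis (E :: 'd set)" using B.orthonormal_basis_model ..
  obtain U \<phi> where U: "(U, \<phi>) \<in> A" "x \<in> U" using M.chart_exists by blast
  obtain W \<psi> where W: "(W, \<psi>) \<in> B" "p x \<in> W" using B.chart_exists by blast
  note op = p_chart_domain_open[OF U(1) W(1)]
  have "smooth_on (\<phi> ` (U \<inter> p -` W)) (\<lambda>y. g (inv_into W \<psi> (\<psi> (p (inv_into U \<phi> y)))))"
    by (rule smooth_on_compose[OF E op(2) _ B.smooth_fun_chart[OF g W(1)] p_smooth_chart[OF U(1) W(1)]])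
      (use M.chart_inv[OF U(1)] in auto)
  then have "smooth_on (\<phi> ` (U \<inter> p -` W)) (\<lambda>y. g (p (inv_into U \<phi> y)))"
    by (rule smooth_on_cong[OF op(2), rotated])
      (use M.chart_inv[OF U(1)] B.chart_inv[OF W(1)] in auto)
  then show "\<exists>U \<phi> W. (U, \<phi>) \<in> A \<and> open W \<and> x \<in> W \<and> W \<subseteq> U \<and> smooth_on (\<phi> ` W) (\<lambda>y. g (p (inv_into U \<phi> y)))"
    using U W(2) op(1) by (intro exI[of _ U] exI[of _ \<phi>] exI[of _ "U \<inter> p -` W"]) auto
qed

lemma dp_apply: "smooth_fun B g \<Longrightarrow> dp v g = v (\<lambda>x. g (p x))"
  by (simp add: differential_def o_def)

lemma dp_not_smooth: "\<not> smooth_fun B g \<Longrightarrow> dp v g = 0"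
  by (simp add: differential_def)

lemma dp_tlin: "dp (tlin a v b w) = tlin a (dp v) b (dp w)"
  by (simp add: differential_def tlin_def fun_eq_iff)

lemma dp_tangent: "v \<in> tangent A x \<Longrightarrow> dp v \<in> tangent B (p x)"
  and dp_onto: "w \<in> tangent B (p x) \<Longrightarrow> \<exists>v\<in>tangent A x. dp v = w"
proof -
  have eq: "dp ` tangent A x = tangent B (p x)" using submersion by (simp add: submersion_def)
  show "v \<in> tangent A x \<Longrightarrow> dp v \<in> tangent B (p x)" using eq by blast
  assume "w \<in> tangent B (p x)"
  then have "w \<in> dp ` tangent A x" by (simp only: eq)
  then show "\<exists>v\<in>tangent A x. dp v = w" by auto
qed

section \<open>Vertical vectors, horizontal vectors and horizontal lifts\<close>

lemma vertical_iff:
  "v \<in> Vert x \<longleftrightarrow> v \<in> tangent A x \<and> (\<forall>g. smooth_fun B g \<longrightarrow> v (\<lambda>y. g (p y)) = 0)"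
  by (auto simp: vertical_def differential_def tzero_def fun_eq_iff o_def)

lemma vertical_tangent: "v \<in> Vert x \<Longrightarrow> v \<in> tangent A x"
  and vertical_dp: "v \<in> Vert x \<Longrightarrow> dp v = tzero"
  by (auto simp: vertical_def)

lemma verticalI: "v \<in> tangent A x \<Longrightarrow> dp v = tzero \<Longrightarrow> v \<in> Vert x"
  by (simp add: vertical_def)

lemma tlin_tzero: "tlin a tzero b tzero = tzero"
  by (simp add: tlin_def tzero_def)

lemma linear_vertical: "M.linear_distribution Vert"
  by (auto simp: M.linear_distribution_def vertical_iff M.tangent_tlin M.tangent_tzero)
    (simp_all add: tlin_def tzero_def)

lemma linear_horizontal: "M.linear_distribution Hor"
  using connection unfolding ehresmann_connection_def M.linear_distribution_def by (elim conjE) simp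

lemma horizontal_tangent: "v \<in> Hor x \<Longrightarrow> v \<in> tangent A x"
  using linear_horizontal unfolding M.linear_distribution_def by blast

lemma horizontal_split: "v \<in> tangent A x \<Longrightarrow> \<exists>v1\<in>Vert x. \<exists>v2\<in>Hor x. v = tlin 1 v1 1 v2"
  and horizontal_vertical: "v \<in> Hor x \<Longrightarrow> v \<in> Vert x \<Longrightarrow> v = tzero"
  and horizontal_extension: "v \<in> Hor x \<Longrightarrow> \<exists>X\<in>sections A Hor. X x = v"
  using connection unfolding ehresmann_connection_def by (elim conjE; blast)+

text \<open>Pointwise version of \<open>hlift\<close>, so that it also applies to families of base
  vectors depending on the point of M, such as the projection of a field that does not come from the
  base.\<close>

definition lift :: "'m \<Rightarrow> 'b tvec \<Rightarrow> 'm tvec" where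
  "lift x w = (THE v. v \<in> Hor x \<and> dp v = w)"

lemma hlift_eq: "hlift B p Hor u = (\<lambda>x. lift x (u (p x)))"
  by (simp add: hlift_def lift_def)

lemma horizontal_unique:
  assumes "v \<in> Hor x" "v' \<in> Hor x" "dp v = dp v'"
  shows "v = v'"
proof -
  have h: "tlin 1 v (- 1) v' \<in> Hor x"
    using linear_horizontal assms(1,2) unfolding M.linear_distribution_def by blast
  moreover have "dp (tlin 1 v (- 1) v') = tzero" unfolding dp_tlin assms(3) by (simp add: tlin_def tzero_def)
  ultimately have "tlin 1 v (- 1) v' = tzero"
    by (intro horizontal_vertical verticalI horizontal_tangent)
  then have "v f - v' f = 0" for f unfolding tlin_def tzero_def by (drule_tac fun_cong[of _ _ f]) simp
  then show ?thesis by (simp add: fun_eq_iff)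
qed

lemma lift:
  assumes w: "w \<in> tangent B (p x)"
  shows lift_horizontal: "lift x w \<in> Hor x" and dp_lift: "dp (lift x w) = w"
proof -
  obtain v where v: "v \<in> tangent A x" "dp v = w" using dp_onto[OF w] by blast
  obtain v1 v2 where v12: "v1 \<in> Vert x" "v2 \<in> Hor x" "v = tlin 1 v1 1 v2" using horizontal_split[OF v(1)] by blast
  have "dp v2 = w" using v(2) vertical_dp[OF v12(1)] unfolding v12(3) dp_tlin by (simp add: tlin_def tzero_def)
  then have "\<exists>!v. v \<in> Hor x \<and> dp v = w" using v12(2) horizontal_unique by metis
  from theI'[OF this] show "lift x w \<in> Hor x" "dp (lift x w) = w" unfolding lift_def by auto
qed

lemma lift_tangent: "w \<in> tangent B (p x) \<Longrightarrow> lift x w \<in> tangent A x"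
  by (intro horizontal_tangent lift_horizontal)

lemma lift_eqI: "v \<in> Hor x \<Longrightarrow> dp v = w \<Longrightarrow> lift x w = v"
  using horizontal_unique lift dp_tangent horizontal_tangent by metis

lemma lift_tlin:
  assumes "v \<in> tangent B (p x)" "w \<in> tangent B (p x)"
  shows "lift x (tlin a v b w) = tlin a (lift x v) b (lift x w)"
proof (rule lift_eqI)
  show "tlin a (lift x v) b (lift x w) \<in> Hor x"
    using linear_horizontal assms[THEN lift_horizontal] unfolding M.linear_distribution_def by blast
qed (simp add: dp_tlin dp_lift assms)

text \<open>
  Gauss--Jordan elimination: one coordinate at a time, the frame \<open>H\<close> is corrected to be dual to the
  \<open>y\<close>s near \<open>x0\<close>, and not only at \<open>x0\<close>.
\<close>

lemma dual_horizontal_frame: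
  assumes I: "finite I" and y: "\<And>i. i \<in> I \<Longrightarrow> smooth_fun A (y i)"
    and H: "\<And>i. i \<in> I \<Longrightarrow> H i \<in> sections A Hor"
    and dual: "\<And>i j. i \<in> I \<Longrightarrow> j \<in> I \<Longrightarrow> H i x0 (y j) = (if i = j then 1 else 0)"
    and J: "J \<subseteq> I"
  shows "\<exists>K N. open N \<and> x0 \<in> N \<and> (\<forall>i\<in>I. K i \<in> sections A Hor) \<and>
    (\<forall>i\<in>I. \<forall>j\<in>I. K i x0 (y j) = (if i = j then 1 else 0)) \<and>
    (\<forall>x\<in>N. \<forall>i\<in>I. \<forall>j\<in>J. K i x (y j) = (if i = j then 1 else 0))"
  using finite_subset[OF J I] J
proof (induction J)
  case empty
  show ?case using H dual by (intro exI[of _ H] exI[of _ UNIV]) simp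
next
  case (insert m J)
  then obtain K N where K: "open N" "x0 \<in> N" "\<forall>i\<in>I. K i \<in> sections A Hor"
    "\<forall>i\<in>I. \<forall>j\<in>I. K i x0 (y j) = (if i = j then 1 else 0)"
    "\<forall>x\<in>N. \<forall>i\<in>I. \<forall>j\<in>J. K i x (y j) = (if i = j then 1 else 0)"
  proof -
    have "J \<subseteq> I" using insert.prems by simp
    from insert.IH[OF this] show ?thesis using that by (elim exE conjE)
  qed
  have m: "m \<in> I" "m \<notin> J" "J \<subseteq> I" using insert by auto
  have Ks: "smooth_fun A (\<lambda>x. K i x (y j))" if "i \<in> I" "j \<in> I" for i j
    using K(3) that y by (intro M.sections_smooth[of "K i" Hor]) auto
  obtain g N' where g: "smooth_fun A g" "open N'" "x0 \<in> N'" "\<forall>x\<in>N'. g x * K m x (y m) = 1"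
    using M.local_reciprocal[OF Ks[OF m(1) m(1)], of x0] K(4) m(1) by auto
  \<comment> \<open>\<open>Km\<close> is the pivot row divided by the pivot; \<open>K'\<close>
    clears the column \<open>y m\<close> in the other rows. The columns in \<open>J\<close> stay as
    they are, because the pivot row is 0 there. At \<open>x0\<close> no value on the
    \<open>y\<close>s changes, so the next pivot is again 1 there.\<close>
  define Km where "Km = vlin g (K m) (\<lambda>_. 0) (K m)"
  define K' where "K' i = (if i = m then Km else vlin (\<lambda>_. 1) (K i) (\<lambda>x. - K i x (y m)) Km)" for i
  have Km: "Km \<in> sections A Hor" unfolding Km_def
    using K(3) m(1) g(1) by (intro M.sections_vlin linear_horizontal M.smooth_fun_const) auto
  have "K' i \<in> sections A Hor" if "i \<in> I" for i
    unfolding K'_def using K(3) m(1) that Km Ks[OF that m(1)]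
    by (auto intro!: M.sections_vlin linear_horizontal M.smooth_fun_const M.smooth_fun_minus)
  moreover have gx0: "g x0 = 1" using g(3,4) K(4) m(1) by force
  have "K' i x0 (y j) = (if i = j then 1 else 0)" if "i \<in> I" "j \<in> I" for i j
    using K(4) that m(1) gx0 by (simp add: K'_def Km_def tlin_def)
  moreover have "K' i x (y j) = (if i = j then 1 else 0)" if x: "x \<in> N \<inter> N'" and ij: "i \<in> I" "j \<in> insert m J" for x i j
  proof -
    have 1: "g x * K m x (y m) = 1" using g(4) x by blast
    have 2: "K i x (y j) = (if i = j then 1 else 0)" if "i \<in> I" "j \<in> J" for i j using K(5) x that by blast
    show ?thesis using ij 1 2 m by (auto simp: K'_def Km_def tlin_def)
  qed
  ultimately show ?case using K(1,2) g(2,3)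
    by (intro exI[of _ K'] exI[of _ "N \<inter> N'"]) auto
qed

text \<open>Smoothness of \<open>Hor\<close> is given only through sections passing through single
  vectors. Such sections through the lifts of a base frame at \<open>x0\<close> are corrected to
  \<open>K i\<close>, dual to the pulled back coordinates near \<open>x0\<close>; the lift of
  \<open>s\<close> is then the sum of the \<open>s x (y i)\<close> times \<open>K i\<close>, with
  smooth coefficients.\<close>

lemma lift_sections:
  assumes s: "\<And>x. s x \<in> tangent B (p x)" and smooth: "\<And>g. smooth_fun B g \<Longrightarrow> smooth_fun A (\<lambda>x. s x g)"
  shows "(\<lambda>x. lift x (s x)) \<in> sections A Hor"
proof -
  have "smooth_fun A (\<lambda>x. lift x (s x) f)" if f: "smooth_fun A f" for f
  proof (rule M.smooth_fun_local)
    fix x0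
    obtain I :: "'d set" and y D W where *: "finite I" "open W" "p x0 \<in> W" "\<forall>i\<in>I. smooth_fun B (y i)" "\<forall>i\<in>I. D i \<in> vfields B"
      "\<forall>c\<in>W. \<forall>v\<in>tangent B c. \<forall>f. v f = (\<Sum>i\<in>I. v (y i) * D i c f)"
      "\<forall>c\<in>W. \<forall>i\<in>I. \<forall>j\<in>I. D i c (y j) = (if i = j then 1 else 0)"
      using B.local_frame[of "p x0"] by (elim exE conjE)
    have DT: "D i c \<in> tangent B c" if "i \<in> I" for i c using *(5) that B.vfields_tangent by blast
    have "\<forall>i\<in>I. \<exists>X. X \<in> sections A Hor \<and> X x0 = lift x0 (D i (p x0))"
      using horizontal_extension[OF lift_horizontal[OF DT]] by blast
    then obtain H where H: "\<And>i. i \<in> I \<Longrightarrow> H i \<in> sections A Hor" "\<And>i. i \<in> I \<Longrightarrow> H i x0 = lift x0 (D i (p x0))"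
      by metis
    let ?y = "\<lambda>i x. y i (p x)"
    have dual: "H i x0 (?y j) = (if i = j then 1 else 0)" if "i \<in> I" "j \<in> I" for i j
    proof -
      have "H i x0 (?y j) = dp (lift x0 (D i (p x0))) (y j)" using *(4) H(2) that by (simp add: dp_apply)
      then show ?thesis using *(3,7) that by (simp add: dp_lift[OF DT])
    qed
    have y: "smooth_fun A (?y i)" if "i \<in> I" for i using *(4) that smooth_fun_pullback by blast
    have "\<exists>K N. open N \<and> x0 \<in> N \<and> (\<forall>i\<in>I. K i \<in> sections A Hor) \<and>
      (\<forall>i\<in>I. \<forall>j\<in>I. K i x0 (?y j) = (if i = j then 1 else 0)) \<and>
      (\<forall>x\<in>N. \<forall>i\<in>I. \<forall>j\<in>I. K i x (?y j) = (if i = j then 1 else 0))"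
      by (rule dual_horizontal_frame[where H = H]) (use *(1) y H(1) dual in simp_all)
    then obtain K N where K: "open N" "x0 \<in> N" "\<forall>i\<in>I. K i \<in> sections A Hor"
      "\<forall>x\<in>N. \<forall>i\<in>I. \<forall>j\<in>I. K i x (?y j) = (if i = j then 1 else 0)" by (elim exE conjE)
    let ?X = "vsum I (\<lambda>i x. s x (y i)) K"
    have X: "?X \<in> sections A Hor"
      using *(1,4) K(3) smooth by (intro M.sections_vsum linear_horizontal) auto
    have "lift x (s x) = ?X x" if x: "x \<in> N \<inter> p -` W" for x
    proof (rule lift_eqI)
      show "?X x \<in> Hor x" by (rule M.sections_mem[OF X])
      show "dp (?X x) = s x"
      proof
        fix g
        show "dp (?X x) g = s x g"
        proof (cases "smooth_fun B g")
          case True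
          \<comment> \<open>\<open>K i\<close> projects to \<open>D i\<close> on the neighbourhood,
            since both have the same components with respect to the coordinate functions
            \<open>y j\<close>.\<close>
          have "K i x (\<lambda>x. g (p x)) = D i (p x) g" if i: "i \<in> I" for i
          proof -
            have KT: "dp (K i x) \<in> tangent B (p x)"
              using K(3) i by (intro dp_tangent horizontal_tangent M.sections_mem[of "K i"]) auto
            have "K i x (\<lambda>x. g (p x)) = dp (K i x) g" using True by (simp add: dp_apply)
            also have "\<dots> = (\<Sum>j\<in>I. dp (K i x) (y j) * D j (p x) g)" using *(6) KT x by blast
            also have "\<dots> = (\<Sum>j\<in>I. if i = j then D j (p x) g else 0)"
              using K(4) x i *(4) by (intro sum.cong) (auto simp: dp_apply)
            also have "\<dots> = D i (p x) g" using *(1) i by simp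
            finally show ?thesis .
          qed
          then have "dp (?X x) g = (\<Sum>i\<in>I. s x (y i) * D i (p x) g)" using True by (simp add: dp_apply)
          also have "\<dots> = s x g" using *(6) s[of x] x by auto
          finally show ?thesis .
        next
          case False
          then show ?thesis using B.tangent_not_smooth[OF s] by (simp add: dp_not_smooth)
        qed
      qed
    qed
    moreover have "open (N \<inter> p -` W)" using K(1) *(2) p_continuous by (intro open_Int open_vimage)
    ultimately show "\<exists>W g. open W \<and> x0 \<in> W \<and> smooth_fun A g \<and> (\<forall>x\<in>W. lift x (s x) f = g x)"
      using K(2) *(3) M.sections_smooth[OF X f]
      by (intro exI[of _ "N \<inter> p -` W"] exI[of _ "\<lambda>x. ?X x f"]) simp
  qed
  then show ?thesis using lift_horizontal[OF s] unfolding sections_def by blast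
qed

section \<open>Horizontal lifts of vector fields\<close>

lemma hlift_horizontal: "u \<in> vfields B \<Longrightarrow> hlift B p Hor u \<in> sections A Hor"
  unfolding hlift_eq
  by (rule lift_sections[OF B.vfields_tangent smooth_fun_pullback[OF B.sections_smooth]])

lemma hlift_vfields: "u \<in> vfields B \<Longrightarrow> hlift B p Hor u \<in> vfields A"
  by (intro M.sections_subset_vfields[OF linear_horizontal] hlift_horizontal)

lemma dp_hlift: "u \<in> vfields B \<Longrightarrow> dp (hlift B p Hor u x) = u (p x)"
  unfolding hlift_eq by (intro dp_lift B.vfields_tangent)

lemma hlift_pullback: "u \<in> vfields B \<Longrightarrow> smooth_fun B g \<Longrightarrow> hlift B p Hor u x (\<lambda>x. g (p x)) = u (p x) g"
  using dp_hlift[of u x] dp_apply[of g "hlift B p Hor u x"] by simp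

lemma hlift_vlin:
  assumes "u \<in> vfields B" "v \<in> vfields B"
  shows "hlift B p Hor (vlin f u g v) = vlin (\<lambda>x. f (p x)) (hlift B p Hor u) (\<lambda>x. g (p x)) (hlift B p Hor v)"
  unfolding hlift_eq using assms by (intro ext) (simp add: lift_tlin B.vfields_tangent)

section \<open>Projection to the vertical bundle along the connection\<close>

definition vpart :: "'m \<Rightarrow> 'm tvec \<Rightarrow> 'm tvec" where
  "vpart x v = tlin 1 v (- 1) (lift x (dp v))"

lemma vpart_vertical:
  assumes v: "v \<in> tangent A x"
  shows "vpart x v \<in> Vert x"
proof (rule verticalI)
  show "vpart x v \<in> tangent A x"
    unfolding vpart_def by (intro M.tangent_tlin lift_tangent dp_tangent v)
  show "dp (vpart x v) = tzero"
    unfolding vpart_def dp_tlin dp_lift[OF dp_tangent[OF v]] by (simp add: tlin_def tzero_def)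
qed

lemma vpart_of_vertical:
  assumes "v \<in> Vert x"
  shows "vpart x v = v"
proof -
  have "lift x tzero = tzero"
    using linear_horizontal unfolding M.linear_distribution_def
    by (intro lift_eqI) (auto simp: differential_def tzero_def)
  then show ?thesis unfolding vpart_def vertical_dp[OF assms] by (simp add: tlin_def tzero_def)
qed

lemma vpart_of_lift: "w \<in> tangent B (p x) \<Longrightarrow> vpart x (lift x w) = tzero"
  unfolding vpart_def by (simp add: dp_lift) (simp add: tlin_def tzero_def)

lemma vpart_hlift: "u \<in> vfields B \<Longrightarrow> vpart x (hlift B p Hor u x) = tzero"
  unfolding hlift_eq by (intro vpart_of_lift B.vfields_tangent)

lemma vpart_tlin:
  assumes "v \<in> tangent A x" "w \<in> tangent A x"
  shows "vpart x (tlin a v b w) = tlin a (vpart x v) b (vpart x w)"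
  using assms by (simp add: vpart_def dp_tlin lift_tlin dp_tangent) (simp add: tlin_def algebra_simps)

lemma vpart_sections:
  assumes X: "X \<in> vfields A"
  shows "(\<lambda>x. vpart x (X x)) \<in> sections A Vert"
proof -
  have "(\<lambda>x. lift x (dp (X x))) \<in> sections A Hor"
  proof (rule lift_sections)
    show "dp (X x) \<in> tangent B (p x)" for x by (intro dp_tangent M.vfields_tangent X)
    show "smooth_fun A (\<lambda>x. dp (X x) g)" if "smooth_fun B g" for g
      using M.sections_smooth[OF X smooth_fun_pullback[OF that]] by (simp add: dp_apply[OF that])
  qed
  then have "(\<lambda>x. lift x (dp (X x))) \<in> vfields A" by (rule M.sections_subset_vfields[OF linear_horizontal])
  then have "(\<lambda>x. vpart x (X x)) \<in> vfields A"
    unfolding vpart_def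
    using M.sections_vlin[OF M.linear_distribution_tangent X _ M.smooth_fun_const M.smooth_fun_const] by simp
  then show ?thesis using vpart_vertical[OF M.vfields_tangent[OF X]] by (simp add: sections_def)
qed

lemma vertical_extension:
  assumes "v \<in> Vert x"
  shows "\<exists>X\<in>sections A Vert. X x = v"
proof -
  obtain X where X: "X \<in> vfields A" "X x = v" using M.tangent_extension[OF vertical_tangent[OF assms]] by blast
  show ?thesis using vpart_sections[OF X(1)] vpart_of_vertical[OF assms] X(2) by (intro bexI) auto
qed

lemma vertical_vfields: "X \<in> sections A Vert \<Longrightarrow> X \<in> vfields A"
  by (rule M.sections_subset_vfields[OF linear_vertical])

lemma vertical_pullback: "X \<in> sections A Vert \<Longrightarrow> smooth_fun B g \<Longrightarrow> X x (\<lambda>x. g (p x)) = 0"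
  using M.sections_mem vertical_iff by metis

text \<open>A tensorial functional sees only the value of the field at \<open>x\<close>. So
  \<open>X\<close> may be replaced by its vertical part plus the lift of any base field with the
  right value at \<open>p x\<close>, even if \<open>X\<close> does not project to a base
  field.\<close>

lemma tensorial_split:
  assumes L: "\<And>X Y f g. X \<in> vfields A \<Longrightarrow> Y \<in> vfields A \<Longrightarrow> smooth_fun A f \<Longrightarrow> smooth_fun A g \<Longrightarrow>
        L (vlin f X g Y) = f x * L X + g x * (L Y :: real)"
    and X: "X \<in> vfields A" and u: "u \<in> vfields B" "u (p x) = dp (X x)"
  shows "L X = L (\<lambda>x. vpart x (X x)) + L (hlift B p Hor u)"
proof -
  have V: "(\<lambda>x. vpart x (X x)) \<in> vfields A" by (intro vertical_vfields vpart_sections X)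
  note H = hlift_vfields[OF u(1)]
  have "L X = L (vlin (\<lambda>_. 1) (\<lambda>x. vpart x (X x)) (\<lambda>_. 1) (hlift B p Hor u))"
  proof (rule M.tensorial_pointwise[where L = L and x = x])
    show "vlin (\<lambda>_. 1) (\<lambda>x. vpart x (X x)) (\<lambda>_. 1) (hlift B p Hor u) \<in> vfields A"
      by (intro M.sections_vlin M.linear_distribution_tangent M.smooth_fun_const V H)
    show "X x = tlin 1 (vpart x (X x)) 1 (hlift B p Hor u x)"
      unfolding hlift_eq u(2) vpart_def by (simp add: tlin_def)
  qed (simp_all add: L X)
  also have "\<dots> = 1 * L (\<lambda>x. vpart x (X x)) + 1 * L (hlift B p Hor u)"
    by (intro L V H M.smooth_fun_const)
  finally show ?thesis by simp
qed

section \<open>Brackets of fields that are related by p\<close>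

lemma lie_bracket_pullback:
  assumes X: "X \<in> vfields A" and Y: "Y \<in> vfields A" and u: "u \<in> vfields B" and v: "v \<in> vfields B"
    and "\<And>x. dp (X x) = u (p x)" "\<And>x. dp (Y x) = v (p x)"
  shows "dp (lie_bracket X Y x) = lie_bracket u v (p x)"
proof
  fix g
  show "dp (lie_bracket X Y x) g = lie_bracket u v (p x) g"
  proof (cases "smooth_fun B g")
    case True
    have 1: "Y x (\<lambda>x. h (p x)) = v (p x) h" "X x (\<lambda>x. h (p x)) = u (p x) h" if "smooth_fun B h" for h x
      using assms(5,6)[of x] dp_apply[OF that] by metis+
    have "dp (lie_bracket X Y x) g = X x (\<lambda>x. v (p x) g) - Y x (\<lambda>x. u (p x) g)"
      using True by (simp add: dp_apply lie_bracket_def 1)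
    also have "\<dots> = u (p x) (\<lambda>b. v b g) - v (p x) (\<lambda>b. u b g)"
      using 1(2)[of "\<lambda>b. v b g"] 1(1)[of "\<lambda>b. u b g"] B.sections_smooth[OF u True] B.sections_smooth[OF v True] by simp
    finally show ?thesis by (simp add: lie_bracket_def)
  next
    case False
    then show ?thesis
      using B.tangent_not_smooth[OF B.vfields_tangent[OF B.lie_bracket_vfields[OF u v]]] by (simp add: dp_not_smooth)
  qed
qed

lemma lie_bracket_zero: "v \<in> vfields B \<Longrightarrow> lie_bracket (\<lambda>b. tzero) v b = tzero"
  by (simp add: lie_bracket_def tzero_def fun_eq_iff B.tangent_const[OF B.vfields_tangent])

lemma tzero_vfields: "(\<lambda>b. tzero) \<in> vfields B"
  using B.sections_zero[OF B.linear_distribution_tangent] by (simp add: tzero_def)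

text \<open>A vertical field is related by p to the zero field, whose bracket with \<open>v\<close>
  is zero.\<close>

lemma lie_bracket_projectable_vertical:
  assumes V: "V \<in> sections A Vert" and Y: "Y \<in> vfields A" and v: "v \<in> vfields B" and "\<And>x. dp (Y x) = v (p x)"
  shows "lie_bracket V Y \<in> sections A Vert"
proof -
  note b = M.lie_bracket_vfields[OF vertical_vfields[OF V] Y]
  have "dp (lie_bracket V Y x) = tzero" for x
    using lie_bracket_pullback[OF vertical_vfields[OF V] Y tzero_vfields v _ assms(4), of x]
      vertical_dp[OF M.sections_mem[OF V]] lie_bracket_zero[OF v] by simp
  then show ?thesis using b verticalI[OF M.vfields_tangent[OF b]] by (simp add: sections_def)
qed

lemma lie_bracket_vertical_hlift:
  "V \<in> sections A Vert \<Longrightarrow> u \<in> vfields B \<Longrightarrow> lie_bracket V (hlift B p Hor u) \<in> sections A Vert"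
  by (rule lie_bracket_projectable_vertical[OF _ hlift_vfields _ dp_hlift])

lemma lie_bracket_vertical:
  "V \<in> sections A Vert \<Longrightarrow> V' \<in> sections A Vert \<Longrightarrow> lie_bracket V V' \<in> sections A Vert"
  by (rule lie_bracket_projectable_vertical[OF _ vertical_vfields tzero_vfields])
    (auto intro: vertical_dp M.sections_mem)

lemma dp_lie_bracket_hlift:
  "u \<in> vfields B \<Longrightarrow> v \<in> vfields B \<Longrightarrow> dp (lie_bracket (hlift B p Hor u) (hlift B p Hor v) x) = lie_bracket u v (p x)"
  by (rule lie_bracket_pullback[OF hlift_vfields hlift_vfields _ _ dp_hlift dp_hlift])


subsection \<open>Functions constant along the fibres\<close>

text \<open>The infinitesimal form of being constant on fibres; the passage to actual constancy, in
  \<open>basic_constant_on_fibre\<close>, uses connected fibres.\<close>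

definition basic :: "('m \<Rightarrow> real) \<Rightarrow> bool" where
  "basic f \<longleftrightarrow> smooth_fun A f \<and> (\<forall>X\<in>sections A Vert. \<forall>x. X x f = 0)"

lemma basic_smooth: "basic f \<Longrightarrow> smooth_fun A f"
  by (simp add: basic_def)

lemma basic_vertical:
  assumes "basic f" "v \<in> Vert x"
  shows "v f = 0"
proof -
  obtain X where "X \<in> sections A Vert" "X x = v" using vertical_extension[OF assms(2)] by blast
  then show ?thesis using assms(1) unfolding basic_def by blast
qed

lemma basic_lift:
  assumes f: "basic f" and v: "v \<in> tangent A x"
  shows "v f = lift x (dp v) f"
proof -
  have "vpart x v f = 0" using basic_vertical[OF f vpart_vertical[OF v]] .
  then show ?thesis by (simp add: vpart_def tlin_def)
qed

text \<open>X(h(u) f) = [X, h(u)] f + h(u)(X f), and both terms vanish because [X, h(u)] is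
  vertical. This stability is the engine of the bootstrap in
  \<open>basic_factor_smooth\<close>.\<close>

lemma basic_hlift:
  assumes f: "basic f" and u: "u \<in> vfields B"
  shows "basic (\<lambda>x. hlift B p Hor u x f)"
  unfolding basic_def
proof (intro conjI ballI allI)
  show "smooth_fun A (\<lambda>x. hlift B p Hor u x f)"
    by (rule M.sections_smooth[OF hlift_vfields[OF u] basic_smooth[OF f]])
  fix X x assume X: "X \<in> sections A Vert"
  have "lie_bracket X (hlift B p Hor u) x f = 0"
    using f lie_bracket_vertical_hlift[OF X u] unfolding basic_def by blast
  moreover have "(\<lambda>y. X y f) = (\<lambda>y. 0)" using f X unfolding basic_def by blast
  ultimately show "X x (\<lambda>x. hlift B p Hor u x f) = 0"
    by (simp add: lie_bracket_def M.tangent_const[OF M.vfields_tangent[OF hlift_vfields[OF u]]])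
qed

lemma dp_coord_vec:
  assumes U: "(U, \<phi>) \<in> A" "x \<in> U" and W: "(W, \<psi>) \<in> B" "p x \<in> W"
  shows "dp (M.coord_vec U \<phi> x e) =
    B.coord_vec W \<psi> (p x) (frechet_derivative (\<lambda>y. \<psi> (p (inv_into U \<phi> y))) (at (\<phi> x)) e)"
proof
  fix g
  let ?Y = "\<lambda>y. \<psi> (p (inv_into U \<phi> y))"
  show "dp (M.coord_vec U \<phi> x e) g = B.coord_vec W \<psi> (p x) (frechet_derivative ?Y (at (\<phi> x)) e) g"
  proof (cases "smooth_fun B g")
    case True
    note op = p_chart_domain_open(2)[OF U(1) W(1)]
    have mem: "\<phi> x \<in> \<phi> ` (U \<inter> p -` W)" using U W by auto
    have Y: "(?Y has_derivative frechet_derivative ?Y (at (\<phi> x))) (at (\<phi> x))"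
      by (rule smooth_on_has_derivative[OF p_smooth_chart[OF U(1) W(1)] mem])
    have "?Y (\<phi> x) = \<psi> (p x)" by (simp add: M.chart_inv[OF U])
    then have "((\<lambda>\<eta>. g (inv_into W \<psi> \<eta>)) has_derivative (\<lambda>d. B.coord_vec W \<psi> (p x) d g)) (at (?Y (\<phi> x)))"
      using B.coord_has_derivative[OF W True] by simp
    from has_derivative_compose[OF Y this]
    have "((\<lambda>y. g (inv_into W \<psi> (?Y y))) has_derivative
        (\<lambda>e. B.coord_vec W \<psi> (p x) (frechet_derivative ?Y (at (\<phi> x)) e) g)) (at (\<phi> x))" .
    then have "((\<lambda>y. g (p (inv_into U \<phi> y))) has_derivative
        (\<lambda>e. B.coord_vec W \<psi> (p x) (frechet_derivative ?Y (at (\<phi> x)) e) g)) (at (\<phi> x))"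
      by (rule has_derivative_transform_within_open[OF _ op mem])
        (use M.chart_inv[OF U(1)] B.chart_inv[OF W(1)] in auto)
    then show ?thesis using M.coord_vec_eq[OF U smooth_fun_pullback[OF True]] True by (simp add: dp_apply)
  next
    case False
    then show ?thesis by (simp add: dp_not_smooth B.coord_vec_def)
  qed
qed

text \<open>By \<open>basic_lift\<close> and \<open>dp_coord_vec\<close> the derivative of a basic
  function in a chart factors through the derivative of p, as \<open>submersion_factor\<close>
  requires. The derivative of \<open>F\<close> is expressed by a lift at some point above \<eta>
  that need not lie in \<open>N\<close>; its independence of that point comes later, from connected
  fibres.\<close>

lemma basic_local:
  assumes f: "basic f" and U: "(U, \<phi>) \<in> A" "x0 \<in> U" and W: "(W, \<psi>) \<in> B" "p x0 \<in> W"
  shows "\<exists>N Q F. open N \<and> x0 \<in> N \<and> (\<forall>x\<in>N. f x = F (\<psi> (p x))) \<and> open Q \<and> \<psi> (p x0) \<in> Q \<and>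
    (\<forall>\<eta>\<in>Q. \<exists>x. p x \<in> W \<and> \<psi> (p x) = \<eta> \<and> f x = F \<eta> \<and>
       (F has_derivative (\<lambda>d. lift x (B.coord_vec W \<psi> (p x) d) f)) (at \<eta>))"
proof -
  obtain E where E: "orthonormal_basis (E :: 'e set)" using M.orthonormal_basis_model ..
  obtain E' where E': "orthonormal_basis (E' :: 'd set)" using B.orthonormal_basis_model ..
  let ?Y = "\<lambda>y. \<psi> (p (inv_into U \<phi> y))"
  let ?S = "\<phi> ` (U \<inter> p -` W)"
  let ?a = "\<lambda>y d. lift (inv_into U \<phi> y) (B.coord_vec W \<psi> (p (inv_into U \<phi> y)) d) f"
  note op = p_chart_domain_open[OF U(1) W(1)]
  have mem: "\<phi> x0 \<in> ?S" using U W by auto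
  have pt: "\<exists>x. x \<in> U \<and> p x \<in> W \<and> y = \<phi> x \<and> inv_into U \<phi> y = x" if "y \<in> ?S" for y
    using that M.chart_inv[OF U(1)] by auto
  have "\<exists>N Q F. open N \<and> \<phi> x0 \<in> N \<and> N \<subseteq> ?S \<and> open Q \<and> ?Y (\<phi> x0) \<in> Q \<and>
    (\<forall>w\<in>N. f (inv_into U \<phi> w) = F (?Y w)) \<and>
    (\<forall>\<eta>\<in>Q. \<exists>w\<in>?S. ?Y w = \<eta> \<and> f (inv_into U \<phi> w) = F \<eta> \<and> (F has_derivative ?a w) (at \<eta>))"
  proof (rule submersion_factor[OF E E' op(2) mem p_smooth_chart[OF U(1) W(1)]])
    fix w assume "w \<in> ?S"
    then obtain x where x: "x \<in> U" "p x \<in> W" "w = \<phi> x" "inv_into U \<phi> w = x" using pt by blast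
    have "M.coord_vec U \<phi> x e f = ?a w (frechet_derivative ?Y (at w) e)" for e
      using basic_lift[OF f M.coord_vec_tangent[OF U(1) x(1), of e]] dp_coord_vec[OF U(1) x(1) W(1) x(2)] x
      by simp
    then show "((\<lambda>y. f (inv_into U \<phi> y)) has_derivative (\<lambda>v. ?a w (frechet_derivative ?Y (at w) v))) (at w)"
      using M.coord_has_derivative[OF U(1) x(1) basic_smooth[OF f]] x(3) by simp
    note c = B.coord_vec_tangent[OF W(1) x(2)]
    have "B.coord_vec W \<psi> (p x) (d + d') = tlin 1 (B.coord_vec W \<psi> (p x) d) 1 (B.coord_vec W \<psi> (p x) d')"
      "B.coord_vec W \<psi> (p x) (r *\<^sub>R d) = tlin r (B.coord_vec W \<psi> (p x) d) 0 (B.coord_vec W \<psi> (p x) d)" for d d' r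
      using B.coord_vec_linear[OF W(1) x(2)] by (simp_all add: fun_eq_iff tlin_def linear_add linear_cmul linear_iff)
    then show "linear (?a w)" unfolding x(4) by (intro linearI) (simp_all add: lift_tlin c, simp_all add: tlin_def)
  next
    fix d
    have Wx: "p (inv_into U \<phi> (\<phi> x0)) = p x0" by (simp add: M.chart_inv[OF U])
    obtain v where v: "v \<in> tangent A x0" "dp v = B.coord_vec W \<psi> (p x0) d"
      using dp_onto[OF B.coord_vec_tangent[OF W]] by blast
    obtain e where "v = M.coord_vec U \<phi> x0 e" using M.tangent_coord_vec[OF U v(1)] by blast
    then have "B.coord_vec W \<psi> (p x0) (frechet_derivative ?Y (at (\<phi> x0)) e) = B.coord_vec W \<psi> (p x0) d"
      using v(2) dp_coord_vec[OF U W] by simp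
    then have "frechet_derivative ?Y (at (\<phi> x0)) e = d" by (rule B.coord_vec_inject[OF W])
    then show "\<exists>e. frechet_derivative ?Y (at (\<phi> x0)) e = d" ..
  qed
  then obtain N Q F where *: "open N" "\<phi> x0 \<in> N" "N \<subseteq> ?S" "open Q" "?Y (\<phi> x0) \<in> Q"
    "\<forall>w\<in>N. f (inv_into U \<phi> w) = F (?Y w)"
    "\<forall>\<eta>\<in>Q. \<exists>w\<in>?S. ?Y w = \<eta> \<and> f (inv_into U \<phi> w) = F \<eta> \<and> (F has_derivative ?a w) (at \<eta>)" by (elim exE conjE)
  define N' where "N' = U \<inter> \<phi> -` N"
  have "open N'" unfolding N'_def
    by (rule continuous_open_preimage[OF M.chart_continuous[OF U(1)] M.chart_open[OF U(1)] *(1)])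
  moreover have "x0 \<in> N'" using U *(2) by (simp add: N'_def)
  moreover have "f x = F (\<psi> (p x))" if "x \<in> N'" for x
  proof -
    have "x \<in> U" "\<phi> x \<in> N" using that by (auto simp: N'_def)
    then show ?thesis using *(6) M.chart_inv[OF U(1), of x] by force
  qed
  moreover have "\<psi> (p x0) \<in> Q" using *(5) by (simp add: M.chart_inv[OF U])
  moreover have "\<exists>x. p x \<in> W \<and> \<psi> (p x) = \<eta> \<and> f x = F \<eta> \<and>
       (F has_derivative (\<lambda>d. lift x (B.coord_vec W \<psi> (p x) d) f)) (at \<eta>)" if \<eta>: "\<eta> \<in> Q" for \<eta>
  proof -
    obtain w where w: "w \<in> ?S" "?Y w = \<eta>" "f (inv_into U \<phi> w) = F \<eta>" "(F has_derivative ?a w) (at \<eta>)"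
      using bspec[OF *(7) \<eta>] by (elim bexE conjE)
    obtain x where "p x \<in> W" "inv_into U \<phi> w = x" using pt[OF w(1)] by blast
    then show ?thesis using w by (intro exI[of _ x]) simp
  qed
  ultimately show ?thesis using *(4) by (intro exI[of _ N'] exI[of _ Q] exI[of _ F]) simp
qed

text \<open>Near each point the function factors through p by \<open>basic_local\<close>, so it is
  locally constant on the fibre, and connectedness does the rest.\<close>

lemma basic_constant_on_fibre:
  assumes f: "basic f" and conn: "connected (p -` {b})" and x: "p x = b" "p x' = b"
  shows "f x = f x'"
proof -
  have "f constant_on p -` {b}"
  proof (rule locally_constant_imp_constant[OF conn])
    fix a assume a: "a \<in> p -` {b}"
    obtain U \<phi> where U: "(U, \<phi>) \<in> A" "a \<in> U" using M.chart_exists by blast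
    obtain W \<psi> where W: "(W, \<psi>) \<in> B" "p a \<in> W" using B.chart_exists by blast
    obtain N F where N: "open N" "a \<in> N" "\<forall>x\<in>N. f x = F (\<psi> (p x))"
      using basic_local[OF f U W] by (elim exE conjE)
    show "\<exists>T. openin (top_of_set (p -` {b})) T \<and> a \<in> T \<and> (\<forall>x\<in>T. f x = f a)"
    proof (intro exI conjI ballI)
      show "openin (top_of_set (p -` {b})) (p -` {b} \<inter> N)" using N(1) by (rule openin_open_Int)
      show "a \<in> p -` {b} \<inter> N" using a N(2) by simp
      show "f x = f a" if "x \<in> p -` {b} \<inter> N" for x using that a N by simp
    qed
  qed
  then obtain c where "\<And>x. x \<in> p -` {b} \<Longrightarrow> f x = c" unfolding constant_on_def by blast
  then show ?thesis using x by simp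
qed

lemma basic_factor:
  assumes "basic f" "\<And>b. connected (p -` {b})"
  shows "\<exists>F. \<forall>x. f x = F (p x)"
proof (intro exI allI)
  fix x
  have "p (inv p (p x)) = p x" using surj by (simp add: surj_f_inv_f)
  then show "f x = (\<lambda>b. f (inv p b)) (p x)"
    using basic_constant_on_fibre[OF assms(1,2) refl, of x "inv p (p x)"] by simp
qed

text \<open>
  In a chart of the base, the partial derivatives of \<open>F\<close> pull back to derivatives of \<open>f\<close> along
  horizontal lifts, which are basic again; this bootstraps differentiability to smoothness.
\<close>

lemma basic_factor_smooth:
  assumes "basic f" and conn: "\<And>b. connected (p -` {b})" and "\<And>x. f x = F (p x)"
  shows "smooth_fun B F"
proof -
  \<comment> \<open>The candidate for the derivative in a chart of the base: the derivative of
    \<open>f\<close> along the lift at the point that \<open>inv p\<close> selects in the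
    fibre.\<close>
  define D where "D W \<psi> f \<eta> d =
      lift (inv p (inv_into W \<psi> \<eta>)) (B.coord_vec W \<psi> (inv_into W \<psi> \<eta>) d) f" for W \<psi> f \<eta> d
  have der: "((\<lambda>\<eta>. F (inv_into W \<psi> \<eta>)) has_derivative D W \<psi> f \<eta>0) (at \<eta>0)"
    if W: "(W, \<psi>) \<in> B" and f: "basic f" and F: "\<And>x. f x = F (p x)" and \<eta>0: "\<eta>0 \<in> \<psi> ` W" for W \<psi> f F \<eta>0
  proof -
    obtain b where b: "b \<in> W" "\<eta>0 = \<psi> b" using \<eta>0 by blast
    define x0 where "x0 = inv p b"
    have x0: "p x0 = b" using surj by (simp add: x0_def surj_f_inv_f)
    obtain U \<phi> where U: "(U, \<phi>) \<in> A" "x0 \<in> U" using M.chart_exists by blast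
    have bW: "p x0 \<in> W" using b x0 by simp
    obtain Q F' where Q: "open Q" "\<psi> (p x0) \<in> Q"
      "\<forall>\<eta>\<in>Q. \<exists>x. p x \<in> W \<and> \<psi> (p x) = \<eta> \<and> f x = F' \<eta> \<and>
         (F' has_derivative (\<lambda>d. lift x (B.coord_vec W \<psi> (p x) d) f)) (at \<eta>)"
      using basic_local[OF f U W bW] by (elim exE conjE)
    have eq: "F' \<eta> = F (inv_into W \<psi> \<eta>)" if \<eta>: "\<eta> \<in> Q" for \<eta>
    proof -
      obtain x where "p x \<in> W" "\<psi> (p x) = \<eta>" "f x = F' \<eta>" using bspec[OF Q(3) \<eta>] by (elim exE conjE)
      then show ?thesis using F[of x] B.chart_inv[OF W, of "p x"] by auto
    qed
    have mem: "\<eta>0 \<in> Q" using Q(2) b x0 by simp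
    obtain x where x: "p x \<in> W" "\<psi> (p x) = \<eta>0"
      "(F' has_derivative (\<lambda>d. lift x (B.coord_vec W \<psi> (p x) d) f)) (at \<eta>0)" using bspec[OF Q(3) mem] by (elim exE conjE)
    have px: "p x = b" using x(1,2) b B.chart_inj[OF W] by (auto dest: inj_onD)
    \<comment> \<open>The derivative is known with the lift at an unspecified point \<open>x\<close>
      of the fibre. As h(u) f is again basic, \<open>x\<close> can be exchanged for the selected
      point \<open>x0\<close>.\<close>
    have "lift x (B.coord_vec W \<psi> b d) f = lift x0 (B.coord_vec W \<psi> b d) f" for d
    proof -
      obtain u where u: "u \<in> vfields B" "u b = B.coord_vec W \<psi> b d"
        using B.tangent_extension[OF B.coord_vec_tangent[OF W b(1)]] by blast
      have "hlift B p Hor u x f = hlift B p Hor u x0 f"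
        by (rule basic_constant_on_fibre[OF basic_hlift[OF f u(1)] conn px x0])
      then show ?thesis by (simp add: hlift_eq px x0 u(2))
    qed
    then have "(F' has_derivative D W \<psi> f \<eta>0) (at \<eta>0)"
      using x(3) b by (simp add: D_def[abs_def] px B.chart_inv[OF W b(1)] x0_def)
    then show ?thesis by (rule has_derivative_transform_within_open[OF _ Q(1) mem eq])
  qed
  have Ck: "Ck_on k (\<psi> ` W) (\<lambda>\<eta>. F (inv_into W \<psi> \<eta>))"
    if W: "(W, \<psi>) \<in> B" and "basic f" "\<And>x. f x = F (p x)" for k f F W \<psi>
    using that(2,3)
  proof (induction k arbitrary: f F)
    case 0
    have "continuous_on (\<psi> ` W) (\<lambda>\<eta>. F (inv_into W \<psi> \<eta>))"
      by (intro continuous_at_imp_continuous_on ballI has_derivative_continuous[OF der[OF W 0]])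
    then show ?case by simp
  next
    case (Suc k)
    have op: "open (\<psi> ` W)" using B.chart_image_open[OF W] B.chart_open[OF W] by simp
    show ?case
    proof (rule Ck_on_SucI[OF op der[OF W Suc.prems]])
      fix d
      show "Ck_on k (\<psi> ` W) (\<lambda>\<eta>. D W \<psi> f \<eta> d)"
      proof (rule Ck_on_local)
        fix \<eta>0 assume "\<eta>0 \<in> \<psi> ` W"
        then obtain b where b: "b \<in> W" "\<eta>0 = \<psi> b" by blast
        obtain E where E: "orthonormal_basis (E :: 'd set)" using B.orthonormal_basis_model ..
        \<comment> \<open>The coordinate fields are global only after a cutoff, so order
          \<open>k\<close> is checked locally: on \<open>W0\<close> the derivative in direction
          \<open>d\<close> is the function on the base that belongs to the basic function h(X d)
          f.\<close>
        obtain X W0 where W0: "open W0" "b \<in> W0" "W0 \<subseteq> W" "\<forall>d. X d \<in> vfields B"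
          "\<forall>d. \<forall>c\<in>W0. X d c = B.coord_vec W \<psi> c d"
          using B.coordinate_frame[OF E W b(1)] by (elim exE conjE)
        have h: "basic (\<lambda>x. hlift B p Hor (X d) x f)" using basic_hlift[OF Suc.prems(1)] W0(4) by blast
        obtain G where G: "\<forall>x. hlift B p Hor (X d) x f = G (p x)" using basic_factor[OF h conn] by blast
        have opW0: "open (\<psi> ` W0)" using B.chart_image_open[OF W W0(1,3)] .
        have "Ck_on k (\<psi> ` W0) (\<lambda>\<eta>. G (inv_into W \<psi> \<eta>))"
          by (rule Ck_on_subset[OF Suc.IH[OF h]]) (use G W0(3) in auto)
        then have "Ck_on k (\<psi> ` W0) (\<lambda>\<eta>. D W \<psi> f \<eta> d)"
        proof (rule Ck_on_cong[OF opW0, rotated])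
          fix \<eta> assume "\<eta> \<in> \<psi> ` W0"
          then obtain c where c: "c \<in> W0" "\<eta> = \<psi> c" by blast
          have i: "inv_into W \<psi> \<eta> = c" using c W0(3) B.chart_inv[OF W] by blast
          have pc: "p (inv p c) = c" using surj by (simp add: surj_f_inv_f)
          have "hlift B p Hor (X d) (inv p c) f = G c" using G pc by metis
          then show "G (inv_into W \<psi> \<eta>) = D W \<psi> f \<eta> d"
            using W0(5) c(1) by (simp add: D_def i hlift_eq pc)
        qed
        then show "\<exists>T. open T \<and> \<eta>0 \<in> T \<and> Ck_on k T (\<lambda>\<eta>. D W \<psi> f \<eta> d)"
          using opW0 W0(2) b(2) by blast
      qed
    qed
  qed
  show ?thesis unfolding smooth_fun_def smooth_on_def o_def using Ck[OF _ assms(1,3)] by auto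
qed

end


section \<open>Two-forms on the total space\<close>

text \<open>The three conditions test, on vertical fields and lifts, that d\<omega> vanishes as soon
  as one argument is vertical. There are two instances: the extension of the symplectic form and the
  pullback of a two-form on the base.\<close>

locale connection_two_form = fibred_connection A B p Hor + W: two_form A \<omega>
  for A :: "('m::t2_space, 'e::real_inner) atlas" and B :: "('b::t2_space, 'd::real_inner) atlas"
    and p :: "'m \<Rightarrow> 'b" and Hor :: "'m distribution" and \<omega> :: "'m form" +
  assumes ext_d_VVV: "\<And>X Y Z x. X \<in> sections A Vert \<Longrightarrow> Y \<in> sections A Vert \<Longrightarrow> Z \<in> sections A Vert \<Longrightarrow>
      ext_d \<omega> [X, Y, Z] x = 0"
    and ext_d_VVH: "\<And>X Y u x. X \<in> sections A Vert \<Longrightarrow> Y \<in> sections A Vert \<Longrightarrow> u \<in> vfields B \<Longrightarrow>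
      ext_d \<omega> [X, Y, hlift B p Hor u] x = 0"
    and ext_d_VHH: "\<And>X u v x. X \<in> sections A Vert \<Longrightarrow> u \<in> vfields B \<Longrightarrow> v \<in> vfields B \<Longrightarrow>
      ext_d \<omega> [X, hlift B p Hor u, hlift B p Hor v] x = 0"
begin

lemma ext_d_vlin2:
  assumes "X \<in> vfields A" "X' \<in> vfields A" "Y \<in> vfields A" "Z \<in> vfields A" "smooth_fun A f" "smooth_fun A g"
  shows "ext_d \<omega> [Y, vlin f X g X', Z] x = f x * ext_d \<omega> [Y, X, Z] x + g x * ext_d \<omega> [Y, X', Z] x"
proof -
  have "vlin f X g X' \<in> vfields A" by (intro M.sections_vlin M.linear_distribution_tangent assms)
  then show ?thesis
    using W.ext_d_vlin[OF assms] W.ext_d_anti1[of _ Y Z x] assms by simp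
qed

lemma ext_d_vlin3:
  assumes "X \<in> vfields A" "X' \<in> vfields A" "Y \<in> vfields A" "Z \<in> vfields A" "smooth_fun A f" "smooth_fun A g"
  shows "ext_d \<omega> [Y, Z, vlin f X g X'] x = f x * ext_d \<omega> [Y, Z, X] x + g x * ext_d \<omega> [Y, Z, X'] x"
proof -
  have "vlin f X g X' \<in> vfields A" by (intro M.sections_vlin M.linear_distribution_tangent assms)
  then show ?thesis
    using ext_d_vlin2[OF assms] W.ext_d_anti2[of Y _ Z x] assms by simp
qed

lemma lift_extension:
  assumes "X \<in> vfields A"
  shows "\<exists>u\<in>vfields B. u (p x) = dp (X x)"
  by (intro B.tangent_extension dp_tangent M.vfields_tangent assms)

text \<open>Splitting the second and then the third argument into vertical part and lift leaves the
  three assumed cases; the case vertical, horizontal, vertical is one of them up to sign.\<close>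

lemma ext_d_vertical:
  assumes X: "X \<in> sections A Vert" and Y: "Y \<in> vfields A" and Z: "Z \<in> vfields A"
  shows "ext_d \<omega> [X, Y, Z] x = 0"
proof -
  note XV = vertical_vfields[OF X]
  have s2: "ext_d \<omega> [X, Y, Z] x = ext_d \<omega> [X, \<lambda>x. vpart x (Y x), Z] x + ext_d \<omega> [X, hlift B p Hor u, Z] x"
    if "Y \<in> vfields A" "Z \<in> vfields A" "u \<in> vfields B" "u (p x) = dp (Y x)" for Y Z u
    by (rule tensorial_split[where L = "\<lambda>Y. ext_d \<omega> [X, Y, Z] x"]) (use that in \<open>simp_all add: ext_d_vlin2 XV\<close>)
  have s3: "ext_d \<omega> [X, Y, Z] x = ext_d \<omega> [X, Y, \<lambda>x. vpart x (Z x)] x + ext_d \<omega> [X, Y, hlift B p Hor u] x"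
    if "Y \<in> vfields A" "Z \<in> vfields A" "u \<in> vfields B" "u (p x) = dp (Z x)" for Y Z u
    by (rule tensorial_split[where L = "\<lambda>Z. ext_d \<omega> [X, Y, Z] x"]) (use that in \<open>simp_all add: ext_d_vlin3 XV\<close>)
  obtain u where u: "u \<in> vfields B" "u (p x) = dp (Y x)" using lift_extension[OF Y] by blast
  obtain v where v: "v \<in> vfields B" "v (p x) = dp (Z x)" using lift_extension[OF Z] by blast
  note VY = vpart_sections[OF Y] and VZ = vpart_sections[OF Z] and hu = hlift_vfields[OF u(1)] and hv = hlift_vfields[OF v(1)]
  have "ext_d \<omega> [X, \<lambda>x. vpart x (Y x), Z] x = 0"
    using s3[OF vertical_vfields[OF VY] Z v] ext_d_VVV[OF X VY VZ] ext_d_VVH[OF X VY v(1)] by simp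
  moreover have "ext_d \<omega> [X, hlift B p Hor u, Z] x = 0"
    using s3[OF hu Z v] W.ext_d_anti2[OF XV vertical_vfields[OF VZ] hu] ext_d_VVH[OF X VZ u(1)] ext_d_VHH[OF X u(1) v(1)] by simp
  ultimately show ?thesis using s2[OF Y Z u] by simp
qed

text \<open>Replacing one argument by a lift with the same projection at \<open>x\<close> changes
  d\<omega> by a term with a vertical argument, that is, by 0. The replacement is carried out in the
  first slot, and antisymmetry brings the other arguments there.\<close>

lemma ext_d_hlift:
  assumes X: "X \<in> vfields A" and Y: "Y \<in> vfields A" and Z: "Z \<in> vfields A"
    and u: "u \<in> vfields B" "u (p x) = dp (X x)" and v: "v \<in> vfields B" "v (p x) = dp (Y x)"
    and w: "w \<in> vfields B" "w (p x) = dp (Z x)"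
  shows "ext_d \<omega> [X, Y, Z] x = ext_d \<omega> [hlift B p Hor u, hlift B p Hor v, hlift B p Hor w] x"
proof -
  have step: "ext_d \<omega> [X, Y, Z] x = ext_d \<omega> [hlift B p Hor u, Y, Z] x"
    if "X \<in> vfields A" "Y \<in> vfields A" "Z \<in> vfields A" "u \<in> vfields B" "u (p x) = dp (X x)" for X Y Z u
  proof -
    have "ext_d \<omega> [X, Y, Z] x = ext_d \<omega> [\<lambda>x. vpart x (X x), Y, Z] x + ext_d \<omega> [hlift B p Hor u, Y, Z] x"
      by (rule tensorial_split[where L = "\<lambda>X. ext_d \<omega> [X, Y, Z] x"]) (use that in \<open>simp_all add: W.ext_d_vlin\<close>)
    then show ?thesis using ext_d_vertical[OF vpart_sections[OF that(1)] that(2,3)] by simp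
  qed
  note h = hlift_vfields[OF u(1)] hlift_vfields[OF v(1)] hlift_vfields[OF w(1)]
  show ?thesis
    using step[OF X Y Z u] step[OF Y h(1) Z v] step[OF Z h(2) h(1) w]
      W.ext_d_anti1[OF h(1) Y Z, of x] W.ext_d_anti1[OF h(1) h(2) Z, of x]
      W.ext_d_anti2[OF h(2) h(1) Z, of x] W.ext_d_anti1[OF h(2) Z h(1), of x]
      W.ext_d_anti2[OF h(2) h(1) h(3), of x] W.ext_d_anti1[OF h(3) h(2) h(1), of x]
      W.ext_d_anti1[OF h(1) h(2) h(3), of x]
    by linarith
qed

text \<open>In d d\<omega> = 0 on X, h u, h v, h w every term except X(d\<omega>(h u, h v, h w)) has
  a vertical argument: \<open>X\<close> itself, or one of the vertical brackets [X, h u], [X, h v],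
  [X, h w].\<close>

lemma ext_d_basic:
  assumes u: "u \<in> vfields B" and v: "v \<in> vfields B" and w: "w \<in> vfields B"
  shows "basic (ext_d \<omega> [hlift B p Hor u, hlift B p Hor v, hlift B p Hor w])"
  unfolding basic_def
proof (intro conjI ballI allI)
  note h = hlift_vfields[OF u] hlift_vfields[OF v] hlift_vfields[OF w]
  show "smooth_fun A (ext_d \<omega> [hlift B p Hor u, hlift B p Hor v, hlift B p Hor w])"
    by (rule W.ext_d_smooth[OF h])
  fix X x assume X: "X \<in> sections A Vert"
  note XV = vertical_vfields[OF X]
  have 0: "ext_d \<omega> [X, Y, Z] = (\<lambda>x. 0)" if "Y \<in> vfields A" "Z \<in> vfields A" for Y Z
    using ext_d_vertical[OF X that] by (rule ext)
  have 1: "ext_d \<omega> [Y, X, Z] x = 0" if "Y \<in> vfields A" "Z \<in> vfields A" for Y Z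
    using W.ext_d_anti1[OF XV that] ext_d_vertical[OF X that] by simp
  note z = M.tangent_const[OF M.vfields_tangent[OF h(1)]] M.tangent_const[OF M.vfields_tangent[OF h(2)]]
    M.tangent_const[OF M.vfields_tangent[OF h(3)]]
  note b = lie_bracket_vertical_hlift[OF X u] lie_bracket_vertical_hlift[OF X v] lie_bracket_vertical_hlift[OF X w]
  note e = ext_d_vertical[OF b(1) h(2,3)] ext_d_vertical[OF b(2) h(1,3)] ext_d_vertical[OF b(3) h(1,2)]
  note f = 1[OF M.lie_bracket_vfields[OF h(1,2)] h(3)] 1[OF M.lie_bracket_vfields[OF h(1,3)] h(2)]
    1[OF M.lie_bracket_vfields[OF h(2,3)] h(1)]
  show "X x (ext_d \<omega> [hlift B p Hor u, hlift B p Hor v, hlift B p Hor w]) = 0"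
    using W.ext_d_ext_d[OF XV h, of x] unfolding 0[OF h(2,3)] 0[OF h(1,3)] 0[OF h(1,2)] z e f by simp
qed

lemma ext_d_pullback_exists:
  assumes conn: "\<And>b. connected (p -` {b})"
  shows "\<exists>\<phi>. closed_form B (tangent B) 3 \<phi> \<and>
    (\<forall>X\<in>vfields A. \<forall>Y\<in>vfields A. \<forall>Z\<in>vfields A. \<forall>x.
       ext_d \<omega> [X, Y, Z] x = apply_form (pullback B p \<phi>) [X, Y, Z] x)"
proof -
  define ext where "ext b w = (SOME u. u \<in> vfields B \<and> u b = w)" for b w
  have ext: "ext b w \<in> vfields B" "ext b w b = w" if "w \<in> tangent B b" for b w
    using someI_ex[of "\<lambda>u. u \<in> vfields B \<and> u b = w"] B.tangent_extension[OF that] unfolding ext_def by blast+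
  let ?h = "hlift B p Hor"
  \<comment> \<open>Two choices enter: base fields through the given vectors, and a point of the
    fibre. The first is harmless by \<open>ext_d_hlift\<close>, the second because the values on
    lifts are basic and the fibres are connected.\<close>
  define \<phi> where "\<phi> b vs = ext_d \<omega> [?h (ext b (vs ! 0)), ?h (ext b (vs ! 1)), ?h (ext b (vs ! 2))] (inv p b)"
    for b vs
  have \<phi>: "\<phi> (p x) [u (p x), v (p x), w (p x)] = ext_d \<omega> [?h u, ?h v, ?h w] x"
    if u: "u \<in> vfields B" and v: "v \<in> vfields B" and w: "w \<in> vfields B" for u v w x
  proof -
    let ?x = "inv p (p x)"
    have px: "p ?x = p x" using surj by (simp add: surj_f_inv_f)
    note e = ext[OF B.vfields_tangent[OF u]] ext[OF B.vfields_tangent[OF v]] ext[OF B.vfields_tangent[OF w]]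
    note h = hlift_vfields[OF u] hlift_vfields[OF v] hlift_vfields[OF w]
    have "ext_d \<omega> [?h u, ?h v, ?h w] x = ext_d \<omega> [?h u, ?h v, ?h w] ?x"
      by (rule basic_constant_on_fibre[OF ext_d_basic[OF u v w] conn refl px])
    also have "\<dots> = ext_d \<omega> [?h (ext (p x) (u (p x))), ?h (ext (p x) (v (p x))), ?h (ext (p x) (w (p x)))] ?x"
      by (rule ext_d_hlift[OF h]) (simp_all add: e dp_hlift u v w px)
    finally show ?thesis by (simp add: \<phi>_def)
  qed
  have \<phi>': "\<phi> b [u b, v b, w b] = ext_d \<omega> [?h u, ?h v, ?h w] (inv p b)"
    if "u \<in> vfields B" "v \<in> vfields B" "w \<in> vfields B" for u v w b
    using \<phi>[OF that, of "inv p b"] surj by (simp add: surj_f_inv_f)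
  have form: "form B (tangent B) 3 \<phi>"
  proof (rule B.form3I[OF B.linear_distribution_tangent])
    fix b u v w t r s
    assume "u \<in> tangent B b" "v \<in> tangent B b" "w \<in> tangent B b" "t \<in> tangent B b"
    then obtain U V W T where *: "U \<in> vfields B" "U b = u" "V \<in> vfields B" "V b = v"
      "W \<in> vfields B" "W b = w" "T \<in> vfields B" "T b = t"
      using B.tangent_extension by metis
    have UV: "vlin (\<lambda>_. r) U (\<lambda>_. s) V \<in> vfields B"
      by (intro B.sections_vlin B.linear_distribution_tangent * B.smooth_fun_const)
    have "\<phi> b [vlin (\<lambda>_. r) U (\<lambda>_. s) V b, W b, T b] =
        r * \<phi> b [U b, W b, T b] + s * \<phi> b [V b, W b, T b]"
      unfolding \<phi>'[OF UV *(5,7)] \<phi>'[OF *(1,5,7)] \<phi>'[OF *(3,5,7)] hlift_vlin[OF *(1,3)]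
      by (intro W.ext_d_vlin hlift_vfields * M.smooth_fun_const)
    then show "\<phi> b [tlin r u s v, w, t] = r * \<phi> b [u, w, t] + s * \<phi> b [v, w, t]" by (simp add: *)
  next
    fix b u v w
    assume "u \<in> tangent B b" "v \<in> tangent B b" "w \<in> tangent B b"
    then obtain U V W where *: "U \<in> vfields B" "U b = u" "V \<in> vfields B" "V b = v" "W \<in> vfields B" "W b = w"
      using B.tangent_extension by metis
    note h = hlift_vfields[OF *(1)] hlift_vfields[OF *(3)] hlift_vfields[OF *(5)]
    show "\<phi> b [u, v, w] = - \<phi> b [v, u, w]"
      using \<phi>'[OF *(1,3,5), of b] \<phi>'[OF *(3,1,5), of b] W.ext_d_anti1[OF h(2,1,3)] by (simp add: *)
    show "\<phi> b [u, v, w] = - \<phi> b [u, w, v]"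
      using \<phi>'[OF *(1,3,5), of b] \<phi>'[OF *(1,5,3), of b] W.ext_d_anti2[OF h(1,3,2)] by (simp add: *)
  next
    fix u v w assume uvw: "u \<in> vfields B" "v \<in> vfields B" "w \<in> vfields B"
    show "smooth_fun B (\<lambda>b. \<phi> b [u b, v b, w b])"
      by (rule basic_factor_smooth[OF ext_d_basic[OF uvw] conn]) (simp add: \<phi>[OF uvw])
  qed
  have closed: "ext_d \<phi> [u, v, w, t] b = 0"
    if u: "u \<in> vfields B" and v: "v \<in> vfields B" and w: "w \<in> vfields B" and t: "t \<in> vfields B" for u v w t b
  proof -
    define x where "x = inv p b"
    have b: "b = p x" using surj by (simp add: x_def surj_f_inv_f)
    note h = hlift_vfields[OF u] hlift_vfields[OF v] hlift_vfields[OF w] hlift_vfields[OF t]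
    have d: "u (p x) (\<lambda>b. \<phi> b [v b, w b, t b]) = ?h u x (ext_d \<omega> [?h v, ?h w, ?h t])"
      if u: "u \<in> vfields B" and vwt: "v \<in> vfields B" "w \<in> vfields B" "t \<in> vfields B" for u v w t
    proof -
      have s: "smooth_fun B (\<lambda>b. \<phi> b [v b, w b, t b])"
        by (rule basic_factor_smooth[OF ext_d_basic[OF vwt] conn]) (simp add: \<phi>[OF vwt])
      have "(\<lambda>x. \<phi> (p x) [v (p x), w (p x), t (p x)]) = ext_d \<omega> [?h v, ?h w, ?h t]"
        by (rule HOL.ext) (rule \<phi>[OF vwt])
      then show ?thesis using hlift_pullback[OF u s, of x] by simp
    qed
    \<comment> \<open>The bracket of two lifts is in general not the lift of the bracket, but both
      have the same projection, which is all that \<open>ext_d_hlift\<close> asks for.\<close>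
    have br: "\<phi> (p x) [lie_bracket u v (p x), w (p x), t (p x)] = ext_d \<omega> [lie_bracket (?h u) (?h v), ?h w, ?h t] x"
      if uv: "u \<in> vfields B" "v \<in> vfields B" and w: "w \<in> vfields B" and t: "t \<in> vfields B" for u v w t
    proof -
      note b = B.lie_bracket_vfields[OF uv]
      have "ext_d \<omega> [lie_bracket (?h u) (?h v), ?h w, ?h t] x = ext_d \<omega> [?h (lie_bracket u v), ?h w, ?h t] x"
        by (rule ext_d_hlift)
          (simp_all add: M.lie_bracket_vfields hlift_vfields uv w t b dp_lie_bracket_hlift dp_hlift)
      then show ?thesis using \<phi>[OF b w t, of x] by simp
    qed
    show ?thesis
      unfolding b ext_d_4 d[OF u v w t] d[OF v u w t] d[OF w u v t] d[OF t u v w]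
        br[OF u v w t] br[OF u w v t] br[OF u t v w] br[OF v w u t] br[OF v t u w] br[OF w t u v]
      by (rule W.ext_d_ext_d[OF h])
  qed
  have "closed_form B (tangent B) 3 \<phi>"
    unfolding closed_form_def
  proof (intro conjI allI impI form)
    fix Xs :: "'b vfield list" and x assume *: "length Xs = Suc 3" "set Xs \<subseteq> vfields B"
    obtain u v w t where "Xs = [u, v, w, t]" using *(1) by (auto simp: length_Suc_conv numeral_3_eq_3)
    then show "ext_d \<phi> Xs x = 0" using * closed by simp
  qed
  moreover have "ext_d \<omega> [X, Y, Z] x = apply_form (pullback B p \<phi>) [X, Y, Z] x"
    if X: "X \<in> vfields A" and Y: "Y \<in> vfields A" and Z: "Z \<in> vfields A" for X Y Z x
  proof -
    obtain u where u: "u \<in> vfields B" "u (p x) = dp (X x)" using lift_extension[OF X] by blast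
    obtain v where v: "v \<in> vfields B" "v (p x) = dp (Y x)" using lift_extension[OF Y] by blast
    obtain w where w: "w \<in> vfields B" "w (p x) = dp (Z x)" using lift_extension[OF Z] by blast
    have "ext_d \<omega> [X, Y, Z] x = \<phi> (p x) [u (p x), v (p x), w (p x)]"
      using ext_d_hlift[OF X Y Z u v w] \<phi>[OF u(1) v(1) w(1)] by simp
    then show ?thesis by (simp add: apply_form_def pullback_def u v w)
  qed
  ultimately show ?thesis by (intro exI[of _ \<phi>]) simp
qed

end


section \<open>Function-valued two-forms on the base as two-forms on M\<close>

context fibred_connection
begin

text \<open>\<open>function_valued_two_form\<close> acts on vector fields, a form on tangent
  vectors. Bilinearity over the functions on B makes the value independent of the chosen fields;
  this is \<open>horizontal_value_eq\<close>.\<close>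

definition horizontal_value :: "('b vfield \<Rightarrow> 'b vfield \<Rightarrow> 'm \<Rightarrow> real) \<Rightarrow> 'm \<Rightarrow> 'b tvec \<Rightarrow> 'b tvec \<Rightarrow> real" where
  "horizontal_value \<tau> x v w = \<tau> (SOME u. u \<in> vfields B \<and> u (p x) = v) (SOME u. u \<in> vfields B \<and> u (p x) = w) x"

context
  fixes \<tau> assumes \<tau>: "function_valued_two_form A B p \<tau>"
begin

lemma two_form_smooth: "u \<in> vfields B \<Longrightarrow> v \<in> vfields B \<Longrightarrow> smooth_fun A (\<tau> u v)"
  using \<tau> unfolding function_valued_two_form_def by blast

lemma two_form_vlin1:
  "u \<in> vfields B \<Longrightarrow> v \<in> vfields B \<Longrightarrow> w \<in> vfields B \<Longrightarrow> smooth_fun B f \<Longrightarrow> smooth_fun B g \<Longrightarrow>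
     \<tau> (vlin f u g v) w x = f (p x) * \<tau> u w x + g (p x) * \<tau> v w x"
  and two_form_vlin2:
  "u \<in> vfields B \<Longrightarrow> v \<in> vfields B \<Longrightarrow> w \<in> vfields B \<Longrightarrow> smooth_fun B f \<Longrightarrow> smooth_fun B g \<Longrightarrow>
     \<tau> w (vlin f u g v) x = f (p x) * \<tau> w u x + g (p x) * \<tau> w v x"
  using \<tau> unfolding function_valued_two_form_def by blast+

lemma two_form_anti:
  assumes u: "u \<in> vfields B" and v: "v \<in> vfields B"
  shows "\<tau> u v x = - \<tau> v u x"
proof -
  let ?s = "vlin (\<lambda>_. 1) u (\<lambda>_. 1) v"
  have s: "?s \<in> vfields B" by (intro B.sections_vlin B.linear_distribution_tangent B.smooth_fun_const u v)
  have z: "\<tau> u u x = 0" if "u \<in> vfields B" for u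
    using \<tau> that unfolding function_valued_two_form_def by blast
  show ?thesis
    using two_form_vlin1[OF u v s B.smooth_fun_const B.smooth_fun_const, of 1 1 x]
      two_form_vlin2[OF u v u B.smooth_fun_const B.smooth_fun_const, of 1 1 x]
      two_form_vlin2[OF u v v B.smooth_fun_const B.smooth_fun_const, of 1 1 x] z[OF s] z[OF u] z[OF v] by simp
qed

lemma horizontal_value_eq:
  assumes u: "u \<in> vfields B" and v: "v \<in> vfields B"
  shows "horizontal_value \<tau> x (u (p x)) (v (p x)) = \<tau> u v x"
proof -
  define e where "e w = (SOME u. u \<in> vfields B \<and> u (p x) = w)" for w
  have e: "e (u (p x)) \<in> vfields B" "e (u (p x)) (p x) = u (p x)" if "u \<in> vfields B" for u
    using someI[of "\<lambda>u'. u' \<in> vfields B \<and> u' (p x) = u (p x)" u] that unfolding e_def by blast+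
  have "\<tau> (e (u (p x))) (e (v (p x))) x = \<tau> u (e (v (p x))) x"
    by (rule B.tensorial_pointwise[where L = "\<lambda>u. \<tau> u (e (v (p x))) x" and x = "p x"])
      (simp_all add: two_form_vlin1 e u v)
  also have "\<dots> = \<tau> u v x"
    by (rule B.tensorial_pointwise[where L = "\<lambda>v. \<tau> u v x" and x = "p x"])
      (simp_all add: two_form_vlin2 e u v)
  finally show ?thesis by (simp add: horizontal_value_def e_def)
qed

lemma horizontal_value_tlin:
  assumes "u \<in> tangent B (p x)" "v \<in> tangent B (p x)" "w \<in> tangent B (p x)"
  shows "horizontal_value \<tau> x (tlin a u b v) w = a * horizontal_value \<tau> x u w + b * horizontal_value \<tau> x v w"
proof -
  obtain U where U: "U \<in> vfields B" "U (p x) = u" using B.tangent_extension[OF assms(1)] by blast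
  obtain V where V: "V \<in> vfields B" "V (p x) = v" using B.tangent_extension[OF assms(2)] by blast
  obtain W where W: "W \<in> vfields B" "W (p x) = w" using B.tangent_extension[OF assms(3)] by blast
  have UV: "vlin (\<lambda>_. a) U (\<lambda>_. b) V \<in> vfields B"
    by (intro B.sections_vlin B.linear_distribution_tangent B.smooth_fun_const U V)
  show ?thesis
    using horizontal_value_eq[OF UV W(1), of x] horizontal_value_eq[OF U(1) W(1), of x]
      horizontal_value_eq[OF V(1) W(1), of x]
      two_form_vlin1[OF U(1) V(1) W(1) B.smooth_fun_const B.smooth_fun_const, of a b x]
    by (simp add: U V W)
qed

lemma horizontal_value_anti:
  assumes "u \<in> tangent B (p x)" "v \<in> tangent B (p x)"
  shows "horizontal_value \<tau> x u v = - horizontal_value \<tau> x v u"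
proof -
  obtain U where U: "U \<in> vfields B" "U (p x) = u" using B.tangent_extension[OF assms(1)] by blast
  obtain V where V: "V \<in> vfields B" "V (p x) = v" using B.tangent_extension[OF assms(2)] by blast
  show ?thesis
    using horizontal_value_eq[OF U(1) V(1), of x] horizontal_value_eq[OF V(1) U(1), of x] two_form_anti[OF U(1) V(1), of x]
    by (simp add: U V)
qed

lemma horizontal_value_tzero: "w \<in> tangent B (p x) \<Longrightarrow> horizontal_value \<tau> x tzero w = 0"
  using horizontal_value_tlin[OF B.tangent_tzero B.tangent_tzero, of w x 0 0] by (simp add: tlin_tzero)

text \<open>Smoothness is the point, as the projection of a field on M is in general not a field on
  B. In a local frame of the base the function becomes the double sum of X(y_i o p) Y(y_j o p)
  \<tau>(D_i, D_j), whose coefficients are smooth on M.\<close>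

lemma horizontal_form:
  "form A (tangent A) 2 (\<lambda>x vs. horizontal_value \<tau> x (dp (vs ! 0)) (dp (vs ! 1)))"
  unfolding M.form2_iff[OF M.linear_distribution_tangent]
proof (intro conjI allI ballI)
  fix x u v w a b assume uvw: "u \<in> tangent A x" "v \<in> tangent A x" "w \<in> tangent A x"
  from horizontal_value_tlin[OF uvw[THEN dp_tangent], of a b]
  show "horizontal_value \<tau> x (dp ([tlin a u b v, w] ! 0)) (dp ([tlin a u b v, w] ! 1)) =
    a * horizontal_value \<tau> x (dp ([u, w] ! 0)) (dp ([u, w] ! 1)) +
    b * horizontal_value \<tau> x (dp ([v, w] ! 0)) (dp ([v, w] ! 1))"
    by (simp add: dp_tlin)
next
  fix x u v assume uv: "u \<in> tangent A x" "v \<in> tangent A x"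
  from horizontal_value_anti[OF uv[THEN dp_tangent]]
  show "horizontal_value \<tau> x (dp ([u, v] ! 0)) (dp ([u, v] ! 1)) =
    - horizontal_value \<tau> x (dp ([v, u] ! 0)) (dp ([v, u] ! 1))"
    by simp
next
  fix X Y assume X: "X \<in> vfields A" and Y: "Y \<in> vfields A"
  have "smooth_fun A (\<lambda>x. horizontal_value \<tau> x (dp (X x)) (dp (Y x)))"
  proof (rule M.smooth_fun_local)
    fix x0
    obtain I :: "'d set" and y D W where *: "finite I" "open W" "p x0 \<in> W" "\<forall>i\<in>I. smooth_fun B (y i)" "\<forall>i\<in>I. D i \<in> vfields B"
      "\<forall>c\<in>W. \<forall>v\<in>tangent B c. \<forall>f. v f = (\<Sum>i\<in>I. v (y i) * D i c f)"
      using B.local_frame[of "p x0"] by (elim exE conjE)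
    let ?c = "\<lambda>X i x. X x (\<lambda>x. y i (p x))"
    let ?g = "\<lambda>x. \<Sum>i\<in>I. ?c X i x * (\<Sum>j\<in>I. ?c Y j x * \<tau> (D i) (D j) x)"
    have c: "smooth_fun A (\<lambda>x. ?c X i x)" if "X \<in> vfields A" "i \<in> I" for X i
      using *(4) that(2) by (intro M.sections_smooth[OF that(1)] smooth_fun_pullback) simp
    have "smooth_fun A ?g"
      using *(5) by (intro M.smooth_fun_sum M.smooth_fun_mult c X Y two_form_smooth) auto
    moreover have "horizontal_value \<tau> x (dp (X x)) (dp (Y x)) = ?g x" if x: "x \<in> p -` W" for x
    proof -
      \<comment> \<open>\<tau> is linear over functions on B only, while the coefficients are
        functions on M. So they are frozen at the point \<open>x\<close>, which leaves the value
        there unchanged.\<close>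
      define E where "E X = vsum I (\<lambda>i _. ?c X i x) D" for X
      have E: "E X \<in> vfields B" for X unfolding E_def
        using *(1,5) by (intro B.sections_vsum B.linear_distribution_tangent B.smooth_fun_const) auto
      have Ep: "E X (p x) = dp (X x)" if X: "X \<in> vfields A" for X
      proof
        fix f
        have "dp (X x) f = (\<Sum>i\<in>I. dp (X x) (y i) * D i (p x) f)"
          using *(6) x dp_tangent[OF M.vfields_tangent[OF X]] by blast
        then show "E X (p x) f = dp (X x) f" using *(4) by (simp add: E_def dp_apply)
      qed
      have "horizontal_value \<tau> x (dp (X x)) (dp (Y x)) = \<tau> (E X) (E Y) x"
        using horizontal_value_eq[OF E[of X] E[of Y], of x] by (simp add: Ep X Y)
      also have "\<dots> = (\<Sum>i\<in>I. ?c X i x * \<tau> (D i) (E Y) x)"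
        unfolding E_def[of X]
        by (rule B.tensorial_vsum[OF *(1), where L = "\<lambda>u. \<tau> u (E Y) x" and x = "p x"])
          (use *(5) in \<open>simp_all add: two_form_vlin1 E B.smooth_fun_const\<close>)
      also have "\<dots> = ?g x"
      proof (intro sum.cong refl arg_cong2[where f = "(*)"])
        fix i assume "i \<in> I"
        then show "\<tau> (D i) (E Y) x = (\<Sum>j\<in>I. ?c Y j x * \<tau> (D i) (D j) x)"
          unfolding E_def[of Y]
          by (intro B.tensorial_vsum[OF *(1), where L = "\<lambda>u. \<tau> (D i) u x" and x = "p x"])
            (use *(5) in \<open>simp_all add: two_form_vlin2 B.smooth_fun_const\<close>)
      qed
      finally show ?thesis .
    qed
    moreover have "open (p -` W)" using *(2) p_continuous by (intro open_vimage)
    ultimately show "\<exists>W g. open W \<and> x0 \<in> W \<and> smooth_fun A g \<and>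
        (\<forall>x\<in>W. horizontal_value \<tau> x (dp (X x)) (dp (Y x)) = g x)"
      using *(3) by (intro exI[of _ "p -` W"] exI[of _ ?g]) simp
  qed
  then show "smooth_fun A (\<lambda>x. horizontal_value \<tau> x (dp ([X x, Y x] ! 0)) (dp ([X x, Y x] ! 1)))" by simp
qed

end

end

lemma (in smooth_manifold) form2_diff:
  assumes \<omega>: "form A (tangent A) 2 \<omega>" and \<eta>: "form A (tangent A) 2 \<eta>"
  shows "form A (tangent A) 2 (\<lambda>x vs. \<omega> x vs - \<eta> x vs)"
proof -
  interpret W: two_form A \<omega> by unfold_locales (rule \<omega>)
  interpret H: two_form A \<eta> by unfold_locales (rule \<eta>)
  show ?thesis
    unfolding form2_iff[OF linear_distribution_tangent]
  proof (intro conjI allI ballI)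
    fix x u v assume "u \<in> tangent A x" "v \<in> tangent A x"
    then show "\<omega> x [u, v] - \<eta> x [u, v] = - (\<omega> x [v, u] - \<eta> x [v, u])"
      using W.anti[of u x v] H.anti[of u x v] by simp
  qed (simp_all add: W.lin1 H.lin1 algebra_simps smooth_fun_diff W.smooth H.smooth)
qed

lemma (in smooth_manifold) ext_d_diff:
  assumes \<omega>: "form A (tangent A) 2 \<omega>" and \<eta>: "form A (tangent A) 2 \<eta>"
    and X: "X \<in> vfields A" and Y: "Y \<in> vfields A" and Z: "Z \<in> vfields A"
  shows "ext_d (\<lambda>x vs. \<omega> x vs - \<eta> x vs) [X, Y, Z] x = ext_d \<omega> [X, Y, Z] x - ext_d \<eta> [X, Y, Z] x"
proof -
  interpret W: two_form A \<omega> by unfold_locales (rule \<omega>)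
  interpret H: two_form A \<eta> by unfold_locales (rule \<eta>)
  note T = vfields_tangent[OF X] vfields_tangent[OF Y] vfields_tangent[OF Z]
  show ?thesis
    unfolding ext_d_3
    by (simp add: T[THEN tangent_diff] W.smooth H.smooth X Y Z)
qed

section \<open>Extension of the vertical form, and pullback of forms from the base\<close>

context fibred_connection
begin

lemma vpart_form:
  assumes \<omega>: "form A Vert 2 \<omega>"
  shows "form A (tangent A) 2 (\<lambda>x vs. \<omega> x (map (vpart x) vs))"
proof -
  have lin: "\<omega> x [tlin a u b v, w] = a * \<omega> x [u, w] + b * \<omega> x [v, w]"
    and anti: "\<omega> x [u, v] = - \<omega> x [v, u]"
    if "u \<in> Vert x" "v \<in> Vert x" "w \<in> Vert x" for x u v w a b
    using \<omega> that unfolding M.form2_iff[OF linear_vertical] by blast+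
  have sm: "smooth_fun A (\<lambda>x. \<omega> x [X x, Y x])" if "X \<in> sections A Vert" "Y \<in> sections A Vert" for X Y
    using \<omega> that unfolding M.form2_iff[OF linear_vertical] by blast
  show ?thesis
    unfolding M.form2_iff[OF M.linear_distribution_tangent]
  proof (intro conjI allI ballI)
    fix x u v assume uv: "u \<in> tangent A x" "v \<in> tangent A x"
    show "\<omega> x (map (vpart x) [u, v]) = - \<omega> x (map (vpart x) [v, u])"
      using anti[OF vpart_vertical[OF uv(1)] vpart_vertical[OF uv(2)] vpart_vertical[OF uv(1)]] by simp
    fix w a b assume w: "w \<in> tangent A x"
    show "\<omega> x (map (vpart x) [tlin a u b v, w]) = a * \<omega> x (map (vpart x) [u, w]) + b * \<omega> x (map (vpart x) [v, w])"
      using lin[OF vpart_vertical[OF uv(1)] vpart_vertical[OF uv(2)] vpart_vertical[OF w]] vpart_tlin[OF uv] by simp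
  next
    fix X Y assume "X \<in> vfields A" "Y \<in> vfields A"
    then show "smooth_fun A (\<lambda>x. \<omega> x (map (vpart x) [X x, Y x]))"
      using sm[OF vpart_sections vpart_sections] by simp
  qed
qed

lemma
  assumes \<tau>: "function_valued_two_form A B p \<tau>" and v: "v \<in> Vert x" and w: "w \<in> tangent A x"
  shows horizontal_value_vertical1: "horizontal_value \<tau> x (dp v) (dp w) = 0"
    and horizontal_value_vertical2: "horizontal_value \<tau> x (dp w) (dp v) = 0"
  using horizontal_value_tzero[OF \<tau> dp_tangent[OF w]] horizontal_value_anti[OF \<tau> dp_tangent[OF w] B.tangent_tzero]
  by (simp_all add: vertical_dp[OF v])

lemma horizontal_value_hlift:
  "function_valued_two_form A B p \<tau> \<Longrightarrow> u \<in> vfields B \<Longrightarrow> v \<in> vfields B \<Longrightarrow>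
    horizontal_value \<tau> x (dp (hlift B p Hor u x)) (dp (hlift B p Hor v x)) = \<tau> u v x"
  by (simp add: dp_hlift horizontal_value_eq)

lemma symplectic_extension:
  assumes closed: "closed_form A Vert 2 \<omega>\<^sub>V" and sympl: "symplectic_connection A B p \<omega>\<^sub>V Hor"
    and ham: "hamiltonian_curvature A B p \<omega>\<^sub>V Hor"
    and conn: "\<And>b. connected (p -` {b})"
  shows "\<exists>\<omega> \<phi>. closed_up_to_base A B p \<omega>\<^sub>V \<omega> \<phi>"
proof -
  obtain \<tau> where \<tau>: "function_valued_two_form A B p \<tau>"
    and curv: "\<forall>u\<in>vfields B. \<forall>v\<in>vfields B. \<forall>Y\<in>sections A Vert. \<forall>x.
       apply_form \<omega>\<^sub>V [curvature B p Hor u v, Y] x = - ext_d (fun_form (\<tau> u v)) [Y] x"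
    using ham unfolding hamiltonian_curvature_def by (elim exE conjE)
  have fV: "form A Vert 2 \<omega>\<^sub>V" using closed by (simp add: closed_form_def)
  define \<omega> where "\<omega> = (\<lambda>x vs. \<omega>\<^sub>V x (map (vpart x) vs) - horizontal_value \<tau> x (dp (vs ! 0)) (dp (vs ! 1)))"
  have f\<omega>: "form A (tangent A) 2 \<omega>"
    unfolding \<omega>_def by (intro M.form2_diff vpart_form fV horizontal_form \<tau>)
  interpret W: two_form A \<omega> by unfold_locales (rule f\<omega>)
  interpret WV: two_form A "\<lambda>x vs. \<omega>\<^sub>V x (map (vpart x) vs)" by unfold_locales (rule vpart_form[OF fV])
  have anti: "\<omega>\<^sub>V x [v, w] = - \<omega>\<^sub>V x [w, v]" if "v \<in> Vert x" "w \<in> Vert x" for x v w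
    using WV.anti[OF vertical_tangent[OF that(1)] vertical_tangent[OF that(2)]] that by (simp add: vpart_of_vertical)
  have linV: "\<omega>\<^sub>V x [tlin a u b v, w] = a * \<omega>\<^sub>V x [u, w] + b * \<omega>\<^sub>V x [v, w]"
    if "u \<in> Vert x" "v \<in> Vert x" "w \<in> Vert x" for x u v w a b
    using fV that unfolding M.form2_iff[OF linear_vertical] by blast
  have VT: "\<omega> x [v, w] = \<omega>\<^sub>V x [v, vpart x w]" "\<omega> x [w, v] = \<omega>\<^sub>V x [vpart x w, v]"
    if "v \<in> Vert x" "w \<in> tangent A x" for x v w
    using that by (simp_all add: \<omega>_def vpart_of_vertical horizontal_value_vertical1[OF \<tau> that]
        horizontal_value_vertical2[OF \<tau> that])
  have VV: "\<omega> x [v, w] = \<omega>\<^sub>V x [v, w]" if "v \<in> Vert x" "w \<in> Vert x" for x v w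
    using VT(1)[OF that(1) vertical_tangent[OF that(2)]] by (simp add: vpart_of_vertical that)
  have tz: "\<omega>\<^sub>V x [v, tzero] = 0" "\<omega>\<^sub>V x [tzero, v] = 0" if "v \<in> Vert x" for x v
  proof -
    have z: "tzero \<in> Vert x" using linear_vertical unfolding M.linear_distribution_def by blast
    have "\<omega>\<^sub>V x [tlin 0 tzero 0 tzero, v] = 0"
      using WV.lin1[OF M.tangent_tzero M.tangent_tzero vertical_tangent[OF that], of 0 0]
      by (simp add: vpart_of_vertical that z tlin_tzero)
    then show "\<omega>\<^sub>V x [tzero, v] = 0" by (simp add: tlin_tzero)
    then show "\<omega>\<^sub>V x [v, tzero] = 0" using anti[OF that z] by simp
  qed
  let ?h = "hlift B p Hor"
  have VH: "\<omega> x [v, ?h u x] = 0" "\<omega> x [?h u x, v] = 0" if "v \<in> Vert x" "u \<in> vfields B" for x v u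
    using VT[OF that(1) M.vfields_tangent[OF hlift_vfields[OF that(2)]]] tz[OF that(1)] by (simp_all add: vpart_hlift that)
  have HH: "\<omega> x [?h u x, ?h v x] = - \<tau> u v x" if "u \<in> vfields B" "v \<in> vfields B" for u v x
  proof -
    have z: "tzero \<in> Vert x" using linear_vertical unfolding M.linear_distribution_def by blast
    show ?thesis using tz(1)[OF z] that by (simp add: \<omega>_def vpart_hlift horizontal_value_hlift[OF \<tau>])
  qed
  interpret C: connection_two_form A B p Hor \<omega>
  proof unfold_locales
    fix X Y Z x assume X: "X \<in> sections A Vert" and Y: "Y \<in> sections A Vert" and Z: "Z \<in> sections A Vert"
    have "ext_d \<omega>\<^sub>V [X, Y, Z] x = 0" using closed X Y Z by (simp add: closed_form_def)
    then show "ext_d \<omega> [X, Y, Z] x = 0"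
      unfolding ext_d_3
      by (simp add: VV X[THEN M.sections_mem] Y[THEN M.sections_mem] Z[THEN M.sections_mem]
          lie_bracket_vertical[OF X Y, THEN M.sections_mem] lie_bracket_vertical[OF X Z, THEN M.sections_mem]
          lie_bracket_vertical[OF Y Z, THEN M.sections_mem])
  next
    fix X Y u x assume X: "X \<in> sections A Vert" and Y: "Y \<in> sections A Vert" and u: "u \<in> vfields B"
    note XV = M.sections_mem[OF X] and YV = M.sections_mem[OF Y]
    note bX = lie_bracket_vertical_hlift[OF X u, THEN M.sections_mem]
    note bY = lie_bracket_vertical_hlift[OF Y u, THEN M.sections_mem]
    note bXY = lie_bracket_vertical[OF X Y, THEN M.sections_mem]
    note Xz = M.tangent_const[OF M.vfields_tangent[OF vertical_vfields[OF X]]]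
    note Yz = M.tangent_const[OF M.vfields_tangent[OF vertical_vfields[OF Y]]]
    have L: "lie_deriv (?h u) \<omega>\<^sub>V [X, Y] x = 0"
      by (rule bspec[OF bspec[OF bspec[OF conjunct2[OF sympl[unfolded symplectic_connection_def]] u] X] Y, THEN spec])
    have flip: "\<omega>\<^sub>V x [lie_bracket (?h u) U x, w] = - \<omega>\<^sub>V x [lie_bracket U (?h u) x, w]"
      if U: "U \<in> sections A Vert" and w: "w \<in> Vert x" for U w
    proof -
      note b = lie_bracket_vertical_hlift[OF U u, THEN M.sections_mem, of x]
      have "\<omega>\<^sub>V x [tlin (- 1) (lie_bracket U (?h u) x) 0 (lie_bracket U (?h u) x), w] = - \<omega>\<^sub>V x [lie_bracket U (?h u) x, w]"
        using linV[OF b b w, of "- 1" 0] by simp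
      then show ?thesis unfolding M.lie_bracket_antisym[of "?h u" U x] .
    qed
    have "lie_bracket (?h u) Y \<in> sections A Vert"
    proof -
      note b = lie_bracket_vertical_hlift[OF Y u]
      have "lie_bracket (?h u) Y = vlin (\<lambda>_. - 1) (lie_bracket Y (?h u)) (\<lambda>_. 0) (lie_bracket Y (?h u))"
        by (rule ext) (rule M.lie_bracket_antisym)
      then show ?thesis using M.sections_vlin[OF linear_vertical b b M.smooth_fun_const M.smooth_fun_const] by simp
    qed
    then have b': "lie_bracket (?h u) Y x \<in> Vert x" by (rule M.sections_mem)
    have "?h u x (\<lambda>y. \<omega>\<^sub>V y [X y, Y y]) - \<omega>\<^sub>V x [lie_bracket (?h u) X x, Y x] - \<omega>\<^sub>V x [X x, lie_bracket (?h u) Y x] = 0"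
      using L by (simp add: lie_deriv_def apply_form_def lessThan_Suc numeral_2_eq_2)
    \<comment> \<open>Since \<omega> pairs vertical vectors with lifts to 0, what remains is
      h(u)(\<omega>(X, Y)) + \<omega>([X, h u], Y) - \<omega>([Y, h u], X): the Lie derivative above
      after reversing its brackets.\<close>
    then show "ext_d \<omega> [X, Y, ?h u] x = 0"
      unfolding ext_d_3 using flip[OF X YV] flip[OF Y XV] anti[OF XV b']
      by (simp add: VV VH XV YV bX bY bXY u Xz Yz)
  next
    fix X u v x assume X: "X \<in> sections A Vert" and u: "u \<in> vfields B" and v: "v \<in> vfields B"
    note XV = M.sections_mem[OF X]
    note hT = M.tangent_const[OF M.vfields_tangent[OF hlift_vfields[OF u]]]
      M.tangent_const[OF M.vfields_tangent[OF hlift_vfields[OF v]]]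
    note b = lie_bracket_vertical_hlift[OF X u, THEN M.sections_mem] lie_bracket_vertical_hlift[OF X v, THEN M.sections_mem]
    note huv = M.lie_bracket_vfields[OF hlift_vfields[OF u] hlift_vfields[OF v], THEN M.vfields_tangent]
    \<comment> \<open>The lift of [u, v] is the horizontal part of [h u, h v], so the curvature is
      its vertical part. Only this part contributes to the pairing of the bracket with a vertical
      vector.\<close>
    have "vpart x (lie_bracket (?h u) (?h v) x) = curvature B p Hor u v x"
      unfolding vpart_def curvature_def dp_lie_bracket_hlift[OF u v] by (simp add: hlift_eq)
    then have "\<omega> x [lie_bracket (?h u) (?h v) x, X x] = \<omega>\<^sub>V x [curvature B p Hor u v x, X x]"
      using VT(2)[OF XV huv, of x] by simp
    also have "\<dots> = - X x (\<tau> u v)"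
      using curv u v X by (simp add: apply_form_def ext_d_1 fun_form_def)
    finally have c: "\<omega> x [lie_bracket (?h u) (?h v) x, X x] = - X x (\<tau> u v)" .
    have "X x (\<lambda>y. - \<tau> u v y) = - X x (\<tau> u v)"
      by (rule M.tangent_minus[OF M.vfields_tangent[OF vertical_vfields[OF X]] two_form_smooth[OF \<tau> u v]])
    then show "ext_d \<omega> [X, ?h u, ?h v] x = 0"
      unfolding ext_d_3 by (simp add: HH VH XV u v b hT c)
  qed
  obtain \<phi> where "closed_form B (tangent B) 3 \<phi>" "\<forall>X\<in>vfields A. \<forall>Y\<in>vfields A. \<forall>Z\<in>vfields A. \<forall>x.
      ext_d \<omega> [X, Y, Z] x = apply_form (pullback B p \<phi>) [X, Y, Z] x"
    using C.ext_d_pullback_exists[OF conn] by (elim exE conjE)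
  then have "closed_up_to_base A B p \<omega>\<^sub>V \<omega> \<phi>"
    unfolding closed_up_to_base_def extends_vertical_def using f\<omega> VV by simp
  then show ?thesis by (intro exI)
qed

text \<open>The form is p^* \<beta>, obtained as a horizontal form so that its smoothness is already
  known. It vanishes on vertical vectors, and \<beta>(u, v) o p has no vertical derivative; so it is
  an instance of \<open>connection_two_form\<close>, and its differential may be computed on lifts,
  which are related by p to base fields. The base fields are tied to \<open>X\<close>,
  \<open>Y\<close>, \<open>Z\<close> at the point \<open>x\<close> only.\<close>

lemma pullback_two_form:
  assumes \<beta>: "form B (tangent B) 2 \<beta>"
  shows "\<exists>\<eta>. form A (tangent A) 2 \<eta> \<and> (\<forall>x. \<forall>v\<in>Vert x. \<forall>w\<in>Vert x. \<eta> x [v, w] = 0) \<and>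
    (\<forall>X Y Z u v w x. X \<in> vfields A \<longrightarrow> Y \<in> vfields A \<longrightarrow> Z \<in> vfields A \<longrightarrow>
       u \<in> vfields B \<longrightarrow> v \<in> vfields B \<longrightarrow> w \<in> vfields B \<longrightarrow>
       u (p x) = dp (X x) \<longrightarrow> v (p x) = dp (Y x) \<longrightarrow> w (p x) = dp (Z x) \<longrightarrow>
       ext_d \<eta> [X, Y, Z] x = ext_d \<beta> [u, v, w] (p x))"
proof -
  interpret \<beta>: two_form B \<beta> by unfold_locales (rule \<beta>)
  define \<tau> where "\<tau> u v x = \<beta> (p x) [u (p x), v (p x)]" for u v :: "'b vfield" and x
  have "\<tau> u u x = 0" if "u \<in> vfields B" for u x
    using \<beta>.anti[OF B.vfields_tangent B.vfields_tangent, OF that that, of "p x"] by (simp add: \<tau>_def)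
  then have \<tau>: "function_valued_two_form A B p \<tau>"
    unfolding function_valued_two_form_def
    by (auto simp: \<tau>_def[abs_def] \<beta>.lin1 \<beta>.lin2 B.vfields_tangent intro!: smooth_fun_pullback[OF \<beta>.smooth])
  define \<eta> where "\<eta> = (\<lambda>x vs. horizontal_value \<tau> x (dp (vs ! 0)) (dp (vs ! 1)))"
  have f\<eta>: "form A (tangent A) 2 \<eta>" unfolding \<eta>_def by (rule horizontal_form[OF \<tau>])
  interpret H: two_form A \<eta> by unfold_locales (rule f\<eta>)
  have Vz: "\<eta> x [v, w] = 0" "\<eta> x [w, v] = 0" if "v \<in> Vert x" "w \<in> tangent A x" for x v w
    unfolding \<eta>_def using horizontal_value_vertical1[OF \<tau> that] horizontal_value_vertical2[OF \<tau> that] by simp_all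
  let ?h = "hlift B p Hor"
  have val: "\<eta> x [s, t] = \<beta> (p x) [dp s, dp t]" if st: "s \<in> tangent A x" "t \<in> tangent A x" for x s t
  proof -
    obtain u where u: "u \<in> vfields B" "u (p x) = dp s" using B.tangent_extension[OF dp_tangent[OF st(1)]] by blast
    obtain v where v: "v \<in> vfields B" "v (p x) = dp t" using B.tangent_extension[OF dp_tangent[OF st(2)]] by blast
    show ?thesis using horizontal_value_eq[OF \<tau> u(1) v(1), of x] by (simp add: \<eta>_def \<tau>_def u v)
  qed
  interpret C: connection_two_form A B p Hor \<eta>
  proof unfold_locales
    fix X Y Z x assume X: "X \<in> sections A Vert" and Y: "Y \<in> sections A Vert" and Z: "Z \<in> sections A Vert"
    note V = vertical_vfields[OF X] vertical_vfields[OF Y] vertical_vfields[OF Z]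
    show "ext_d \<eta> [X, Y, Z] x = 0"
      unfolding ext_d_3
      by (simp add: Vz M.sections_mem[OF X] M.sections_mem[OF Y] M.sections_mem[OF Z] V[THEN M.vfields_tangent]
          V[THEN M.vfields_tangent, THEN M.tangent_const] M.lie_bracket_vfields V M.vfields_tangent)
  next
    fix X Y u x assume X: "X \<in> sections A Vert" and Y: "Y \<in> sections A Vert" and u: "u \<in> vfields B"
    note V = vertical_vfields[OF X] vertical_vfields[OF Y] hlift_vfields[OF u]
    show "ext_d \<eta> [X, Y, ?h u] x = 0"
      unfolding ext_d_3
      by (simp add: Vz M.sections_mem[OF X] M.sections_mem[OF Y] V[THEN M.vfields_tangent]
          V[THEN M.vfields_tangent, THEN M.tangent_const] M.lie_bracket_vfields V M.vfields_tangent
          lie_bracket_vertical[OF X Y, THEN M.sections_mem])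
  next
    fix X u v x assume X: "X \<in> sections A Vert" and u: "u \<in> vfields B" and v: "v \<in> vfields B"
    note V = vertical_vfields[OF X] hlift_vfields[OF u] hlift_vfields[OF v]
    have "X x (\<lambda>y. \<eta> y [?h u y, ?h v y]) = X x (\<lambda>y. \<beta> (p y) [u (p y), v (p y)])"
      by (simp add: val V[THEN M.vfields_tangent] dp_hlift u v)
    also have "\<dots> = 0" by (rule vertical_pullback[OF X \<beta>.smooth[OF u v]])
    finally show "ext_d \<eta> [X, ?h u, ?h v] x = 0"
      unfolding ext_d_3
      by (simp add: Vz M.sections_mem[OF X] V[THEN M.vfields_tangent]
          V[THEN M.vfields_tangent, THEN M.tangent_const] M.lie_bracket_vfields V M.vfields_tangent
          lie_bracket_vertical_hlift[OF X u, THEN M.sections_mem]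
          lie_bracket_vertical_hlift[OF X v, THEN M.sections_mem])
  qed
  have hd: "ext_d \<eta> [?h u, ?h v, ?h w] x = ext_d \<beta> [u, v, w] (p x)"
    if u: "u \<in> vfields B" and v: "v \<in> vfields B" and w: "w \<in> vfields B" for u v w x
  proof -
    note V = hlift_vfields[OF u] hlift_vfields[OF v] hlift_vfields[OF w]
    note br = M.lie_bracket_vfields[OF V(1,2)] M.lie_bracket_vfields[OF V(1,3)] M.lie_bracket_vfields[OF V(2,3)]
    show ?thesis
      unfolding ext_d_3
      by (simp add: val V[THEN M.vfields_tangent] br[THEN M.vfields_tangent] dp_hlift dp_lie_bracket_hlift
          u v w hlift_pullback[OF _ \<beta>.smooth])
  qed
  have "ext_d \<eta> [X, Y, Z] x = ext_d \<beta> [u, v, w] (p x)"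
    if "X \<in> vfields A" "Y \<in> vfields A" "Z \<in> vfields A" "u \<in> vfields B" "v \<in> vfields B" "w \<in> vfields B"
      "u (p x) = dp (X x)" "v (p x) = dp (Y x)" "w (p x) = dp (Z x)" for X Y Z u v w x
    using C.ext_d_hlift[OF that(1-4,7,5,8,6,9)] hd[OF that(4-6)] by simp
  moreover have "\<eta> x [v, w] = 0" if "v \<in> Vert x" "w \<in> Vert x" for x v w
    using Vz(1)[OF that(1) vertical_tangent[OF that(2)]] .
  ultimately show ?thesis using f\<eta> by (intro exI[of _ \<eta>]) simp
qed

section \<open>A closed extension when the class on the base vanishes\<close>

lemma closed_extension:
  assumes \<phi>: "closed_up_to_base A B p \<omega>\<^sub>V \<omega> \<phi>"
    and exact: "deRham_class B 3 \<phi> = deRham_class B 3 (\<lambda>b vs. 0)"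
  shows "\<exists>\<omega>'. closed_form A (tangent A) 2 \<omega>' \<and> extends_vertical A B p \<omega>' \<omega>\<^sub>V"
proof -
  have f\<omega>: "form A (tangent A) 2 \<omega>" and ext: "extends_vertical A B p \<omega> \<omega>\<^sub>V" and c\<phi>: "closed_form B (tangent B) 3 \<phi>"
    and d\<omega>: "\<And>X Y Z x. X \<in> vfields A \<Longrightarrow> Y \<in> vfields A \<Longrightarrow> Z \<in> vfields A \<Longrightarrow>
        ext_d \<omega> [X, Y, Z] x = apply_form (pullback B p \<phi>) [X, Y, Z] x"
    using \<phi> unfolding closed_up_to_base_def by blast+
  \<comment> \<open>The class is a set of forms, so its vanishing is an equality of sets. That
    \<phi> belongs to its own class, with the zero form as primitive of \<phi> - \<phi>, is what
    lets the equality produce a primitive of \<phi>.\<close>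
  have "form B (tangent B) 2 (\<lambda>b vs. 0)"
    unfolding B.form2_iff[OF B.linear_distribution_tangent] by (simp add: B.smooth_fun_const)
  moreover have "ext_d (\<lambda>b vs. 0) Xs x = 0" if Xs: "length Xs = 3" "set Xs \<subseteq> vfields B" for Xs x
  proof -
    obtain X Y Z where XYZ: "Xs = [X, Y, Z]" using Xs(1) by (auto simp: length_Suc_conv numeral_3_eq_3)
    then have "X \<in> vfields B" "Y \<in> vfields B" "Z \<in> vfields B" using Xs(2) by auto
    then show ?thesis unfolding XYZ ext_d_3 by (simp add: B.tangent_const[OF B.vfields_tangent])
  qed
  ultimately have "\<phi> \<in> deRham_class B 3 \<phi>"
    unfolding deRham_class_def using c\<phi> by (intro CollectI conjI exI[of _ "\<lambda>b vs. 0"]) auto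
  then have "\<phi> \<in> deRham_class B 3 (\<lambda>b vs. 0)" using exact by simp
  then obtain \<beta> where \<beta>: "form B (tangent B) 2 \<beta>"
    and d\<beta>: "\<forall>Xs x. length Xs = 3 \<longrightarrow> set Xs \<subseteq> vfields B \<longrightarrow>
      apply_form \<phi> Xs x - apply_form (\<lambda>b vs. 0) Xs x = ext_d \<beta> Xs x"
    unfolding deRham_class_def by auto
  obtain \<eta> where f\<eta>: "form A (tangent A) 2 \<eta>" and \<eta>0: "\<forall>x. \<forall>v\<in>Vert x. \<forall>w\<in>Vert x. \<eta> x [v, w] = 0"
    and d\<eta>: "\<forall>X Y Z u v w x. X \<in> vfields A \<longrightarrow> Y \<in> vfields A \<longrightarrow> Z \<in> vfields A \<longrightarrow>
       u \<in> vfields B \<longrightarrow> v \<in> vfields B \<longrightarrow> w \<in> vfields B \<longrightarrow>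
       u (p x) = dp (X x) \<longrightarrow> v (p x) = dp (Y x) \<longrightarrow> w (p x) = dp (Z x) \<longrightarrow>
       ext_d \<eta> [X, Y, Z] x = ext_d \<beta> [u, v, w] (p x)"
    using pullback_two_form[OF \<beta>] by (elim exE conjE)
  let ?\<omega>' = "\<lambda>x vs. \<omega> x vs - \<eta> x vs"
  have "ext_d ?\<omega>' Xs x = 0" if Xs: "length Xs = Suc 2" "set Xs \<subseteq> vfields A" for Xs x
  proof -
    obtain X Y Z where XYZ: "Xs = [X, Y, Z]" using Xs(1) by (auto simp: length_Suc_conv numeral_2_eq_2)
    then have V: "X \<in> vfields A" "Y \<in> vfields A" "Z \<in> vfields A" using Xs(2) by auto
    obtain u where u: "u \<in> vfields B" "u (p x) = dp (X x)"
      using B.tangent_extension[OF dp_tangent[OF M.vfields_tangent[OF V(1)]]] by blast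
    obtain v where v: "v \<in> vfields B" "v (p x) = dp (Y x)"
      using B.tangent_extension[OF dp_tangent[OF M.vfields_tangent[OF V(2)]]] by blast
    obtain w where w: "w \<in> vfields B" "w (p x) = dp (Z x)"
      using B.tangent_extension[OF dp_tangent[OF M.vfields_tangent[OF V(3)]]] by blast
    have "ext_d \<omega> [X, Y, Z] x = apply_form \<phi> [u, v, w] (p x)"
      using d\<omega>[OF V] by (simp add: apply_form_def pullback_def u v w)
    also have "\<dots> = ext_d \<beta> [u, v, w] (p x)"
      using d\<beta>[rule_format, of "[u, v, w]" "p x"] u(1) v(1) w(1) by (simp add: apply_form_def)
    also have "\<dots> = ext_d \<eta> [X, Y, Z] x" using d\<eta> V u v w by simp
    finally show ?thesis unfolding XYZ M.ext_d_diff[OF f\<omega> f\<eta> V] by simp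
  qed
  then have "closed_form A (tangent A) 2 ?\<omega>'"
    unfolding closed_form_def using M.form2_diff[OF f\<omega> f\<eta>] by blast
  moreover have "extends_vertical A B p ?\<omega>' \<omega>\<^sub>V"
    using ext \<eta>0 unfolding extends_vertical_def by simp
  ultimately show ?thesis by (intro exI conjI)
qed

end

text \<open>The second part is quantified over all pairs (\<omega>, \<phi>), so vanishing of the
  class may be tested on any available \<phi> and not only on the one constructed for the first
  part.\<close>

theorem proposition5:
  fixes A :: "('m::{second_countable_topology, t2_space}, 'e::real_inner) atlas"
    and B :: "('b::{second_countable_topology, t2_space}, 'd::real_inner) atlas"
    and p :: "'m \<Rightarrow> 'b"
    and \<omega>\<^sub>V :: "'m form"
  assumes symplectic: "symplectic_fibration A B p \<omega>\<^sub>V"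
    and connected_fibres: "\<And>b. connected (p -` {b})"
    and hamiltonian: "\<exists>Hor. symplectic_connection A B p \<omega>\<^sub>V Hor \<and> hamiltonian_curvature A B p \<omega>\<^sub>V Hor"
  shows "(\<exists>\<omega> \<phi>. closed_up_to_base A B p \<omega>\<^sub>V \<omega> \<phi>) \<and>
    (\<forall>\<omega> \<phi>. closed_up_to_base A B p \<omega>\<^sub>V \<omega> \<phi> \<longrightarrow>
       deRham_class B 3 \<phi> = deRham_class B 3 (\<lambda>b vs. 0) \<longrightarrow>
       (\<exists>\<omega>'. closed_form A (tangent A) 2 \<omega>' \<and> extends_vertical A B p \<omega>' \<omega>\<^sub>V))"
proof -
  obtain Hor where Hor: "symplectic_connection A B p \<omega>\<^sub>V Hor" "hamiltonian_curvature A B p \<omega>\<^sub>V Hor"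
    using hamiltonian by (elim exE conjE)
  have fib: "smooth_atlas A" "smooth_atlas B" "submersion A B p" "surj p"
    using symplectic by (simp_all add: symplectic_fibration_def fibration_def)
  have closed: "closed_form A (vertical A B p) 2 \<omega>\<^sub>V" using symplectic by (simp add: symplectic_fibration_def)
  have "ehresmann_connection A B p Hor" using Hor(1) by (simp add: symplectic_connection_def)
  with fib interpret fibred_connection A B p Hor by unfold_locales
  show ?thesis
    using symplectic_extension[OF closed Hor connected_fibres] closed_extension by (intro conjI allI impI)
qed

end
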